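(* Let $n\geq 2$. There is no symplectic star product on the complex projective space $\mathbb{CP}^{n-1}$ (that is, no star product for the Poisson structure of any symplectic form on $\mathbb{CP}^{n-1}$) induced by a twist based on $U(\mathfrak{gl}_n(\mathbb{C}))[[h]]$ or any sub-bialgebra of it.
   Context: Conventions. Algebras are unital and associative, over $\mathbb{C}$ or over $\mathbb{C}[[h]]$. $C^\infty(M)$ denotes the complex-valued smooth functions on $M$. For a complex vector space $V$, $V[[h]]$ is the $\mathbb{C}[[h]]$-module of formal power series in $h$ with coefficients in $V$. For a Lie group $G$ with Lie algebra $\mathfrak{g}$, $U(\mathfrak{g})$ is the universal enveloping algebra of $\mathfrak{g}$ with complex coefficients (i.e. of $\mathfrak{g}\otimes_{\mathbb{R}}\mathbb{C}$), with its standard coproduct $\Delta$ and counit $\varepsilon$ extended $\mathbb{C}[[h]]$-linearly to $U(\mathfrak{g})[[h]]$; tensor products over $\mathbb{C}[[h]]$ are completed in the $h$-adic topology. Here $G=GL_n(\mathbb{C})$, viewed as a (real) Lie group with Lie algebra $\mathfrak{g}=\mathfrak{gl}_n(\mathbb{C})$, acts on $M=\mathbb{CP}^{n-1}$, the manifold of lines through the origin in $\mathbb{C}^n$, by the action induced by matrix multiplication on $\mathbb{C}^n$. Star product. A star product on a Poisson manifold $M$ is a $\mathbb{C}[[h]]$-bilinear associative binary operation $\ast$ on $C^\infty(M)[[h]]$ of the form $f\ast g=\sum_{k=0}^\infty h^kB_k(f,g)$ for $f,g\in C^\infty(M)$, where each $B_k$ is a bi-differential operator, $B_0(f,g)=fg$,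 $B_1(f,g)-B_1(g,f)=\mathrm{i}\{f,g\}$ with $\{\cdot,\cdot\}$ the Poisson bracket, and $f\ast 1=1\ast f=f$. It is called symplectic if the Poisson bracket comes from a symplectic form on $M$. Twist. A (formal cocycle) twist based on a (topological) $\mathbb{C}[[h]]$-bialgebra $U$ (here $U=U(\mathfrak{g})[[h]]$ or a sub-bialgebra of it) is an invertible element $F$ of the completed tensor product $U\hat\otimes U$ such that $(F\otimes 1)(\Delta\otimes\mathrm{Id})(F)=(1\otimes F)(\mathrm{Id}\otimes\Delta)(F)$, $(\varepsilon\otimes\mathrm{Id})(F)=(\mathrm{Id}\otimes\varepsilon)(F)=1$, and $F=1\otimes 1 \bmod h$. Star product induced by a twist. $G$ acts on $C^\infty(M)$ by $(\alpha_gf)(x)=f(g^{-1}x)$; differentiating gives an action $\triangleright$ of $U(\mathfrak{g})[[h]]$, hence of any sub-bialgebra, on $C^\infty(M)[[h]]$. A star product $\ast$ is induced by the twist $F$ if $f\ast g=m\big(F^{-1}(\triangleright\otimes\triangleright)(f\otimes g)\big)$ for all $f,g\in C^\infty(M)[[h]]$, where $m$ is the pointwise multiplication. *)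

theory Defs
  imports
    "HOL-Analysis.Analysis"
    "HOL-Computational_Algebra.Formal_Power_Series"
    "HOL-Library.Poly_Mapping"
    "HOL-Library.Function_Algebras"
begin

section \<open>Complex vector spaces and algebras\<close>

class complex_vector = ab_group_add +
  fixes scaleC :: "complex \<Rightarrow> 'a \<Rightarrow> 'a"  (infixr "*\<^sub>C" 75)
  assumes scaleC_add_right: "c *\<^sub>C (x + y) = c *\<^sub>C x + c *\<^sub>C y"
    and scaleC_add_left: "(c + d) *\<^sub>C x = c *\<^sub>C x + d *\<^sub>C x"
    and scaleC_scaleC: "c *\<^sub>C d *\<^sub>C x = (c * d) *\<^sub>C x"
    and scaleC_one: "1 *\<^sub>C x = x"

class complex_algebra_1 = complex_vector + ring_1 +
  assumes mult_scaleC_left: "(c *\<^sub>C x) * y = c *\<^sub>C (x * y)"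
    and mult_scaleC_right: "x * (c *\<^sub>C y) = c *\<^sub>C (x * y)"

global_interpretation complex_vector: vector_space "scaleC :: complex \<Rightarrow> 'a \<Rightarrow> 'a::complex_vector"
  by standard (simp_all add: scaleC_add_right scaleC_add_left scaleC_scaleC scaleC_one)

instantiation complex :: complex_algebra_1
begin

definition scaleC_complex :: "complex \<Rightarrow> complex \<Rightarrow> complex"
  where "scaleC_complex c x = c * x"

instance
  by standard (simp_all add: scaleC_complex_def algebra_simps)

end

instantiation "fun" :: (type, complex_vector) complex_vector
begin

definition scaleC_fun :: "complex \<Rightarrow> ('a \<Rightarrow> 'b) \<Rightarrow> 'a \<Rightarrow> 'b"
  where "scaleC_fun c f = (\<lambda>x. c *\<^sub>C f x)"

instance
  by standard
    (simp_all add: scaleC_fun_def fun_eq_iff scaleC_add_right scaleC_add_left scaleC_scaleC scaleC_one)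

end

instantiation poly_mapping :: (type, complex_vector) complex_vector
begin

definition scaleC_poly_mapping :: "complex \<Rightarrow> ('a \<Rightarrow>\<^sub>0 'b) \<Rightarrow> 'a \<Rightarrow>\<^sub>0 'b"
  where "scaleC_poly_mapping c p = Poly_Mapping.map (scaleC c) p"

lemma lookup_scaleC: "Poly_Mapping.lookup (c *\<^sub>C p) k = c *\<^sub>C Poly_Mapping.lookup p k"
  for p :: "'a \<Rightarrow>\<^sub>0 'b"
  by (simp add: scaleC_poly_mapping_def map.rep_eq when_def)

instance
  by standard
    (auto intro!: poly_mapping_eqI
      simp: lookup_scaleC lookup_add scaleC_add_right scaleC_add_left scaleC_scaleC scaleC_one)

end

definition clinear :: "('a::complex_vector \<Rightarrow> 'b::complex_vector) \<Rightarrow> bool" where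
  "clinear f \<longleftrightarrow> (\<forall>x y. f (x + y) = f x + f y) \<and> (\<forall>c x. f (c *\<^sub>C x) = c *\<^sub>C f x)"

definition cbilinear :: "('a::complex_vector \<Rightarrow> 'b::complex_vector \<Rightarrow> 'c::complex_vector) \<Rightarrow> bool" where
  "cbilinear B \<longleftrightarrow> (\<forall>a. clinear (B a)) \<and> (\<forall>b. clinear (\<lambda>a. B a b))"

definition lin_ext :: "('k \<Rightarrow> 'v) \<Rightarrow> ('k \<Rightarrow>\<^sub>0 complex) \<Rightarrow> 'v::complex_vector" where
  "lin_ext \<phi> p = (\<Sum>k\<in>Poly_Mapping.keys p. Poly_Mapping.lookup p k *\<^sub>C \<phi> k)"

lemma lin_ext_superset:
  assumes "finite A" "Poly_Mapping.keys p \<subseteq> A"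
  shows "lin_ext \<phi> p = (\<Sum>k\<in>A. Poly_Mapping.lookup p k *\<^sub>C \<phi> k)"
  unfolding lin_ext_def using assms
  by (intro sum.mono_neutral_left) (auto simp: in_keys_iff)

lemma lin_ext_add: "lin_ext \<phi> (p + q) = lin_ext \<phi> p + lin_ext \<phi> q"
proof -
  let ?A = "Poly_Mapping.keys p \<union> Poly_Mapping.keys q"
  have "Poly_Mapping.keys (p + q) \<subseteq> ?A" by (rule Poly_Mapping.keys_add)
  then show ?thesis
    by (simp add: lin_ext_superset[of ?A] lookup_add scaleC_add_left sum.distrib)
qed

lemma lin_ext_scaleC: "lin_ext \<phi> (c *\<^sub>C p) = c *\<^sub>C lin_ext \<phi> p"
proof -
  have "Poly_Mapping.keys (c *\<^sub>C p) \<subseteq> Poly_Mapping.keys p"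
    by (auto simp: in_keys_iff lookup_scaleC)
  then show ?thesis
    by (simp add: lin_ext_superset[of "Poly_Mapping.keys p"] lookup_scaleC scaleC_complex_def
        complex_vector.scale_sum_right scaleC_scaleC)
qed

lemma clinear_lin_ext: "clinear (lin_ext \<phi>)"
  by (simp add: clinear_def lin_ext_add lin_ext_scaleC)

lemma lin_ext_single: "lin_ext \<phi> (Poly_Mapping.single k c) = c *\<^sub>C \<phi> k"
  by (simp add: lin_ext_def)

lemma lin_ext_diff: "lin_ext \<phi> (p - q) = lin_ext \<phi> p - lin_ext \<phi> q"
  using lin_ext_add[of \<phi> "p - q" q] by simp

lemma lin_ext_zero: "lin_ext \<phi> 0 = 0"
  by (simp add: lin_ext_def)

lemma lin_ext_fun_add: "lin_ext (\<lambda>k. \<phi> k + \<psi> k) p = lin_ext \<phi> p + lin_ext \<psi> p"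
  by (simp add: lin_ext_def scaleC_add_right sum.distrib)

lemma lin_ext_fun_scaleC: "lin_ext (\<lambda>k. c *\<^sub>C \<phi> k) p = c *\<^sub>C lin_ext \<phi> p"
  by (simp add: lin_ext_def complex_vector.scale_sum_right scaleC_scaleC mult.commute)

lemma poly_mapping_single_induct:
  assumes "\<And>k c. P (Poly_Mapping.single k c)" "\<And>p q. P p \<Longrightarrow> P q \<Longrightarrow> P (p + q)"
  shows "P (p :: 'k \<Rightarrow>\<^sub>0 'v::comm_monoid_add)"
proof -
  have z: "P 0" using assms(1)[of undefined 0] by simp
  have "P (\<Sum>k\<in>A. Poly_Mapping.single k (Poly_Mapping.lookup p k))" if "finite A" for A
    using that by (induction A) (auto simp: z intro: assms)
  moreover have "p = (\<Sum>k\<in>Poly_Mapping.keys p. Poly_Mapping.single k (Poly_Mapping.lookup p k))"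
    by (rule poly_mapping_eqI) (simp add: lookup_sum lookup_single when_def in_keys_iff sum.delta)
  ultimately show ?thesis
    by (metis finite_keys)
qed


section \<open>Tensor products of complex vector spaces and of complex algebras\<close>

definition tensor_relators :: "('a::complex_vector \<times> 'b::complex_vector \<Rightarrow>\<^sub>0 complex) set" where
  "tensor_relators =
     {Poly_Mapping.single (a + a', b) 1 - Poly_Mapping.single (a, b) 1
        - Poly_Mapping.single (a', b) 1 | a a' b. True}
   \<union> {Poly_Mapping.single (a, b + b') 1 - Poly_Mapping.single (a, b) 1
        - Poly_Mapping.single (a, b') 1 | a b b'. True}
   \<union> {Poly_Mapping.single (c *\<^sub>C a, b) 1 - c *\<^sub>C Poly_Mapping.single (a, b) 1 | a b c. True}
   \<union> {Poly_Mapping.single (a, c *\<^sub>C b) 1 - c *\<^sub>C Poly_Mapping.single (a, b) 1 | a b c. True}"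

definition tensor_eq :: "('a::complex_vector \<times> 'b::complex_vector \<Rightarrow>\<^sub>0 complex) \<Rightarrow> _ \<Rightarrow> bool" where
  "tensor_eq p q \<longleftrightarrow> p - q \<in> complex_vector.span tensor_relators"

quotient_type (overloaded) ('a, 'b) tensor =
  "('a::complex_vector \<times> 'b::complex_vector) \<Rightarrow>\<^sub>0 complex" / tensor_eq
proof (rule equivpI)
  let ?R = "tensor_eq :: ('a \<times> 'b \<Rightarrow>\<^sub>0 complex) \<Rightarrow> _"
  show "reflp ?R"
    by (auto simp: reflp_def tensor_eq_def complex_vector.span_zero)
  show "symp ?R"
  proof (rule sympI)
    fix p q :: "'a \<times> 'b \<Rightarrow>\<^sub>0 complex"
    assume "tensor_eq p q"
    then have "- (p - q) \<in> complex_vector.span tensor_relators"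
      unfolding tensor_eq_def by (rule complex_vector.span_neg)
    then show "tensor_eq q p" by (simp add: tensor_eq_def)
  qed
  show "transp ?R"
  proof (rule transpI)
    fix p q r :: "'a \<times> 'b \<Rightarrow>\<^sub>0 complex"
    assume "tensor_eq p q" "tensor_eq q r"
    then have "(p - q) + (q - r) \<in> complex_vector.span tensor_relators"
      unfolding tensor_eq_def by (rule complex_vector.span_add)
    then show "tensor_eq p r" by (simp add: tensor_eq_def)
  qed
qed

instantiation tensor :: (complex_vector, complex_vector) complex_vector
begin

lift_definition zero_tensor :: "('a, 'b) tensor" is 0 .

lift_definition plus_tensor :: "('a, 'b) tensor \<Rightarrow> ('a, 'b) tensor \<Rightarrow> ('a, 'b) tensor" is "(+)"
  unfolding tensor_eq_def add_diff_add by (rule complex_vector.span_add)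

lift_definition uminus_tensor :: "('a, 'b) tensor \<Rightarrow> ('a, 'b) tensor" is uminus
  unfolding tensor_eq_def minus_diff_minus by (rule complex_vector.span_neg)

lift_definition minus_tensor :: "('a, 'b) tensor \<Rightarrow> ('a, 'b) tensor \<Rightarrow> ('a, 'b) tensor" is "(-)"
proof -
  fix p p' q q' :: "'a \<times> 'b \<Rightarrow>\<^sub>0 complex"
  assume "tensor_eq p p'" "tensor_eq q q'"
  then have "(p - p') - (q - q') \<in> complex_vector.span tensor_relators"
    unfolding tensor_eq_def by (rule complex_vector.span_diff)
  moreover have "(p - p') - (q - q') = (p - q) - (p' - q')" by (simp add: algebra_simps)
  ultimately show "tensor_eq (p - q) (p' - q')" by (simp add: tensor_eq_def)
qed

lift_definition scaleC_tensor :: "complex \<Rightarrow> ('a, 'b) tensor \<Rightarrow> ('a, 'b) tensor" is scaleC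
  unfolding tensor_eq_def complex_vector.scale_right_diff_distrib[symmetric]
  by (rule complex_vector.span_scale)

instance
  by (standard; transfer)
    (simp_all add: tensor_eq_def algebra_simps complex_vector.span_zero scaleC_add_right
      scaleC_add_left scaleC_scaleC scaleC_one)

end

lift_definition tensor_of :: "'a::complex_vector \<Rightarrow> 'b::complex_vector \<Rightarrow> ('a, 'b) tensor"  (infixr "\<otimes>" 72)
  is "\<lambda>a b. Poly_Mapping.single (a, b) 1" .

text \<open>The linear map on the tensor product induced by a bilinear map \<open>B\<close>; independence of the
  chosen representative is lemma \<open>tensor_lift_abs\<close>.\<close>

definition tensor_lift ::
  "('a \<Rightarrow> 'b \<Rightarrow> 'v) \<Rightarrow> ('a::complex_vector, 'b::complex_vector) tensor \<Rightarrow> 'v::complex_vector" where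
  "tensor_lift B t = lin_ext (\<lambda>(a, b). B a b) (rep_tensor t)"

lemma lin_ext_span_relators:
  assumes "cbilinear B" "p \<in> complex_vector.span tensor_relators"
  shows "lin_ext (\<lambda>(a, b). B a b) p = 0"
  using assms(2)
proof (induction rule: complex_vector.span_induct)
  case base
  show ?case
    by (auto simp: complex_vector.subspace_def lin_ext_zero lin_ext_add lin_ext_scaleC)
next
  case (step x)
  then show ?case using assms(1)
    by (auto simp: tensor_relators_def lin_ext_diff lin_ext_scaleC lin_ext_single scaleC_one
        cbilinear_def clinear_def)
qed

lemma tensor_lift_abs:
  assumes "cbilinear B"
  shows "tensor_lift B (abs_tensor p) = lin_ext (\<lambda>(a, b). B a b) p"
proof -
  have "tensor_eq (rep_tensor (abs_tensor p)) p"
    by (intro rep_abs_rsp_left[OF Quotient3_tensor] equivp_reflp[OF tensor_equivp])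
  then have "lin_ext (\<lambda>(a, b). B a b) (rep_tensor (abs_tensor p) - p) = 0"
    unfolding tensor_eq_def by (rule lin_ext_span_relators[OF assms])
  then show ?thesis by (simp add: tensor_lift_def lin_ext_diff)
qed

lemma tensor_lift_of: "cbilinear B \<Longrightarrow> tensor_lift B (a \<otimes> b) = B a b"
  by (simp add: tensor_of.abs_eq tensor_lift_abs lin_ext_single scaleC_one)

lemma clinear_tensor_lift:
  assumes "cbilinear B" shows "clinear (tensor_lift B)"
  unfolding clinear_def
proof (intro conjI allI)
  show "tensor_lift B (x + y) = tensor_lift B x + tensor_lift B y" for x y
    by (induction x; induction y)
      (simp add: plus_tensor.abs_eq tensor_lift_abs[OF assms] lin_ext_add)
  show "tensor_lift B (c *\<^sub>C x) = c *\<^sub>C tensor_lift B x" for c x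
    by (induction x) (simp add: scaleC_tensor.abs_eq tensor_lift_abs[OF assms] lin_ext_scaleC)
qed

lemma tensor_lift_fun_add:
  "tensor_lift (\<lambda>a b. B a b + C a b) t = tensor_lift B t + tensor_lift C t"
  unfolding tensor_lift_def lin_ext_fun_add[symmetric] by (simp add: case_prod_unfold)

lemma tensor_lift_fun_scaleC: "tensor_lift (\<lambda>a b. c *\<^sub>C B a b) t = c *\<^sub>C tensor_lift B t"
  unfolding tensor_lift_def lin_ext_fun_scaleC[symmetric] by (simp add: case_prod_unfold)

lemma tensor_of_linear:
  "(a + a') \<otimes> b = a \<otimes> b + a' \<otimes> b" "a \<otimes> (b + b') = a \<otimes> b + a \<otimes> b'"
  "(c *\<^sub>C a) \<otimes> b = c *\<^sub>C (a \<otimes> b)" "a \<otimes> (c *\<^sub>C b) = c *\<^sub>C (a \<otimes> b)"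
  by (transfer, unfold tensor_eq_def, rule complex_vector.span_base,
      unfold tensor_relators_def diff_diff_eq[symmetric], blast)+

lemma cbilinear_tensor_of: "cbilinear (\<otimes>)"
  by (simp add: cbilinear_def clinear_def tensor_of_linear)

lemma tensor_induct [case_names pure add]:
  assumes pure: "\<And>a b. P (a \<otimes> b)" and add: "\<And>x y. P x \<Longrightarrow> P y \<Longrightarrow> P (x + y)"
  shows "P t"
proof (induction t rule: tensor.abs_induct)
  case (1 p)
  show ?case
  proof (induction p rule: poly_mapping_single_induct)
    case (1 k c)
    obtain a b where k: "k = (a, b)" by force
    have "Poly_Mapping.single (a, b) c = c *\<^sub>C Poly_Mapping.single (a, b) 1"
      by (rule poly_mapping_eqI) (simp add: lookup_scaleC scaleC_complex_def lookup_single when_def)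
    then have "abs_tensor (Poly_Mapping.single k c) = c *\<^sub>C (a \<otimes> b)"
      by (simp add: k tensor_of.abs_eq scaleC_tensor.abs_eq)
    then show ?case using pure[of "c *\<^sub>C a" b] by (simp add: tensor_of_linear)
  next
    case (2 p q)
    then show ?case using add by (metis plus_tensor.abs_eq)
  qed
qed

lemma complex_functional_exists:
  assumes "(v :: 'a::complex_vector) \<noteq> 0"
  shows "\<exists>\<phi> :: 'a \<Rightarrow> complex. clinear \<phi> \<and> \<phi> v = 1"
proof -
  interpret vector_space_pair "scaleC :: complex \<Rightarrow> 'a \<Rightarrow> 'a" "scaleC :: complex \<Rightarrow> complex \<Rightarrow> complex"
    by unfold_locales
  have "complex_vector.independent {v}" using assms by simp
  from linear_independent_extend[OF this, of "\<lambda>_. 1"] obtain g where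
    g: "Vector_Spaces.linear scaleC (scaleC :: complex \<Rightarrow> complex \<Rightarrow> complex) g" "g v = 1"
    by auto
  then have "clinear g"
    by (simp add: clinear_def Vector_Spaces.linear_iff)
  then show ?thesis using g(2) by blast
qed

instantiation tensor :: (complex_algebra_1, complex_algebra_1) complex_algebra_1
begin

definition one_tensor :: "('a, 'b) tensor"
  where "one_tensor = 1 \<otimes> 1"

definition times_tensor :: "('a, 'b) tensor \<Rightarrow> ('a, 'b) tensor \<Rightarrow> ('a, 'b) tensor"
  where "times_tensor x y = tensor_lift (\<lambda>a b. tensor_lift (\<lambda>c d. (a * c) \<otimes> (b * d)) y) x"

lemma times_tensor_bilinear:
  fixes y :: "('a, 'b) tensor"
  shows "cbilinear (\<lambda>c d. (a * c) \<otimes> (b * d) :: ('a, 'b) tensor)"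
    and "cbilinear (\<lambda>a b. tensor_lift (\<lambda>c d. (a * c) \<otimes> (b * d)) y)"
  by (simp_all add: cbilinear_def clinear_def distrib_left distrib_right mult_scaleC_left
      mult_scaleC_right tensor_of_linear tensor_lift_fun_add tensor_lift_fun_scaleC)

lemma tensor_mult_of: "(a \<otimes> b) * (c \<otimes> d) = (a * c) \<otimes> (b * d :: 'b)" for a c :: 'a
  unfolding times_tensor_def tensor_lift_of[OF times_tensor_bilinear(2)]
  by (rule tensor_lift_of[OF times_tensor_bilinear(1)])

lemma tensor_mult_linear:
  fixes x y z :: "('a, 'b) tensor"
  shows "(x + y) * z = x * z + y * z" "x * (y + z) = x * y + x * z"
    "(c *\<^sub>C x) * y = c *\<^sub>C (x * y)" "x * (c *\<^sub>C y) = c *\<^sub>C (x * y)"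
proof -
  note outer = clinear_tensor_lift[OF times_tensor_bilinear(2), unfolded clinear_def]
  note inner = clinear_tensor_lift[OF times_tensor_bilinear(1), unfolded clinear_def]
  show "(x + y) * z = x * z + y * z" "(c *\<^sub>C x) * y = c *\<^sub>C (x * y)"
    by (simp_all add: times_tensor_def outer)
  show "x * (y + z) = x * y + x * z" "x * (c *\<^sub>C y) = c *\<^sub>C (x * y)"
    by (simp_all add: times_tensor_def inner tensor_lift_fun_add tensor_lift_fun_scaleC)
qed

instance
proof
  fix x y z :: "('a, 'b) tensor" and c :: complex
  show "(x + y) * z = x * z + y * z" "x * (y + z) = x * y + x * z"
    "(c *\<^sub>C x) * y = c *\<^sub>C (x * y)" "x * (c *\<^sub>C y) = c *\<^sub>C (x * y)"
    by (rule tensor_mult_linear)+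
  show "(x * y) * z = x * (y * z)"
  proof (induction x rule: tensor_induct)
    case (pure a b)
    show ?case
    proof (induction y rule: tensor_induct)
      case (pure a' b')
      show ?case
        by (induction z rule: tensor_induct)
          (simp_all add: tensor_mult_of tensor_mult_linear mult.assoc)
    qed (simp add: tensor_mult_linear)
  qed (simp add: tensor_mult_linear)
  show "1 * x = x" "x * 1 = x"
    by (induction x rule: tensor_induct)
      (simp_all add: one_tensor_def tensor_mult_of tensor_mult_linear)
  obtain \<phi> :: "'a \<Rightarrow> complex" where \<phi>: "clinear \<phi>" "\<phi> 1 = 1"
    using complex_functional_exists[of "1 :: 'a"] by auto
  obtain \<psi> :: "'b \<Rightarrow> complex" where \<psi>: "clinear \<psi>" "\<psi> 1 = 1"
    using complex_functional_exists[of "1 :: 'b"] by auto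
  have bil: "cbilinear (\<lambda>a b. \<phi> a * \<psi> b)"
    using \<phi>(1) \<psi>(1)
    by (simp add: cbilinear_def clinear_def algebra_simps scaleC_complex_def)
  have "tensor_lift (\<lambda>a b. \<phi> a * \<psi> b) 1 = 1"
    by (simp add: one_tensor_def tensor_lift_of[OF bil] \<phi> \<psi>)
  moreover have "tensor_lift (\<lambda>a b. \<phi> a * \<psi> b) 0 = 0"
    using clinear_tensor_lift[OF bil] unfolding clinear_def by (metis add_cancel_right_right)
  ultimately show "(0 :: ('a, 'b) tensor) \<noteq> 1" by auto
qed

end

definition tensor_map ::
  "('a \<Rightarrow> 'c) \<Rightarrow> ('b \<Rightarrow> 'd) \<Rightarrow> ('a::complex_vector, 'b::complex_vector) tensor
     \<Rightarrow> ('c::complex_vector, 'd::complex_vector) tensor" where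
  "tensor_map f g = tensor_lift (\<lambda>a b. f a \<otimes> g b)"

definition tensor_assoc ::
  "(('a, 'b) tensor, 'c) tensor \<Rightarrow> ('a::complex_vector, ('b::complex_vector, 'c::complex_vector) tensor) tensor"
  where "tensor_assoc = tensor_lift (\<lambda>ab c. tensor_lift (\<lambda>a b. a \<otimes> (b \<otimes> c)) ab)"


section \<open>The universal enveloping algebra of \<open>gl\<^sub>n(\<complex>)\<close>\<close>

text \<open>Lists form a monoid under concatenation, so \<open>'a list \<Rightarrow>\<^sub>0 complex\<close>, with the convolution
  product, is the free unital associative complex algebra on the set \<open>'a\<close>.\<close>

instantiation list :: (type) monoid_add
begin

definition zero_list :: "'a list" where "zero_list = []"

definition plus_list :: "'a list \<Rightarrow> 'a list \<Rightarrow> 'a list" where "plus_list = (@)"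

instance
  by standard (simp_all add: zero_list_def plus_list_def)

end

lemma scaleC_single: "c *\<^sub>C Poly_Mapping.single k d = Poly_Mapping.single k (c * d)"
  by (rule poly_mapping_eqI) (simp add: lookup_scaleC scaleC_complex_def lookup_single when_def)

lemma poly_mapping_mult_scaleC:
  fixes p q :: "'k::monoid_add \<Rightarrow>\<^sub>0 complex"
  shows "(c *\<^sub>C p) * q = c *\<^sub>C (p * q)" "p * (c *\<^sub>C q) = c *\<^sub>C (p * q)"
proof -
  have *: "(c *\<^sub>C p) * q = c *\<^sub>C (p * q) \<and> p * (c *\<^sub>C q) = c *\<^sub>C (p * q)"
  proof (induction p rule: poly_mapping_single_induct)
    case (1 k d)
    show ?case
    proof (induction q rule: poly_mapping_single_induct)
      case (1 l e)
      show ?case by (simp add: scaleC_single mult_single mult.left_commute mult.assoc)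
    qed (simp add: scaleC_add_right distrib_left)
  qed (simp add: scaleC_add_right distrib_right)
  show "(c *\<^sub>C p) * q = c *\<^sub>C (p * q)" "p * (c *\<^sub>C q) = c *\<^sub>C (p * q)"
    using * by blast+
qed

definition free_hom :: "('x \<Rightarrow> 'b) \<Rightarrow> ('x list \<Rightarrow>\<^sub>0 complex) \<Rightarrow> 'b::complex_algebra_1" where
  "free_hom f = lin_ext (\<lambda>w. prod_list (map f w))"

lemma free_hom_simps:
  "free_hom f (p + q) = free_hom f p + free_hom f q"
  "free_hom f (p - q) = free_hom f p - free_hom f q"
  "free_hom f (c *\<^sub>C p) = c *\<^sub>C free_hom f p"
  "free_hom f (Poly_Mapping.single [x] 1) = f x"
  "free_hom f 1 = 1"
  by (simp_all add: free_hom_def lin_ext_add lin_ext_diff lin_ext_scaleC lin_ext_single scaleC_one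
      single_one[symmetric] zero_list_def del: single_one)

lemma free_hom_mult: "free_hom f (p * q) = free_hom f p * free_hom f q"
proof (induction p rule: poly_mapping_single_induct)
  case (1 k c)
  show ?case
  proof (induction q rule: poly_mapping_single_induct)
    case (1 l d)
    show ?case
      by (simp add: free_hom_def mult_single lin_ext_single plus_list_def mult_scaleC_left
          mult_scaleC_right scaleC_scaleC mult.commute)
  qed (simp add: distrib_left free_hom_simps)
qed (simp add: distrib_right free_hom_simps)

abbreviation gl_bracket :: "complex^'n^'n \<Rightarrow> complex^'n^'n \<Rightarrow> complex^'n^'n" where
  "gl_bracket A B \<equiv> A ** B - B ** A"

text \<open>Only real-linear relations are imposed on the generators: since the coefficients are
  complex, the quotient is the enveloping algebra of the complexification of \<open>gl\<^sub>n(\<complex>)\<close>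
  regarded as a real Lie algebra.\<close>

inductive_set uea_ideal :: "((complex^'n^'n) list \<Rightarrow>\<^sub>0 complex) set" where
  add_rel: "Poly_Mapping.single [A + B] 1 - Poly_Mapping.single [A] 1 - Poly_Mapping.single [B] 1
              \<in> uea_ideal"
| scale_rel: "Poly_Mapping.single [r *\<^sub>R A] 1 - complex_of_real r *\<^sub>C Poly_Mapping.single [A] 1
              \<in> uea_ideal"
| bracket_rel: "Poly_Mapping.single [A] 1 * Poly_Mapping.single [B] 1
                  - Poly_Mapping.single [B] 1 * Poly_Mapping.single [A] 1
                  - Poly_Mapping.single [gl_bracket A B] 1 \<in> uea_ideal"
| add: "p \<in> uea_ideal \<Longrightarrow> q \<in> uea_ideal \<Longrightarrow> p + q \<in> uea_ideal"
| mult_left: "p \<in> uea_ideal \<Longrightarrow> a * p \<in> uea_ideal"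
| mult_right: "p \<in> uea_ideal \<Longrightarrow> p * a \<in> uea_ideal"

lemma uea_ideal_zero: "0 \<in> uea_ideal"
  using uea_ideal.mult_left[OF uea_ideal.add_rel, of 0] by simp

lemma uea_ideal_uminus: "p \<in> uea_ideal \<Longrightarrow> - p \<in> uea_ideal"
  using uea_ideal.mult_left[of p "-1"] by simp

lemma uea_ideal_diff: "p \<in> uea_ideal \<Longrightarrow> q \<in> uea_ideal \<Longrightarrow> p - q \<in> uea_ideal"
  using uea_ideal.add[of p "- q"] uea_ideal_uminus[of q] by simp

lemma uea_ideal_scaleC: "p \<in> uea_ideal \<Longrightarrow> c *\<^sub>C p \<in> uea_ideal"
  using uea_ideal.mult_left[of p "c *\<^sub>C 1"] by (simp add: poly_mapping_mult_scaleC)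

lemma free_hom_uea_ideal:
  fixes f :: "complex^'n^'n \<Rightarrow> 'b::complex_algebra_1"
  assumes "\<And>A B. f (A + B) = f A + f B" "\<And>r A. f (r *\<^sub>R A) = complex_of_real r *\<^sub>C f A"
    "\<And>A B. f (gl_bracket A B) = f A * f B - f B * f A"
    and "p \<in> uea_ideal"
  shows "free_hom f p = 0"
  using assms(4)
  by induction (simp_all add: free_hom_simps free_hom_mult assms(1-3))

definition uea_eq :: "((complex^'n^'n) list \<Rightarrow>\<^sub>0 complex) \<Rightarrow> _ \<Rightarrow> bool" where
  "uea_eq p q \<longleftrightarrow> p - q \<in> uea_ideal"

quotient_type 'n uea = "(complex^'n^'n) list \<Rightarrow>\<^sub>0 complex" / uea_eq
proof (rule equivpI)
  let ?R = "uea_eq :: ((complex^'n^'n) list \<Rightarrow>\<^sub>0 complex) \<Rightarrow> _"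
  show "reflp ?R"
    by (simp add: reflp_def uea_eq_def uea_ideal_zero)
  show "symp ?R"
    unfolding symp_def uea_eq_def using uea_ideal_uminus by fastforce
  show "transp ?R"
    unfolding transp_def uea_eq_def using uea_ideal.add by fastforce
qed

lemma uea_ideal_add_cong:
  assumes "p - p' \<in> uea_ideal" "q - q' \<in> uea_ideal"
  shows "(p + q) - (p' + q') \<in> uea_ideal" "(p - q) - (p' - q') \<in> uea_ideal"
proof -
  have "(p + q) - (p' + q') = (p - p') + (q - q')" "(p - q) - (p' - q') = (p - p') - (q - q')"
    by (simp_all add: algebra_simps)
  then show "(p + q) - (p' + q') \<in> uea_ideal" "(p - q) - (p' - q') \<in> uea_ideal"
    using uea_ideal.add[OF assms] uea_ideal_diff[OF assms] by metis+
qed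

lemma uea_ideal_mult_cong:
  assumes "p - p' \<in> uea_ideal" "q - q' \<in> uea_ideal"
  shows "p * q - p' * q' \<in> uea_ideal"
proof -
  have "p * q - p' * q' = (p - p') * q + p' * (q - q')"
    by (simp add: algebra_simps)
  then show ?thesis
    using uea_ideal.add[OF uea_ideal.mult_right[OF assms(1)] uea_ideal.mult_left[OF assms(2)]]
    by metis
qed

instantiation uea :: (finite) complex_algebra_1
begin

lift_definition zero_uea :: "'a uea" is 0 .
lift_definition one_uea :: "'a uea" is 1 .
lift_definition plus_uea :: "'a uea \<Rightarrow> 'a uea \<Rightarrow> 'a uea" is "(+)"
  by (simp add: uea_eq_def uea_ideal_add_cong)
lift_definition minus_uea :: "'a uea \<Rightarrow> 'a uea \<Rightarrow> 'a uea" is "(-)"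
  by (simp add: uea_eq_def uea_ideal_add_cong)
lift_definition uminus_uea :: "'a uea \<Rightarrow> 'a uea" is uminus
  by (metis minus_diff_minus uea_eq_def uea_ideal_uminus)
lift_definition times_uea :: "'a uea \<Rightarrow> 'a uea \<Rightarrow> 'a uea" is "(*)"
  by (simp add: uea_eq_def uea_ideal_mult_cong)
lift_definition scaleC_uea :: "complex \<Rightarrow> 'a uea \<Rightarrow> 'a uea" is scaleC
  by (metis complex_vector.scale_right_diff_distrib uea_eq_def uea_ideal_scaleC)

instance
proof
  show "(0 :: 'a uea) \<noteq> 1"
  proof transfer
    have "free_hom (\<lambda>_. 0 :: complex) p = 0" if "p \<in> uea_ideal" for p :: "(complex^'a^'a) list \<Rightarrow>\<^sub>0 complex"
      by (rule free_hom_uea_ideal[OF _ _ _ that]) simp_all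
    from this[of "0 - 1"] show "\<not> uea_eq (0 :: (complex^'a^'a) list \<Rightarrow>\<^sub>0 complex) 1"
      unfolding uea_eq_def free_hom_simps by (auto simp: free_hom_def lin_ext_zero)
  qed
qed (transfer; simp add: uea_eq_def uea_ideal_zero algebra_simps scaleC_add_right scaleC_add_left
      scaleC_scaleC scaleC_one poly_mapping_mult_scaleC)+

end

lift_definition uea_of :: "complex^'n^'n \<Rightarrow> 'n::finite uea" is "\<lambda>A. Poly_Mapping.single [A] 1" .

lemma uea_of_linear: "uea_of (A + B) = uea_of A + uea_of B"
  "uea_of (r *\<^sub>R A) = complex_of_real r *\<^sub>C uea_of A"
  by (transfer, metis diff_diff_eq uea_eq_def uea_ideal.intros(1,2))+

lemma uea_of_bracket: "uea_of (gl_bracket A B) = uea_of A * uea_of B - uea_of B * uea_of A"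
  by (transfer, metis minus_diff_eq uea_eq_def uea_ideal.bracket_rel uea_ideal_uminus)

lift_definition uea_coprod :: "'n::finite uea \<Rightarrow> ('n uea, 'n uea) tensor"
  is "free_hom (\<lambda>A. uea_of A \<otimes> 1 + 1 \<otimes> uea_of A)"
proof -
  fix p q :: "(complex^'n^'n) list \<Rightarrow>\<^sub>0 complex"
  have tdiff: "(x - y) \<otimes> z = x \<otimes> z - y \<otimes> z" "z \<otimes> (x - y) = z \<otimes> x - z \<otimes> y"
    for x y z :: "'n uea"
    using tensor_of_linear(1)[of "x - y" y z] tensor_of_linear(2)[of z "x - y" y] by simp_all
  assume "uea_eq p q"
  then have "free_hom (\<lambda>A. uea_of A \<otimes> (1 :: 'n uea) + (1 :: 'n uea) \<otimes> uea_of A) (p - q) = 0"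
    unfolding uea_eq_def
    by (rule free_hom_uea_ideal[rotated 3])
      (simp_all add: uea_of_linear uea_of_bracket tensor_of_linear tdiff tensor_mult_of
        distrib_left distrib_right scaleC_add_right)
  then show "free_hom (\<lambda>A. uea_of A \<otimes> (1 :: 'n uea) + (1 :: 'n uea) \<otimes> uea_of A) p
      = free_hom (\<lambda>A. uea_of A \<otimes> 1 + 1 \<otimes> uea_of A) q"
    by (simp add: free_hom_simps)
qed

lift_definition uea_counit :: "'n::finite uea \<Rightarrow> complex" is "free_hom (\<lambda>_. 0)"
proof -
  fix p q :: "(complex^'n^'n) list \<Rightarrow>\<^sub>0 complex"
  assume "uea_eq p q"
  then have "free_hom (\<lambda>_. 0 :: complex) (p - q) = 0"
    unfolding uea_eq_def by (rule free_hom_uea_ideal[rotated 3]) simp_all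
  then show "free_hom (\<lambda>_. 0 :: complex) p = free_hom (\<lambda>_. 0) q"
    by (simp add: free_hom_simps)
qed

lemma uea_coprod_simps:
  "uea_coprod (uea_of A) = uea_of A \<otimes> 1 + 1 \<otimes> uea_of A"
  "uea_coprod (x + y) = uea_coprod x + uea_coprod y"
  "uea_coprod (c *\<^sub>C x) = c *\<^sub>C uea_coprod x"
  "uea_coprod (x * y) = uea_coprod x * uea_coprod y"
  "uea_coprod 1 = 1"
  by (transfer; simp add: free_hom_simps free_hom_mult)+

lemma uea_counit_simps:
  "uea_counit (uea_of A) = 0"
  "uea_counit (x + y) = uea_counit x + uea_counit y"
  "uea_counit (c *\<^sub>C x) = c * uea_counit x"
  "uea_counit (x * y) = uea_counit x * uea_counit y"
  "uea_counit 1 = 1"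
  by (transfer; simp add: free_hom_simps free_hom_mult scaleC_complex_def)+


section \<open>Formal power series in \<open>h\<close>, sub-bialgebras and twists\<close>

text \<open>\<open>V[[h]]\<close> is \<open>'v fps\<close>; \<open>U(g)[[h]]\<close> is \<open>'n uea fps\<close>, and its completed tensor square is
  \<open>(U(g) \<otimes> U(g))[[h]]\<close>, i.e. \<open>('n uea, 'n uea) tensor fps\<close>. The next two constants are the
  \<open>\<complex>[[h]]\<close>-linear and \<open>\<complex>[[h]]\<close>-bilinear extensions of linear and bilinear maps.\<close>

definition fps_lin :: "('a \<Rightarrow> 'b) \<Rightarrow> 'a fps \<Rightarrow> 'b fps" where
  "fps_lin f x = Abs_fps (\<lambda>m. f (fps_nth x m))"

definition fps_bilin :: "('a \<Rightarrow> 'b \<Rightarrow> 'c::comm_monoid_add) \<Rightarrow> 'a fps \<Rightarrow> 'b fps \<Rightarrow> 'c fps" where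
  "fps_bilin B x y = Abs_fps (\<lambda>m. \<Sum>i\<le>m. B (fps_nth x i) (fps_nth y (m - i)))"

definition h_adic_sum :: "(nat \<Rightarrow> 'a::comm_monoid_add fps) \<Rightarrow> 'a fps" where
  "h_adic_sum t = Abs_fps (\<lambda>m. \<Sum>k\<le>m. fps_nth (t k) (m - k))"

definition algebraic_tensor :: "'n::finite uea fps set \<Rightarrow> ('n uea, 'n uea) tensor fps set" where
  "algebraic_tensor S =
     {sum_list (map (\<lambda>(a, b). fps_bilin (\<otimes>) a b) xs) | xs. set xs \<subseteq> S \<times> S}"

text \<open>An element of the \<open>h\<close>-adic completion of \<open>S \<otimes> S\<close> (tensor product over \<open>\<complex>[[h]]\<close>) is a
  convergent series \<open>\<Sum>\<^sub>k h\<^sup>k t\<^sub>k\<close> with all \<open>t\<^sub>k\<close> in \<open>S \<otimes> S\<close>; below is the image of this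
  completion in \<open>(U(g) \<otimes> U(g))[[h]]\<close>.\<close>

definition completed_tensor :: "'n::finite uea fps set \<Rightarrow> ('n uea, 'n uea) tensor fps set" where
  "completed_tensor S = {h_adic_sum t | t. \<forall>k. t k \<in> algebraic_tensor S}"

definition sub_bialgebra :: "'n::finite uea fps set \<Rightarrow> bool" where
  "sub_bialgebra S \<longleftrightarrow>
     1 \<in> S \<and> (\<forall>x\<in>S. \<forall>y\<in>S. x + y \<in> S \<and> x * y \<in> S) \<and>
     (\<forall>c. \<forall>x\<in>S. fps_bilin scaleC c x \<in> S) \<and>
     (\<forall>x\<in>S. fps_lin uea_coprod x \<in> completed_tensor S)"

definition twist :: "'n::finite uea fps set \<Rightarrow> ('n uea, 'n uea) tensor fps \<Rightarrow> bool" where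
  "twist S F \<longleftrightarrow>
     F \<in> completed_tensor S \<and> (\<exists>G \<in> completed_tensor S. F * G = 1 \<and> G * F = 1) \<and>
     fps_lin tensor_assoc
         (fps_lin (\<lambda>t. t \<otimes> (1 :: 'n uea)) F * fps_lin (tensor_map uea_coprod id) F)
       = fps_lin (\<lambda>t. (1 :: 'n uea) \<otimes> t) F * fps_lin (tensor_map id uea_coprod) F \<and>
     fps_lin (tensor_lift (\<lambda>a b. uea_counit a *\<^sub>C b)) F = 1 \<and>
     fps_lin (tensor_lift (\<lambda>a b. uea_counit b *\<^sub>C a)) F = 1 \<and>
     fps_nth F 0 = 1"

lemma completed_tensor_UNIV: "completed_tensor (UNIV :: 'n::finite uea fps set) = UNIV"
proof -
  have zero: "(0 :: 'n uea) \<otimes> b = 0" "b \<otimes> (0 :: 'n uea) = 0" for b :: "'n uea"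
    using tensor_of_linear(1)[of "0 :: 'n uea" 0 b] tensor_of_linear(2)[of b "0 :: 'n uea" 0]
    by simp_all
  have const: "\<exists>xs. fps_const x = sum_list (map (\<lambda>(a, b). fps_bilin (\<otimes>) a b) xs)"
    for x :: "('n uea, 'n uea) tensor"
  proof (induction x rule: tensor_induct)
    case (pure a b)
    have "fps_const (a \<otimes> b) = fps_bilin (\<otimes>) (fps_const a) (fps_const b)"
      by (rule fps_ext) (simp add: fps_bilin_def zero sum.neutral)
    then show ?case by (intro exI[of _ "[(fps_const a, fps_const b)]"]) simp
  next
    case (add x y)
    then obtain xs ys where "fps_const x = sum_list (map (\<lambda>(a, b). fps_bilin (\<otimes>) a b) xs)"
      "fps_const y = sum_list (map (\<lambda>(a, b). fps_bilin (\<otimes>) a b) ys)" by blast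
    then show ?case
      by (intro exI[of _ "xs @ ys"]) (simp flip: fps_const_add)
  qed
  have "T \<in> completed_tensor UNIV" for T :: "('n uea, 'n uea) tensor fps"
  proof -
    have "T = h_adic_sum (\<lambda>k. fps_const (fps_nth T k))"
    proof (rule fps_ext)
      fix m
      have "(\<Sum>k\<le>m. fps_nth (fps_const (fps_nth T k)) (m - k)) = (\<Sum>k\<in>{m}. fps_nth T k)"
        by (rule sum.mono_neutral_cong_right) auto
      then show "fps_nth T m = fps_nth (h_adic_sum (\<lambda>k. fps_const (fps_nth T k))) m"
        by (simp add: h_adic_sum_def)
    qed
    moreover have "fps_const (fps_nth T k) \<in> algebraic_tensor UNIV" for k
      using const by (auto simp: algebraic_tensor_def)
    ultimately show ?thesis unfolding completed_tensor_def by blast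
  qed
  then show ?thesis by blast
qed

lemma sub_bialgebra_UNIV: "sub_bialgebra UNIV"
  by (simp add: sub_bialgebra_def completed_tensor_UNIV)


section \<open>Complex projective space and its smooth functions\<close>

typedef 'n cproj = "{L. \<exists>v :: complex^'n::finite. v \<noteq> 0 \<and> L = range (\<lambda>c. c *s v)}"
proof -
  have "(1 :: complex^'n) \<noteq> 0" by (simp add: vec_eq_iff)
  then show ?thesis by blast
qed

definition line :: "complex^'n \<Rightarrow> 'n::finite cproj" where
  "line v = Abs_cproj (range (\<lambda>c. c *s v))"

text \<open>The inverse of the affine chart on \<open>{[z]. z $ i \<noteq> 0}\<close>. It ignores the coordinate \<open>w $ i\<close>, so
  that the chart domain \<open>\<complex>\<^sup>n\<^sup>-\<^sup>1\<close> is represented by \<open>\<complex>\<^sup>n\<close> with one dummy coordinate.\<close>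

definition chart_inv :: "'n \<Rightarrow> complex^'n \<Rightarrow> 'n::finite cproj" where
  "chart_inv i w = line (\<chi> j. if j = i then 1 else w $ j)"

primrec k_times_differentiable ::
  "nat \<Rightarrow> ('a::real_normed_vector \<Rightarrow> 'b::real_normed_vector) \<Rightarrow> bool" where
  "k_times_differentiable 0 f \<longleftrightarrow> continuous_on UNIV f"
| "k_times_differentiable (Suc k) f \<longleftrightarrow> (\<forall>x. f differentiable (at x)) \<and>
     (\<forall>v. k_times_differentiable k (\<lambda>x. frechet_derivative f (at x) v))"

definition smooth :: "('a::real_normed_vector \<Rightarrow> 'b::real_normed_vector) \<Rightarrow> bool" where
  "smooth f \<longleftrightarrow> (\<forall>k. k_times_differentiable k f)"

definition C_inf :: "('n::finite cproj \<Rightarrow> 'b::real_normed_vector) set" where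
  "C_inf = {f. \<forall>i. smooth (\<lambda>w. f (chart_inv i w))}"

definition C_inf_fps :: "('n::finite cproj \<Rightarrow> complex) fps set" where
  "C_inf_fps = {f. \<forall>k. fps_nth f k \<in> C_inf}"


section \<open>Symplectic forms and Poisson brackets\<close>

text \<open>Tangent vectors are point derivations of the real-valued smooth functions; they are set to
  zero on non-smooth functions so that distinct HOL functions are distinct tangent vectors.\<close>

definition tangent :: "'n::finite cproj \<Rightarrow> (('n cproj \<Rightarrow> real) \<Rightarrow> real) set" where
  "tangent p = {u.
     (\<forall>f. f \<notin> C_inf \<longrightarrow> u f = 0) \<and>
     (\<forall>f\<in>C_inf. \<forall>g\<in>C_inf. u (\<lambda>q. f q + g q) = u f + u g) \<and>
     (\<forall>r. \<forall>f\<in>C_inf. u (\<lambda>q. r * f q) = r * u f) \<and>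
     (\<forall>f\<in>C_inf. \<forall>g\<in>C_inf. u (\<lambda>q. f q * g q) = f p * u g + g p * u f)}"

type_synonym 'n vfield = "'n cproj \<Rightarrow> ('n cproj \<Rightarrow> real) \<Rightarrow> real"

definition vector_field :: "'n::finite vfield \<Rightarrow> bool" where
  "vector_field X \<longleftrightarrow> (\<forall>p. X p \<in> tangent p) \<and> (\<forall>f\<in>C_inf. (\<lambda>p. X p f) \<in> C_inf)"

definition vf_bracket :: "'n::finite vfield \<Rightarrow> 'n vfield \<Rightarrow> 'n vfield" where
  "vf_bracket X Y = (\<lambda>p f. if f \<in> C_inf then X p (\<lambda>q. Y q f) - Y p (\<lambda>q. X q f) else 0)"

type_synonym 'n form2 =
  "'n cproj \<Rightarrow> (('n cproj \<Rightarrow> real) \<Rightarrow> real) \<Rightarrow> (('n cproj \<Rightarrow> real) \<Rightarrow> real) \<Rightarrow> real"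

definition two_form :: "'n::finite form2 \<Rightarrow> bool" where
  "two_form \<omega> \<longleftrightarrow>
     (\<forall>p. \<forall>u\<in>tangent p. \<forall>v\<in>tangent p. \<forall>w\<in>tangent p. \<forall>r.
        \<omega> p (\<lambda>f. u f + v f) w = \<omega> p u w + \<omega> p v w \<and>
        \<omega> p (\<lambda>f. r * u f) w = r * \<omega> p u w \<and>
        \<omega> p u v = - \<omega> p v u) \<and>
     (\<forall>X Y. vector_field X \<longrightarrow> vector_field Y \<longrightarrow> (\<lambda>p. \<omega> p (X p) (Y p)) \<in> C_inf)"

text \<open>\<open>d\<omega> = 0\<close>, through the invariant formula for \<open>d\<omega>(X, Y, Z)\<close>.\<close>

definition closed_form :: "'n::finite form2 \<Rightarrow> bool" where
  "closed_form \<omega> \<longleftrightarrow>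
     (\<forall>X Y Z p. vector_field X \<longrightarrow> vector_field Y \<longrightarrow> vector_field Z \<longrightarrow>
        X p (\<lambda>q. \<omega> q (Y q) (Z q)) + Y p (\<lambda>q. \<omega> q (Z q) (X q)) + Z p (\<lambda>q. \<omega> q (X q) (Y q))
        - \<omega> p (vf_bracket X Y p) (Z p) - \<omega> p (vf_bracket Y Z p) (X p)
        - \<omega> p (vf_bracket Z X p) (Y p) = 0)"

definition symplectic_form :: "'n::finite form2 \<Rightarrow> bool" where
  "symplectic_form \<omega> \<longleftrightarrow> two_form \<omega> \<and> closed_form \<omega> \<and>
     (\<forall>p. \<forall>u\<in>tangent p. (\<forall>v\<in>tangent p. \<omega> p u v = 0) \<longrightarrow> u = (\<lambda>f. 0))"

definition hamiltonian_field :: "'n::finite form2 \<Rightarrow> ('n cproj \<Rightarrow> real) \<Rightarrow> 'n vfield \<Rightarrow> bool" where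
  "hamiltonian_field \<omega> f X \<longleftrightarrow> vector_field X \<and> (\<forall>p. \<forall>v\<in>tangent p. \<omega> p (X p) v = v f)"

type_synonym 'n bracket = "('n cproj \<Rightarrow> complex) \<Rightarrow> ('n cproj \<Rightarrow> complex) \<Rightarrow> 'n cproj \<Rightarrow> complex"

text \<open>A Poisson bracket is a real operation; it is used here through its complex-bilinear extension
  to complex-valued functions, reality being compatibility with complex conjugation.\<close>

definition poisson_bracket :: "'n::finite bracket \<Rightarrow> bool" where
  "poisson_bracket P \<longleftrightarrow>
     (\<forall>f\<in>C_inf. \<forall>g\<in>C_inf. \<forall>k\<in>C_inf. \<forall>c.
        P f g \<in> C_inf \<and>
        P (f + g) k = P f k + P g k \<and>
        P (c *\<^sub>C f) g = c *\<^sub>C P f g \<and>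
        P f g = - P g f \<and>
        P f (g * k) = P f g * k + g * P f k \<and>
        P f (P g k) + P g (P k f) + P k (P f g) = 0 \<and>
        P (cnj \<circ> f) (cnj \<circ> g) = cnj \<circ> P f g)"

definition bracket_from_form :: "'n::finite form2 \<Rightarrow> 'n bracket \<Rightarrow> bool" where
  "bracket_from_form \<omega> P \<longleftrightarrow>
     (\<forall>f\<in>C_inf. \<forall>g\<in>C_inf. \<exists>X Y. hamiltonian_field \<omega> f X \<and> hamiltonian_field \<omega> g Y \<and>
        P (complex_of_real \<circ> f) (complex_of_real \<circ> g) = (\<lambda>p. complex_of_real (\<omega> p (X p) (Y p))))"


section \<open>Star products\<close>

definition iterated_deriv :: "'a list \<Rightarrow> ('a::real_normed_vector \<Rightarrow> complex) \<Rightarrow> 'a \<Rightarrow> complex" where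
  "iterated_deriv I f = foldr (\<lambda>v g x. frechet_derivative g (at x) v) I f"

definition basis_words :: "nat \<Rightarrow> 'a::euclidean_space list set" where
  "basis_words N = {I. set I \<subseteq> Basis \<and> length I \<le> N}"

text \<open>In each affine chart the operator is a finite sum of products of iterated partial derivatives
  (along the real coordinate directions) of the two arguments, with smooth coefficients. The dummy
  coordinate of the chart contributes only vanishing derivatives. As the charts are finitely many and
  cover the compact space, bounding the order on each chart is no restriction.\<close>

definition bidifferential_operator :: "'n::finite bracket \<Rightarrow> bool" where
  "bidifferential_operator B \<longleftrightarrow>
     (\<forall>i. \<exists>N a. (\<forall>I J. smooth (a I J)) \<and>
        (\<forall>f\<in>C_inf. \<forall>g\<in>C_inf. \<forall>w. B f g (chart_inv i w) =
           (\<Sum>I\<in>basis_words N. \<Sum>J\<in>basis_words N.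
              a I J w * iterated_deriv I (\<lambda>x. f (chart_inv i x)) w
                      * iterated_deriv J (\<lambda>x. g (chart_inv i x)) w)))"

type_synonym 'n star =
  "('n cproj \<Rightarrow> complex) fps \<Rightarrow> ('n cproj \<Rightarrow> complex) fps \<Rightarrow> ('n cproj \<Rightarrow> complex) fps"

definition star_product :: "'n::finite bracket \<Rightarrow> 'n star \<Rightarrow> bool" where
  "star_product P s \<longleftrightarrow> poisson_bracket P \<and>
     (\<forall>f\<in>C_inf_fps. \<forall>g\<in>C_inf_fps. \<forall>k\<in>C_inf_fps. \<forall>c.
        s f g \<in> C_inf_fps \<and>
        s (f + g) k = s f k + s g k \<and> s f (g + k) = s f g + s f k \<and>
        s (fps_bilin scaleC c f) g = fps_bilin scaleC c (s f g) \<and>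
        s f (fps_bilin scaleC c g) = fps_bilin scaleC c (s f g) \<and>
        s (s f g) k = s f (s g k) \<and>
        s f 1 = f \<and> s 1 f = f) \<and>
     (\<exists>B. (\<forall>k. bidifferential_operator (B k)) \<and>
        (\<forall>f\<in>C_inf. \<forall>g\<in>C_inf.
           s (fps_const f) (fps_const g) = Abs_fps (\<lambda>k. B k f g) \<and>
           B 0 f g = f * g \<and>
           B 1 f g - B 1 g f = \<i> *\<^sub>C P f g))"

definition symplectic_star_product :: "'n::finite star \<Rightarrow> bool" where
  "symplectic_star_product s \<longleftrightarrow>
     (\<exists>\<omega> P. symplectic_form \<omega> \<and> bracket_from_form \<omega> P \<and> star_product P s)"


section \<open>Star products induced by twists\<close>

definition cproj_act :: "complex^'n^'n \<Rightarrow> 'n cproj \<Rightarrow> 'n::finite cproj" where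
  "cproj_act g p = Abs_cproj ((*v) g ` Rep_cproj p)"

definition fun_act :: "complex^'n^'n \<Rightarrow> ('n cproj \<Rightarrow> complex) \<Rightarrow> 'n::finite cproj \<Rightarrow> complex" where
  "fun_act g f = (\<lambda>p. f (cproj_act (matrix_inv g) p))"

definition matrix_exp :: "complex^'n^'n \<Rightarrow> complex^'n::finite^'n" where
  "matrix_exp A = suminf (\<lambda>k. (1 / fact k) *\<^sub>R ((\<lambda>B. A ** B) ^^ k) (mat 1))"

definition lie_act :: "complex^'n^'n \<Rightarrow> ('n cproj \<Rightarrow> complex) \<Rightarrow> 'n::finite cproj \<Rightarrow> complex" where
  "lie_act A f = (\<lambda>p. vector_derivative (\<lambda>t. fun_act (matrix_exp (t *\<^sub>R A)) f p) (at 0))"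

text \<open>On smooth functions \<open>lie_act\<close> is a representation of the Lie algebra, so that there the choice
  of the representative of \<open>u\<close> in the free algebra is immaterial.\<close>

definition uea_act :: "'n::finite uea \<Rightarrow> ('n cproj \<Rightarrow> complex) \<Rightarrow> 'n cproj \<Rightarrow> complex" where
  "uea_act u f = lin_ext (\<lambda>w. foldr lie_act w f) (rep_uea u)"

definition tensor_act_mult ::
  "('n::finite uea, 'n uea) tensor \<Rightarrow> ('n cproj \<Rightarrow> complex) \<Rightarrow> ('n cproj \<Rightarrow> complex)
     \<Rightarrow> 'n cproj \<Rightarrow> complex" where
  "tensor_act_mult t f g = tensor_lift (\<lambda>u v. uea_act u f * uea_act v g) t"

definition fps_inverse_of :: "('n::finite uea, 'n uea) tensor fps \<Rightarrow> ('n uea, 'n uea) tensor fps" where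
  "fps_inverse_of F = (THE G. F * G = 1 \<and> G * F = 1)"

lemma fps_inverse_of_eq:
  assumes "F * G = 1" "G * F = 1"
  shows "fps_inverse_of F = G"
  unfolding fps_inverse_of_def
proof (rule the_equality)
  show "F * G = 1 \<and> G * F = 1" using assms by simp
  show "H = G" if "F * H = 1 \<and> H * F = 1" for H
  proof -
    have "H = H * (F * G)" using assms by simp
    also have "\<dots> = (H * F) * G" by (simp only: mult.assoc)
    finally show ?thesis using that by simp
  qed
qed

definition induced_by_twist :: "('n::finite uea, 'n uea) tensor fps \<Rightarrow> 'n star \<Rightarrow> bool" where
  "induced_by_twist F s \<longleftrightarrow>
     (\<forall>f\<in>C_inf_fps. \<forall>g\<in>C_inf_fps.
        s f g = Abs_fps (\<lambda>m. \<Sum>i\<le>m. \<Sum>j\<le>m - i.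
          tensor_act_mult (fps_nth (fps_inverse_of F) i) (fps_nth f j) (fps_nth g (m - i - j))))"

end

theory Submission
  imports Defs
begin

text \<open>
  In the classical limit, a symplectic star product induced by a twist would give a flat connection
  on the dual of the tautological line bundle of projective space, whose Chern class is not zero.

  Let \<open>G = 1 + h G\<^sub>1 + h\<^sup>2 G\<^sub>2 + \<dots>\<close> be the inverse of the twist. The cocycle equation at first order
  makes \<open>r = G\<^sub>1 - flip G\<^sub>1\<close> primitive in both legs, so \<open>r = \<Sum> c\<^sub>j a\<^sub>j \<otimes> b\<^sub>j\<close> lies in \<open>g \<otimes> g\<close>
  (\<open>twist_r_matrix\<close>). The enveloping algebra acts on all smooth functions on \<open>\<complex>\<^sup>n - {0}\<close>, and not only
  on those that come from projective space. Hence \<open>r\<close> defines a bracket \<open>\<rho>\<close> of functions on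
  \<open>\<complex>\<^sup>n - {0}\<close>, and the cocycle equation at second order gives the Jacobi identity there
  (\<open>twist_jacobi\<close>). On functions that come from projective space, \<open>\<rho>\<close> is \<open>\<i>\<close> times the Poisson bracket
  (\<open>induced_star_product_classical_limit\<close>). Applied to a linear coordinate \<open>s\<close>, a section of the dual of
  the tautological bundle, \<open>- \<i> \<rho>(f, s)\<close> is up to sign the derivative of \<open>s\<close> along a lift of the
  Hamiltonian vector field of \<open>f\<close>. Hamiltonian vector fields span the tangent spaces, because the
  r-matrix inverts the symplectic form (\<open>r_matrix_inverts_form\<close>). So these derivatives fit
  together to a connection \<open>nabla\<close>, and the Jacobi identity makes it flat (\<open>nabla_flat\<close>).

  The contradiction is the computation of a Chern number. On linear coordinates the Lie derivative
  along a matrix \<open>A\<close> differs from \<open>nabla A\<close> by the multiplication by a function \<open>moment A\<close> on projective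
  space. Where \<open>A v = k v\<close>, its value is \<open>- k\<close> (\<open>moment_fixed_point\<close>). For commuting matrices that act
  trivially on some coordinate, flatness says that these functions are components of a closed
  \<open>1\<close>-form (\<open>moment_closed\<close>). Take the rotation and the dilation of the \<open>i\<close>-th coordinate. On the
  projective line through the coordinate points \<open>i\<close> and \<open>j\<close>, the mean of the rotational component over a
  circle of latitude is then independent of the circle (\<open>closed_form_no_period\<close>). At the two poles
  it is \<open>- \<i>\<close> and \<open>0\<close>.
\<close>

section \<open>Smooth functions on open sets\<close>

abbreviation fder :: "('a::real_normed_vector \<Rightarrow> 'b::real_normed_vector) \<Rightarrow> 'a \<Rightarrow> 'a \<Rightarrow> 'b" where
  "fder f x \<equiv> frechet_derivative f (at x)"

text \<open>A version of \<open>smooth\<close> on open sets, because a function of degree \<open>0\<close> on \<open>\<complex>\<^sup>n\<close> is in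
  general not even continuous at the origin.\<close>

primrec Ck_on ::
  "nat \<Rightarrow> 'a::real_normed_vector set \<Rightarrow> ('a \<Rightarrow> 'b::real_normed_vector) \<Rightarrow> bool" where
  "Ck_on 0 U f \<longleftrightarrow> continuous_on U f"
| "Ck_on (Suc k) U f \<longleftrightarrow> (\<forall>x\<in>U. f differentiable (at x)) \<and>
     (\<forall>v. Ck_on k U (\<lambda>x. fder f x v))"

definition smooth_on :: "'a::real_normed_vector set \<Rightarrow> ('a \<Rightarrow> 'b::real_normed_vector) \<Rightarrow> bool" where
  "smooth_on U f \<longleftrightarrow> (\<forall>k. Ck_on k U f)"

lemma smooth_iff_smooth_on_UNIV: "smooth f \<longleftrightarrow> smooth_on UNIV f"
proof -
  have "k_times_differentiable k f \<longleftrightarrow> Ck_on k UNIV f" for k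
    by (induction k arbitrary: f) auto
  then show ?thesis by (simp add: smooth_def smooth_on_def)
qed

lemma frechet_derivative_eqI:
  "(f has_derivative D) (at x) \<Longrightarrow> fder f x = D"
  by (metis frechet_derivative_at)

lemma has_derivative_cong_open:
  assumes "open U" "x \<in> U" "\<And>y. y \<in> U \<Longrightarrow> f y = g y"
  shows "(f has_derivative D) (at x) \<longleftrightarrow> (g has_derivative D) (at x)"
  using has_derivative_transform_within_open[of f D x UNIV U g]
    has_derivative_transform_within_open[of g D x UNIV U f] assms by auto

lemma frechet_derivative_cong_open:
  assumes "open U" "x \<in> U" "\<And>y. y \<in> U \<Longrightarrow> f y = g y"
  shows "fder f x = fder g x"
  using has_derivative_cong_open[OF assms] by (simp add: frechet_derivative_def)

lemma Ck_on_cong: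
  assumes "open U" "\<And>x. x \<in> U \<Longrightarrow> f x = g x" "Ck_on k U f"
  shows "Ck_on k U g"
  using assms(2,3)
proof (induction k arbitrary: f g)
  case 0
  then show ?case by (simp cong: continuous_on_cong)
next
  case (Suc k)
  have "fder f x = fder g x" if "x \<in> U" for x
    using frechet_derivative_cong_open[OF assms(1) that] Suc.prems(1) by blast
  then have "Ck_on k U (\<lambda>x. fder g x v)" for v
    using Suc.IH[of "\<lambda>x. fder f x v" "\<lambda>x. fder g x v"]
      Suc.prems(2) by simp
  moreover have "g differentiable (at x)" if "x \<in> U" for x
    using has_derivative_cong_open[OF assms(1) that, of f g] Suc.prems that
    unfolding differentiable_def Ck_on.simps by blast
  ultimately show ?case by simp
qed

lemma Ck_on_SucI:
  assumes "open U" "\<And>x. x \<in> U \<Longrightarrow> (f has_derivative D x) (at x)"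
    "\<And>v. Ck_on k U (\<lambda>x. D x v)"
  shows "Ck_on (Suc k) U f"
proof -
  have "fder f x = D x" if "x \<in> U" for x
    using frechet_derivative_eqI assms(2)[OF that] by blast
  then have "Ck_on k U (\<lambda>x. fder f x v)" for v
    by (intro Ck_on_cong[OF assms(1) _ assms(3)[of v]]) simp
  then show ?thesis
    using assms(2) by (auto simp: differentiable_def)
qed

lemma Ck_on_SucD:
  assumes "Ck_on (Suc k) U f"
  shows "Ck_on k U f"
  using assms
proof (induction k arbitrary: f)
  case 0
  then have "f differentiable_on U"
    by (simp add: differentiable_on_def differentiable_at_withinI)
  then show ?case by (simp add: differentiable_imp_continuous_on)
next
  case (Suc k)
  have "Ck_on k U (\<lambda>x. fder f x v)" for v
    using Suc.prems by (intro Suc.IH) simp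
  then show ?case using Suc.prems by simp
qed

lemma Ck_on_has_derivative:
  assumes "Ck_on (Suc k) U f" "x \<in> U"
  shows "(f has_derivative fder f x) (at x)"
  using assms frechet_derivative_works by auto

lemma Ck_on_Union:
  assumes "\<And>i. i \<in> I \<Longrightarrow> open (U i)" "\<And>i. i \<in> I \<Longrightarrow> Ck_on k (U i) f"
  shows "Ck_on k (\<Union>i\<in>I. U i) f"
  using assms(2)
proof (induction k arbitrary: f)
  case 0
  then show ?case using continuous_on_open_UN[of I U f] assms(1) by auto
qed auto

lemma Ck_on_const: "open U \<Longrightarrow> Ck_on k U (\<lambda>x. c)"
proof (induction k arbitrary: c)
  case (Suc k)
  then show ?case
    by (intro Ck_on_SucI[where D = "\<lambda>x v. 0"]) auto
qed simp

lemma Ck_on_linear: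
  assumes "open U" "bounded_linear f" shows "Ck_on k U f"
proof (cases k)
  case 0
  then show ?thesis using assms by (simp add: linear_continuous_on)
next
  case (Suc l)
  show ?thesis unfolding Suc
    using assms by (intro Ck_on_SucI[where D = "\<lambda>x. f"])
      (auto intro: Ck_on_const bounded_linear_imp_has_derivative)
qed

lemma Ck_on_add:
  assumes "open U" "Ck_on k U f" "Ck_on k U g"
  shows "Ck_on k U (\<lambda>x. f x + g x)"
  using assms(2,3)
proof (induction k arbitrary: f g)
  case 0
  then show ?case by (simp add: continuous_on_add)
next
  case (Suc k)
  note d = Ck_on_has_derivative
  have kd: "Ck_on k U
      (\<lambda>x. fder f x v + fder g x v)" for v
    using Suc by simp
  have der: "((\<lambda>x. f x + g x) has_derivative
      (\<lambda>v. fder f x v + fder g x v)) (at x)" if "x \<in> U" for x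
    by (rule has_derivative_add[OF d[OF Suc.prems(1) that] d[OF Suc.prems(2) that]])
  show ?case
    by (rule Ck_on_SucI[OF assms(1), where D = "\<lambda>x v. fder f x v + fder g x v", OF der kd])
qed

lemma Ck_on_bilinear:
  assumes "bounded_bilinear B" "open U"
    "Ck_on k U f" "Ck_on k U g"
  shows "Ck_on k U (\<lambda>x. B (f x) (g x))"
  using assms(3,4)
proof (induction k arbitrary: f g)
  case 0
  then show ?case by (simp add: bounded_bilinear.continuous_on[OF assms(1)])
next
  case (Suc k)
  note D = Ck_on_SucD
  note d = Ck_on_has_derivative
  have kd: "Ck_on k U
      (\<lambda>x. B (f x) (fder g x v) + B (fder f x v) (g x))" for v
    using Suc.IH[OF D[OF Suc.prems(1)], of "\<lambda>x. fder g x v"]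
      Suc.IH[OF _ D[OF Suc.prems(2)], of "\<lambda>x. fder f x v"] Suc.prems
    by (intro Ck_on_add[OF assms(2)]) simp_all
  have der: "((\<lambda>x. B (f x) (g x)) has_derivative
      (\<lambda>v. B (f x) (fder g x v) + B (fder f x v) (g x))) (at x)"
    if "x \<in> U" for x
    by (rule bounded_bilinear.FDERIV[OF assms(1) d[OF Suc.prems(1) that] d[OF Suc.prems(2) that]])
  show ?case
    by (rule Ck_on_SucI[OF assms(2), where D = "\<lambda>x v. B (f x) (fder g x v) + B (fder f x v) (g x)", OF der kd])
qed

lemma Ck_on_sum:
  assumes "open U" "\<And>i. i \<in> I \<Longrightarrow> Ck_on k U (f i)"
  shows "Ck_on k U (\<lambda>x. \<Sum>i\<in>I. f i x)"
  using assms(2)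
proof (induction I rule: infinite_finite_induct)
  case (insert i I)
  have "Ck_on k U (\<lambda>x. f i x + (\<Sum>i\<in>I. f i x))"
    using insert by (intro Ck_on_add[OF assms(1)]) simp_all
  then show ?case using insert by simp
qed (simp_all add: Ck_on_const assms(1))

lemma Ck_on_inverse:
  fixes f :: "'a::real_normed_vector \<Rightarrow> 'b::real_normed_field"
  assumes "open U" "Ck_on k U f" "\<And>x. x \<in> U \<Longrightarrow> f x \<noteq> 0"
  shows "Ck_on k U (\<lambda>x. inverse (f x))"
  using assms(2)
proof (induction k)
  case 0
  then show ?case using assms(3) by (simp add: continuous_on_inverse)
next
  case (Suc k)
  have IH: "Ck_on k U (\<lambda>x. inverse (f x))"
    using Suc.IH Ck_on_SucD[OF Suc.prems] by simp
  note mult = Ck_on_bilinear[OF bounded_bilinear_mult assms(1)]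
  have "Ck_on k U (\<lambda>x. fder f x v)" for v
    using Suc.prems by simp
  from mult[OF Ck_on_const[OF assms(1)] mult[OF mult[OF IH this] IH], of "- 1"]
  have kd: "Ck_on k U
      (\<lambda>x. - (inverse (f x) * fder f x v * inverse (f x)))" for v
    by simp
  have der: "((\<lambda>x. inverse (f x)) has_derivative
      (\<lambda>v. - (inverse (f x) * fder f x v * inverse (f x)))) (at x)" if "x \<in> U" for x
    using Deriv.has_derivative_inverse[of f x] assms(3)[OF that]
      Ck_on_has_derivative[OF Suc.prems that] by blast
  show ?case
    by (rule Ck_on_SucI[OF assms(1), where D = "\<lambda>x v. - (inverse (f x) * fder f x v * inverse (f x))", OF der kd])
qed

lemma Ck_on_compose:
  fixes f :: "'b::euclidean_space \<Rightarrow> 'c::real_normed_vector"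
  assumes "open U" "open V" "Ck_on k V f" "Ck_on k U g"
    "g ` U \<subseteq> V"
  shows "Ck_on k U (\<lambda>x. f (g x))"
  using assms(3,4)
proof (induction k arbitrary: f)
  case 0
  then show ?case using assms(5) by (auto intro: continuous_on_compose2)
next
  case (Suc k)
  have der: "((\<lambda>x. f (g x)) has_derivative
      (\<lambda>v. fder f (g x) (fder g x v))) (at x)"
    if "x \<in> U" for x
    using that assms(5) Suc.prems
    by (intro has_derivative_compose[of g _ _ _ f] Ck_on_has_derivative) auto
  have g': "Ck_on k U (\<lambda>x. fder g x v)" for v
    using Suc.prems by simp
  have eq: "(\<Sum>b\<in>Basis. (fder g x v \<bullet> b) *\<^sub>R fder f (g x) b)
      = fder f (g x) (fder g x v)" if "x \<in> U" for x v
  proof -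
    have "linear (fder f (g x))"
      using that assms(5) Suc.prems linear_frechet_derivative by auto
    then have "fder f (g x) (\<Sum>b\<in>Basis. (fder g x v \<bullet> b) *\<^sub>R b)
       = (\<Sum>b\<in>Basis. (fder g x v \<bullet> b) *\<^sub>R fder f (g x) b)"
      by (simp add: linear_sum linear_scale)
    then show ?thesis by (simp add: euclidean_representation)
  qed
  have "Ck_on k U (\<lambda>x. fder f (g x) b)" for b
    using Suc.IH[of "\<lambda>y. fder f y b"] Suc.prems(1)
      Ck_on_SucD[OF Suc.prems(2)] by simp
  moreover have "Ck_on k U (\<lambda>x. fder g x v \<bullet> b)" for v b
    by (rule Ck_on_bilinear[OF bounded_bilinear_inner assms(1) g'
          Ck_on_const[OF assms(1)]])
  ultimately have "Ck_on k U (\<lambda>x. \<Sum>b\<in>Basis.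
      (fder g x v \<bullet> b) *\<^sub>R fder f (g x) b)" for v
    by (intro Ck_on_sum assms(1)
        Ck_on_bilinear[OF bounded_bilinear_scaleR])
  then have kd: "Ck_on k U
      (\<lambda>x. fder f (g x) (fder g x v))" for v
    using Ck_on_cong[OF assms(1) eq] by simp
  show ?case
    by (rule Ck_on_SucI[OF assms(1), where D =
          "\<lambda>x v. fder f (g x) (fder g x v)", OF der kd])
qed

lemma smooth_onD:
  assumes "smooth_on U f" 
  shows "x \<in> U \<Longrightarrow> (f has_derivative fder f x) (at x)"
    and "smooth_on U (\<lambda>x. fder f x v)" and "continuous_on U f"
proof -
  show "(f has_derivative fder f x) (at x)" if "x \<in> U"
    using assms that Ck_on_has_derivative unfolding smooth_on_def by blast
  have "Ck_on (Suc k) U f" for k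
    using assms unfolding smooth_on_def by blast
  then show "smooth_on U (\<lambda>x. fder f x v)" 
    unfolding smooth_on_def by simp
  show "continuous_on U f"
    using assms unfolding smooth_on_def by (metis Ck_on.simps(1))
qed

lemma smooth_on_cong:
  "open U \<Longrightarrow> (\<And>x. x \<in> U \<Longrightarrow> f x = g x) \<Longrightarrow> smooth_on U f \<Longrightarrow> smooth_on U g"
  unfolding smooth_on_def using Ck_on_cong by metis

lemma smooth_on_Union:
  "(\<And>i. i \<in> I \<Longrightarrow> open (U i)) \<Longrightarrow> (\<And>i. i \<in> I \<Longrightarrow> smooth_on (U i) f) \<Longrightarrow> smooth_on (\<Union>i\<in>I. U i) f"
  unfolding smooth_on_def using Ck_on_Union by metis

lemma smooth_on_const: "open U \<Longrightarrow> smooth_on U (\<lambda>x. c)"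
  unfolding smooth_on_def by (metis Ck_on_const)

lemma smooth_on_linear: "open U \<Longrightarrow> bounded_linear f \<Longrightarrow> smooth_on U f"
  unfolding smooth_on_def by (metis Ck_on_linear)

lemma smooth_on_add:
  "open U \<Longrightarrow> smooth_on U f \<Longrightarrow> smooth_on U g \<Longrightarrow> smooth_on U (\<lambda>x. f x + g x)"
  unfolding smooth_on_def by (metis Ck_on_add)

lemma smooth_on_sum:
  "open U \<Longrightarrow> (\<And>i. i \<in> I \<Longrightarrow> smooth_on U (f i)) \<Longrightarrow> smooth_on U (\<lambda>x. \<Sum>i\<in>I. f i x)"
  unfolding smooth_on_def by (metis Ck_on_sum)

lemma smooth_on_bilinear:
  "bounded_bilinear B \<Longrightarrow> open U \<Longrightarrow> smooth_on U f \<Longrightarrow> smooth_on U g \<Longrightarrow> smooth_on U (\<lambda>x. B (f x) (g x))"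
  unfolding smooth_on_def by (metis Ck_on_bilinear)

lemmas smooth_on_mult = smooth_on_bilinear[OF bounded_bilinear_mult]

lemma smooth_on_inverse:
  fixes f :: "'a::real_normed_vector \<Rightarrow> 'b::real_normed_field"
  shows "open U \<Longrightarrow> smooth_on U f \<Longrightarrow> (\<And>x. x \<in> U \<Longrightarrow> f x \<noteq> 0) \<Longrightarrow> smooth_on U (\<lambda>x. inverse (f x))"
  unfolding smooth_on_def by (metis Ck_on_inverse)

lemma smooth_on_compose:
  fixes f :: "'b::euclidean_space \<Rightarrow> 'c::real_normed_vector"
  shows "open U \<Longrightarrow> open V \<Longrightarrow> smooth_on V f \<Longrightarrow> smooth_on U g \<Longrightarrow> g ` U \<subseteq> V \<Longrightarrow> smooth_on U (\<lambda>x. f (g x))"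
  unfolding smooth_on_def by (metis Ck_on_compose)

lemma has_vector_derivative_compose:
  assumes "(c has_vector_derivative w) (at t)" "(f has_derivative D) (at (c t))"
  shows "((\<lambda>s. f (c s)) has_vector_derivative D w) (at t)"
proof -
  have "((\<lambda>s. f (c s)) has_derivative (\<lambda>h. D (h *\<^sub>R w))) (at t)"
    using has_derivative_compose[of c "\<lambda>h. h *\<^sub>R w" t UNIV f D] assms
    by (simp add: has_vector_derivative_def)
  moreover have "D (h *\<^sub>R w) = h *\<^sub>R D w" for h
    using has_derivative_linear[OF assms(2)] by (simp add: linear_scale)
  ultimately show ?thesis by (simp add: has_vector_derivative_def)
qed

text \<open>The mean value theorem, applied once in each direction. As the second difference is symmetric in
  \<open>u\<close> and \<open>v\<close> and the parallelogram shrinks to \<open>x\<close>, Schwarz's theorem follows by continuity.\<close>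

lemma second_difference_mean_value:
  fixes f :: "'a::real_normed_vector \<Rightarrow> real"
  assumes f: "smooth_on U f" and U: "ball x e \<subseteq> U" and t: "t > 0" "t * (norm u + norm v) < e"
  shows "\<exists>y. dist x y < e \<and> f (x + t *\<^sub>R u + t *\<^sub>R v) - f (x + t *\<^sub>R u) - f (x + t *\<^sub>R v) + f x
      = t\<^sup>2 * fder (\<lambda>y. fder f y u) y v"
proof -
  have in_U: "x + a *\<^sub>R u + b *\<^sub>R v \<in> U" and dist: "dist x (x + a *\<^sub>R u + b *\<^sub>R v) < e"
    if "0 \<le> a" "a \<le> t" "0 \<le> b" "b \<le> t" for a b
  proof -
    have "norm (a *\<^sub>R u + b *\<^sub>R v) \<le> a * norm u + b * norm v"
      using that by (intro order_trans[OF norm_triangle_ineq]) simp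
    also have "\<dots> \<le> t * norm u + t * norm v"
      using that by (intro add_mono mult_right_mono) auto
    finally have "norm (a *\<^sub>R u + b *\<^sub>R v) < e"
      using t(2) by (simp add: distrib_left)
    moreover have "dist x (x + a *\<^sub>R u + b *\<^sub>R v) = norm (a *\<^sub>R u + b *\<^sub>R v)"
      by (metis add.assoc add_diff_cancel_left' dist_commute dist_norm)
    ultimately show d: "dist x (x + a *\<^sub>R u + b *\<^sub>R v) < e" by simp
    show "x + a *\<^sub>R u + b *\<^sub>R v \<in> U" using d U by (auto simp: ball_def)
  qed
  note d1 = smooth_onD(1)[OF f]
  note d2 = smooth_onD(1)[OF smooth_onD(2)[OF f]]
  define g where "g a = f (x + a *\<^sub>R u + t *\<^sub>R v) - f (x + a *\<^sub>R u + 0 *\<^sub>R v)" for a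
  have g': "(g has_real_derivative
     fder f (x + a *\<^sub>R u + t *\<^sub>R v) u - fder f (x + a *\<^sub>R u + 0 *\<^sub>R v) u) (at a)"
    if "0 \<le> a" "a \<le> t" for a
  proof -
    have "((\<lambda>a. f (x + a *\<^sub>R u + b *\<^sub>R v)) has_real_derivative
       fder f (x + a *\<^sub>R u + b *\<^sub>R v) u) (at a)" if "0 \<le> b" "b \<le> t" for b
      unfolding has_real_derivative_iff_has_vector_derivative
      by (rule has_vector_derivative_compose[where c = "\<lambda>a. x + a *\<^sub>R u + b *\<^sub>R v", OF _ d1[OF in_U[OF \<open>0 \<le> a\<close> \<open>a \<le> t\<close> that]]])
        (auto intro!: derivative_eq_intros)
    from DERIV_diff[OF this[of t] this[of 0]] show ?thesis using t unfolding g_def by simp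
  qed
  obtain a where a: "0 < a" "a < t" "g t - g 0 = (t - 0) *
     (fder f (x + a *\<^sub>R u + t *\<^sub>R v) u - fder f (x + a *\<^sub>R u + 0 *\<^sub>R v) u)"
    using MVT2[OF t(1) g'] by blast
  define h where "h b = fder f (x + a *\<^sub>R u + b *\<^sub>R v) u" for b
  have h': "(h has_real_derivative
      fder (\<lambda>y. fder f y u) (x + a *\<^sub>R u + b *\<^sub>R v) v) (at b)"
    if "0 \<le> b" "b \<le> t" for b
    unfolding has_real_derivative_iff_has_vector_derivative h_def
    by (rule has_vector_derivative_compose[where c = "\<lambda>b. x + a *\<^sub>R u + b *\<^sub>R v", OF _ d2[OF in_U]])
      (use a that in \<open>auto intro!: derivative_eq_intros\<close>)
  obtain b where b: "0 < b" "b < t" "h t - h 0 = (t - 0) *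
     fder (\<lambda>y. fder f y u) (x + a *\<^sub>R u + b *\<^sub>R v) v"
    using MVT2[OF t(1) h'] by blast
  show ?thesis
    using a b dist[of a b]
    by (intro exI[of _ "x + a *\<^sub>R u + b *\<^sub>R v"]) (simp add: g_def h_def power2_eq_square)
qed

lemma second_derivative_symmetric_real:
  fixes f :: "'a::real_normed_vector \<Rightarrow> real"
  assumes f: "smooth_on U f" and "open U" "x \<in> U"
  shows "fder (\<lambda>y. fder f y u) x v
       = fder (\<lambda>y. fder f y v) x u"
    (is "?F u v x = ?F v u x")
proof (rule ccontr)
  assume ne: "?F u v x \<noteq> ?F v u x"
  define d where "d = \<bar>?F u v x - ?F v u x\<bar> / 2"
  have "d > 0" using ne by (simp add: d_def)
  have cont: "continuous (at x) (?F a b)" for a b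
    using smooth_onD(3)[OF smooth_onD(2)[OF smooth_onD(2)[OF f]]] assms
    by (simp add: continuous_on_eq_continuous_at)
  obtain e1 where e1: "e1 > 0" "\<And>y. dist x y < e1 \<Longrightarrow> dist (?F u v y) (?F u v x) < d"
    using cont[of u v] \<open>d > 0\<close> unfolding continuous_at_eps_delta by (metis dist_commute)
  obtain e2 where e2: "e2 > 0" "\<And>y. dist x y < e2 \<Longrightarrow> dist (?F v u y) (?F v u x) < d"
    using cont[of v u] \<open>d > 0\<close> unfolding continuous_at_eps_delta by (metis dist_commute)
  obtain e3 where e3: "e3 > 0" "ball x e3 \<subseteq> U" using assms open_contains_ball by blast
  define e where "e = min e1 (min e2 e3)"
  have e: "e > 0" "ball x e \<subseteq> U" using e1 e2 e3 by (auto simp: e_def)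
  define t where "t = e / (norm u + norm v + 1)"
  have nz: "norm u + norm v + 1 > 0" by (simp add: add_nonneg_pos)
  have "t > 0" using e nz by (simp add: t_def)
  moreover have "t * (norm u + norm v) < e"
    using nz e(1) by (simp add: t_def field_simps)
  ultimately have t: "t > 0" "t * (norm u + norm v) < e" "t * (norm v + norm u) < e"
    by (simp_all add: add.commute)
  obtain y where y: "dist x y < e" "f (x + t *\<^sub>R u + t *\<^sub>R v) - f (x + t *\<^sub>R u) - f (x + t *\<^sub>R v) + f x
      = t\<^sup>2 * ?F u v y" using second_difference_mean_value[OF f e(2) t(1,2)] by blast
  obtain z where z: "dist x z < e" "f (x + t *\<^sub>R v + t *\<^sub>R u) - f (x + t *\<^sub>R v) - f (x + t *\<^sub>R u) + f x
      = t\<^sup>2 * ?F v u z" using second_difference_mean_value[OF f e(2) t(1,3)] by blast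
  have "t\<^sup>2 * ?F u v y = t\<^sup>2 * ?F v u z"
    using y(2) z(2) by (simp add: algebra_simps)
  then have "?F u v y = ?F v u z" using t by simp
  moreover have "dist (?F u v y) (?F u v x) < d" using e1 y by (simp add: e_def)
  moreover have "dist (?F v u z) (?F v u x) < d" using e2 z by (simp add: e_def)
  ultimately show False
    unfolding dist_real_def d_def by (auto simp: abs_if split: if_splits)
qed

lemma second_derivative_symmetric:
  fixes f :: "'a::real_normed_vector \<Rightarrow> 'b::euclidean_space"
  assumes f: "smooth_on U f" and U: "open U" "x \<in> U"
  shows "fder (\<lambda>y. fder f y u) x v
       = fder (\<lambda>y. fder f y v) x u"
proof (rule euclidean_eqI)
  fix b :: 'b assume "b \<in> Basis"
  have inner: "fder (\<lambda>y. g y \<bullet> b) y w = fder g y w \<bullet> b"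
    if "smooth_on U g" "y \<in> U" for g :: "'a \<Rightarrow> 'b" and y w
    using frechet_derivative_eqI[OF has_derivative_inner_left[OF smooth_onD(1)[OF that]]] by simp
  have fb: "smooth_on U (\<lambda>y. f y \<bullet> b)"
    by (intro smooth_on_bilinear[OF bounded_bilinear_inner] f U smooth_on_const)
  have "fder (\<lambda>y. fder f y u) x v \<bullet> b
     = fder (\<lambda>y. fder (\<lambda>y. f y \<bullet> b) y u) x v" for u v
    using inner[OF smooth_onD(2)[OF f] U(2)] inner[OF f]
      frechet_derivative_cong_open[OF U, of "\<lambda>y. fder (\<lambda>y. f y \<bullet> b) y u"
        "\<lambda>y. fder f y u \<bullet> b"] by simp
  then show "fder (\<lambda>y. fder f y u) x v \<bullet> b
      = fder (\<lambda>y. fder f y v) x u \<bullet> b"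
    using second_derivative_symmetric_real[OF fb U] by simp
qed

section \<open>Linear maps on tensor products\<close>

abbreviation cspan :: "'a::complex_vector set \<Rightarrow> 'a set" where
  "cspan \<equiv> complex_vector.span"

lemma clinearI:
  "(\<And>x y. f (x + y) = f x + f y) \<Longrightarrow> (\<And>c x. f (c *\<^sub>C x) = c *\<^sub>C f x) \<Longrightarrow> clinear f"
  by (simp add: clinear_def)

lemma clinear_add: "clinear f \<Longrightarrow> f (x + y) = f x + f y"
  and clinear_scaleC: "clinear f \<Longrightarrow> f (c *\<^sub>C x) = c *\<^sub>C f x"
  by (simp_all add: clinear_def)

lemma clinear_zero: "clinear f \<Longrightarrow> f 0 = 0"
  using clinear_add[of f 0 0] by simp

lemma clinear_diff: "clinear f \<Longrightarrow> f (x - y) = f x - f y"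
  using clinear_add[of f "x - y" y] by simp

lemma clinear_sum: "clinear f \<Longrightarrow> f (\<Sum>i\<in>I. g i) = (\<Sum>i\<in>I. f (g i))"
  by (induction I rule: infinite_finite_induct) (simp_all add: clinear_zero clinear_add)

lemma cbilinearI:
  "(\<And>a a' b. B (a + a') b = B a b + B a' b) \<Longrightarrow> (\<And>a b b'. B a (b + b') = B a b + B a b') \<Longrightarrow>
   (\<And>c a b. B (c *\<^sub>C a) b = c *\<^sub>C B a b) \<Longrightarrow> (\<And>c a b. B a (c *\<^sub>C b) = c *\<^sub>C B a b) \<Longrightarrow> cbilinear B"
  by (simp add: cbilinear_def clinear_def)

lemma clinear_id: "clinear id"
  by (simp add: clinear_def)

lemma clinear_tensor_of_left: "clinear (\<lambda>a. a \<otimes> b)"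
  and clinear_tensor_of_right: "clinear (\<lambda>b. a \<otimes> b)"
  by (simp_all add: clinear_def tensor_of_linear)

lemma cbilinear_tensor_map:
  assumes "clinear f" "clinear g" shows "cbilinear (\<lambda>a b. f a \<otimes> g b)"
  using assms by (intro cbilinearI) (simp_all add: clinear_def tensor_of_linear)

lemma tensor_map_of: "clinear f \<Longrightarrow> clinear g \<Longrightarrow> tensor_map f g (a \<otimes> b) = f a \<otimes> g b"
  unfolding tensor_map_def by (rule tensor_lift_of[OF cbilinear_tensor_map])

lemma clinear_tensor_map: "clinear f \<Longrightarrow> clinear g \<Longrightarrow> clinear (tensor_map f g)"
  unfolding tensor_map_def by (rule clinear_tensor_lift[OF cbilinear_tensor_map])

definition ctrilinear ::
  "('a::complex_vector \<Rightarrow> 'b::complex_vector \<Rightarrow> 'c::complex_vector \<Rightarrow> 'd::complex_vector) \<Rightarrow> bool" where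
  "ctrilinear B \<longleftrightarrow> (\<forall>a. cbilinear (B a)) \<and> (\<forall>b c. clinear (\<lambda>a. B a b c))"

definition tensor_lift3 ::
  "('a::complex_vector \<Rightarrow> 'b::complex_vector \<Rightarrow> 'c::complex_vector \<Rightarrow> 'd::complex_vector)
     \<Rightarrow> ('a, ('b, 'c) tensor) tensor \<Rightarrow> 'd" where
  "tensor_lift3 B = tensor_lift (\<lambda>a. tensor_lift (B a))"

lemma cbilinear_tensor_lift3:
  assumes "ctrilinear B" shows "cbilinear (\<lambda>a. tensor_lift (B a))"
proof -
  have B: "cbilinear (B a)" for a using assms by (simp add: ctrilinear_def)
  have "B (a + a') = (\<lambda>b c. B a b c + B a' b c)" "B (c *\<^sub>C a) = (\<lambda>b d. c *\<^sub>C B a b d)" for a a' c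
    using assms by (simp_all add: ctrilinear_def clinear_def fun_eq_iff)
  then show ?thesis
    by (intro cbilinearI) (simp_all add: tensor_lift_fun_add tensor_lift_fun_scaleC
        clinear_add[OF clinear_tensor_lift[OF B]] clinear_scaleC[OF clinear_tensor_lift[OF B]])
qed

lemma clinear_tensor_lift3: "ctrilinear B \<Longrightarrow> clinear (tensor_lift3 B)"
  unfolding tensor_lift3_def by (rule clinear_tensor_lift[OF cbilinear_tensor_lift3])

lemma tensor_lift3_pure: "ctrilinear B \<Longrightarrow> tensor_lift3 B (a \<otimes> t) = tensor_lift (B a) t"
  unfolding tensor_lift3_def by (rule tensor_lift_of[OF cbilinear_tensor_lift3])

lemma tensor_lift3_of: "ctrilinear B \<Longrightarrow> tensor_lift3 B (a \<otimes> b \<otimes> c) = B a b c"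
  by (simp add: tensor_lift3_pure tensor_lift_of ctrilinear_def)

lemma ctrilinearI:
  "(\<And>a a' b c. B (a + a') b c = B a b c + B a' b c) \<Longrightarrow>
   (\<And>a b b' c. B a (b + b') c = B a b c + B a b' c) \<Longrightarrow>
   (\<And>a b c c'. B a b (c + c') = B a b c + B a b c') \<Longrightarrow>
   (\<And>a b c k. B (k *\<^sub>C a) b c = k *\<^sub>C B a b c) \<Longrightarrow>
   (\<And>a b c k. B a (k *\<^sub>C b) c = k *\<^sub>C B a b c) \<Longrightarrow>
   (\<And>a b c k. B a b (k *\<^sub>C c) = k *\<^sub>C B a b c) \<Longrightarrow> ctrilinear B"
  by (simp add: ctrilinear_def cbilinear_def clinear_def)

lemma tensor_assoc_bilinear:
  "cbilinear (\<lambda>a b. (a::'a::complex_vector) \<otimes> (b::'b::complex_vector) \<otimes> (c::'c::complex_vector))"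
  "cbilinear (\<lambda>ab c. tensor_lift (\<lambda>a b. (a::'a) \<otimes> (b::'b) \<otimes> (c::'c)) ab)"
proof -
  show *: "cbilinear (\<lambda>a b. (a::'a) \<otimes> (b::'b) \<otimes> c)" for c :: 'c
    by (intro cbilinearI) (simp_all add: tensor_of_linear)
  show "cbilinear (\<lambda>ab c. tensor_lift (\<lambda>a b. (a::'a) \<otimes> (b::'b) \<otimes> (c::'c)) ab)"
    by (intro cbilinearI)
      (simp_all add: clinear_add[OF clinear_tensor_lift[OF *]] clinear_scaleC[OF clinear_tensor_lift[OF *]]
        tensor_of_linear tensor_lift_fun_add tensor_lift_fun_scaleC)
qed

lemma tensor_assoc_of: "tensor_assoc ((a \<otimes> b) \<otimes> c) = a \<otimes> b \<otimes> c"
  by (simp add: tensor_assoc_def tensor_lift_of tensor_assoc_bilinear)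

lemma clinear_tensor_assoc: "clinear tensor_assoc"
  unfolding tensor_assoc_def by (rule clinear_tensor_lift[OF tensor_assoc_bilinear(2)])

lemma tensor_multiplicativeI:
  fixes f :: "('a::complex_algebra_1, 'b::complex_algebra_1) tensor \<Rightarrow> 'c::complex_algebra_1"
  assumes f: "clinear f" and pure: "\<And>a b c d. f ((a * c) \<otimes> (b * d)) = f (a \<otimes> b) * f (c \<otimes> d)"
  shows "f (x * y) = f x * f y"
proof (induction x rule: tensor_induct)
  case (pure a b)
  show ?case
    by (induction y rule: tensor_induct)
      (simp_all add: tensor_mult_of assms(2) tensor_mult_linear clinear_add[OF f] distrib_left)
qed (simp add: tensor_mult_linear clinear_add[OF f] distrib_right)

lemma tensor_assoc_mult: "tensor_assoc (x * y) = tensor_assoc x * tensor_assoc y"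
  for x y :: "(('a::complex_algebra_1, 'b::complex_algebra_1) tensor, 'c::complex_algebra_1) tensor"
proof (rule tensor_multiplicativeI[OF clinear_tensor_assoc])
  fix a c :: "('a, 'b) tensor" and b d :: 'c
  note lin = clinear_add[OF clinear_tensor_assoc] tensor_mult_linear tensor_of_linear
  show "tensor_assoc ((a * c) \<otimes> (b * d)) = tensor_assoc (a \<otimes> b) * tensor_assoc (c \<otimes> d)"
  proof (induction a rule: tensor_induct)
    case (pure a1 a2)
    show ?case
      by (induction c rule: tensor_induct) (simp_all add: lin tensor_mult_of tensor_assoc_of)
  qed (simp add: lin)
qed

lemma clinear_uea_coprod: "clinear uea_coprod"
  by (simp add: clinear_def uea_coprod_simps)

lemma tensor_map_mult:
  fixes f :: "'a::complex_algebra_1 \<Rightarrow> 'c::complex_algebra_1"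
    and g :: "'b::complex_algebra_1 \<Rightarrow> 'd::complex_algebra_1"
  assumes "clinear f" "clinear g" "\<And>x y. f (x * y) = f x * f y" "\<And>x y. g (x * y) = g x * g y"
  shows "tensor_map f g (x * y) = tensor_map f g x * tensor_map f g y"
  by (rule tensor_multiplicativeI) (simp_all add: clinear_tensor_map tensor_map_of assms tensor_mult_of)

section \<open>The inverse of a twist\<close>

lemma fps_lin_mult:
  fixes f :: "'a::ring_1 \<Rightarrow> 'b::ring_1"
  assumes "\<And>x y. f (x + y) = f x + f y" "\<And>x y. f (x * y) = f x * f y"
  shows "fps_lin f (F * G) = fps_lin f F * fps_lin f G"
proof (rule fps_ext)
  have zero: "f 0 = 0" using assms(1)[of 0 0] by simp
  have sum: "f (\<Sum>i\<in>I. g i) = (\<Sum>i\<in>I. f (g i))" for I :: "nat set" and g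
    by (induction I rule: infinite_finite_induct) (simp_all add: zero assms(1))
  show "fps_nth (fps_lin f (F * G)) m = fps_nth (fps_lin f F * fps_lin f G) m" for m
    by (simp add: fps_lin_def fps_mult_nth sum assms(2))
qed

lemma fps_lin_one: "f 0 = 0 \<Longrightarrow> f 1 = 1 \<Longrightarrow> fps_lin f 1 = 1"
  by (rule fps_ext) (simp add: fps_lin_def)

text \<open>The four maps of the cocycle equation, rebracketed so that all have the same target. They are
  homomorphisms of algebras, so the equation for a twist can be inverted term by term.\<close>

definition coprod_left :: "('n::finite uea, 'n uea) tensor \<Rightarrow> ('n uea, ('n uea, 'n uea) tensor) tensor"
  where "coprod_left t = tensor_assoc (tensor_map uea_coprod id t)"
definition coprod_right :: "('n::finite uea, 'n uea) tensor \<Rightarrow> ('n uea, ('n uea, 'n uea) tensor) tensor"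
  where "coprod_right t = tensor_map id uea_coprod t"
definition unit_right :: "('n::finite uea, 'n uea) tensor \<Rightarrow> ('n uea, ('n uea, 'n uea) tensor) tensor"
  where "unit_right t = tensor_assoc (t \<otimes> 1)"
definition unit_left :: "('n::finite uea, 'n uea) tensor \<Rightarrow> ('n uea, ('n uea, 'n uea) tensor) tensor"
  where "unit_left t = 1 \<otimes> t"

lemmas leg_defs = coprod_left_def coprod_right_def unit_right_def unit_left_def

lemma legs_pure:
  "coprod_left (u \<otimes> v) = tensor_assoc (uea_coprod u \<otimes> v)"
  "coprod_right (u \<otimes> v) = u \<otimes> uea_coprod v"
  "unit_right (u \<otimes> v) = u \<otimes> v \<otimes> 1"
  "unit_left (u \<otimes> v) = 1 \<otimes> u \<otimes> v"
  by (simp_all add: leg_defs tensor_map_of clinear_uea_coprod clinear_id tensor_assoc_of)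

lemma clinear_legs:
  "clinear (coprod_left :: ('n::finite uea, 'n uea) tensor \<Rightarrow> _)"
  "clinear (coprod_right :: ('n uea, 'n uea) tensor \<Rightarrow> _)"
  "clinear (unit_right :: ('n uea, 'n uea) tensor \<Rightarrow> _)"
  "clinear (unit_left :: ('n uea, 'n uea) tensor \<Rightarrow> _)"
  by (intro clinearI; simp add: leg_defs tensor_of_linear clinear_uea_coprod clinear_id
      clinear_add[OF clinear_tensor_map] clinear_scaleC[OF clinear_tensor_map]
      clinear_add[OF clinear_tensor_assoc] clinear_scaleC[OF clinear_tensor_assoc])+

lemma legs_mult:
  "coprod_left (x * y) = coprod_left x * coprod_left y"
  "coprod_right (x * y) = coprod_right x * coprod_right y"
  "unit_right (x * y) = unit_right x * unit_right y"
  "unit_left (x * y) = unit_left x * unit_left y"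
  by (simp_all add: leg_defs tensor_map_mult clinear_uea_coprod clinear_id uea_coprod_simps tensor_assoc_mult
      tensor_mult_of flip: tensor_assoc_mult)

lemma legs_one: "coprod_left 1 = 1" "coprod_right 1 = 1" "unit_right 1 = 1" "unit_left 1 = 1"
  by (simp_all add: one_tensor_def legs_pure uea_coprod_simps tensor_assoc_of)

lemma twist_inverse_cocycle:
  fixes F G :: "('n::finite uea, 'n uea) tensor fps"
  assumes "twist S F" and G: "F * G = 1" "G * F = 1"
  shows "fps_lin coprod_left G * fps_lin unit_right G = fps_lin coprod_right G * fps_lin unit_left G"
proof -
  have mult: "fps_lin f (X * Y) = fps_lin f X * fps_lin f Y" and one: "fps_lin f 1 = 1"
    if "f \<in> {coprod_left, coprod_right, unit_right, unit_left}" for f and X Y :: "('n uea, 'n uea) tensor fps"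
    using that clinear_legs legs_mult legs_one
    by (auto intro!: fps_lin_mult fps_lin_one clinear_zero clinear_add)
  define a b c d where "a = fps_lin unit_right F" and "b = fps_lin coprod_left F"
    and "c = fps_lin unit_left F" and "d = fps_lin coprod_right F"
  define a' b' c' d' where "a' = fps_lin unit_right G" and "b' = fps_lin coprod_left G"
    and "c' = fps_lin unit_left G" and "d' = fps_lin coprod_right G"
  have inv: "a * a' = 1" "b * b' = 1" "c' * c = 1" "d' * d = 1"
    unfolding a_def a'_def b_def b'_def c_def c'_def d_def d'_def
    by (simp_all add: mult[symmetric] G one)
  have assoc: "fps_lin tensor_assoc (X * Y) = fps_lin tensor_assoc X * fps_lin tensor_assoc Y"
    for X Y :: "((('n uea, 'n uea) tensor, 'n uea) tensor) fps"
    by (rule fps_lin_mult) (simp_all add: clinear_add[OF clinear_tensor_assoc] tensor_assoc_mult)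
  have "fps_lin tensor_assoc (fps_lin (\<lambda>t. t \<otimes> (1 :: 'n uea)) F) = a"
    "fps_lin tensor_assoc (fps_lin (tensor_map uea_coprod id) F) = b"
    "fps_lin (\<lambda>t. (1 :: 'n uea) \<otimes> t) F = c" "fps_lin (tensor_map id uea_coprod) F = d"
    by (rule fps_ext; simp add: a_def b_def c_def d_def fps_lin_def leg_defs)+
  then have eq: "a * b = c * d"
    using assms(1) by (simp add: twist_def assoc)
  have "d' * c' = (d' * c') * (a * (b * b') * a')"
    by (simp add: inv)
  also have "\<dots> = d' * (c' * (a * b)) * (b' * a')"
    by (simp only: mult.assoc)
  also have "\<dots> = (d' * ((c' * c) * d)) * (b' * a')"
    by (simp only: mult.assoc eq)
  also have "\<dots> = b' * a'"
    by (simp add: inv)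
  finally show ?thesis by (simp add: a'_def b'_def c'_def d'_def)
qed

lemma twist_inverse_cocycle_order_1:
  assumes "twist S F" "F * G = 1" "G * F = 1" "fps_nth G 0 = 1"
  shows "coprod_left (fps_nth G 1) + unit_right (fps_nth G 1)
       = coprod_right (fps_nth G 1) + unit_left (fps_nth G 1)"
  using arg_cong[OF twist_inverse_cocycle[OF assms(1-3)], of "\<lambda>x. fps_nth x 1"]
  by (simp add: fps_lin_def fps_mult_nth assms(4) legs_one add.commute)

lemma twist_inverse_cocycle_order_2:
  assumes "twist S F" "F * G = 1" "G * F = 1" "fps_nth G 0 = 1"
  shows "coprod_left (fps_nth G 2) + coprod_left (fps_nth G 1) * unit_right (fps_nth G 1)
           + unit_right (fps_nth G 2)
       = coprod_right (fps_nth G 2) + coprod_right (fps_nth G 1) * unit_left (fps_nth G 1)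
           + unit_left (fps_nth G 2)"
  using arg_cong[OF twist_inverse_cocycle[OF assms(1-3)], of "\<lambda>x. fps_nth x 2"]
  by (simp add: fps_lin_def fps_mult_nth assms(4) legs_one numeral_2_eq_2 algebra_simps)

section \<open>The antisymmetric first-order part of a twist\<close>

definition flip :: "('a::complex_vector, 'b::complex_vector) tensor \<Rightarrow> ('b, 'a) tensor" where
  "flip = tensor_lift (\<lambda>a b. b \<otimes> a)"

lemma cbilinear_flip: "cbilinear (\<lambda>a b. b \<otimes> a)"
  by (intro cbilinearI) (simp_all add: tensor_of_linear)

lemma clinear_flip: "clinear flip"
  unfolding flip_def by (rule clinear_tensor_lift[OF cbilinear_flip])

lemma flip_of: "flip (a \<otimes> b) = b \<otimes> a"
  by (simp add: flip_def tensor_lift_of cbilinear_flip)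

lemma flip_flip: "flip (flip t) = t"
  by (induction t rule: tensor_induct) (simp_all add: flip_of clinear_add[OF clinear_flip])

lemma flip_mult: "flip (x * y) = flip x * flip y"
  for x y :: "('a::complex_algebra_1, 'b::complex_algebra_1) tensor"
  by (rule tensor_multiplicativeI[OF clinear_flip]) (simp add: flip_of tensor_mult_of)

lemma uea_word_induct [case_names word add]:
  assumes "\<And>w c. P (c *\<^sub>C prod_list (map uea_of w))" "\<And>u v. P u \<Longrightarrow> P v \<Longrightarrow> P (u + v)"
  shows "P (u :: 'n::finite uea)"
proof (induction u rule: uea.abs_induct)
  case (1 p)
  have word: "abs_uea (Poly_Mapping.single w 1) = prod_list (map uea_of w)" for w :: "(complex^'n^'n) list"
  proof (induction w)
    case Nil
    have "Poly_Mapping.single ([] :: (complex^'n^'n) list) (1 :: complex) = 1"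
      by (simp add: zero_list_def flip: single_one)
    then show ?case by (simp add: one_uea.abs_eq)
  next
    case (Cons A w)
    have "Poly_Mapping.single (A # w) (1 :: complex) = Poly_Mapping.single [A] 1 * Poly_Mapping.single w 1"
      by (simp add: mult_single plus_list_def)
    then show ?case using Cons by (simp add: times_uea.abs_eq[symmetric] uea_of.abs_eq)
  qed
  show ?case
  proof (induction p rule: poly_mapping_single_induct)
    case (1 w c)
    have "Poly_Mapping.single w c = c *\<^sub>C Poly_Mapping.single w 1" by (simp add: scaleC_single)
    then have "abs_uea (Poly_Mapping.single w c) = c *\<^sub>C prod_list (map uea_of w)"
      by (simp add: word scaleC_uea.abs_eq[symmetric])
    then show ?case using assms(1) by simp
  next
    case (2 p q)
    then show ?case using assms(2) by (simp add: plus_uea.abs_eq[symmetric])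
  qed
qed

text \<open>\<open>U\<close> is cocommutative because it is generated by primitive elements.\<close>

lemma uea_coprod_cocommutative: "flip (uea_coprod u) = uea_coprod (u :: 'n::finite uea)"
proof (induction u rule: uea_word_induct)
  case (word w c)
  have "flip (uea_coprod (prod_list (map uea_of w))) = uea_coprod (prod_list (map uea_of w))"
    by (induction w)
      (simp_all add: uea_coprod_simps flip_mult clinear_add[OF clinear_flip] flip_of add.commute,
        simp add: one_tensor_def flip_of)
  then show ?case by (simp add: uea_coprod_simps clinear_scaleC[OF clinear_flip])
qed (simp add: uea_coprod_simps clinear_add[OF clinear_flip])

text \<open>The second Adams operation (convolution square of the identity) of the bialgebra \<open>U\<close>. It
  multiplies primitive elements by \<open>2\<close>, and serves as a linear test for them.\<close>

definition adams2 :: "'n::finite uea \<Rightarrow> 'n uea" where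
  "adams2 u = tensor_lift (*) (uea_coprod u)"

lemma cbilinear_mult: "cbilinear ((*) :: 'a::complex_algebra_1 \<Rightarrow> 'a \<Rightarrow> 'a)"
  by (intro cbilinearI) (simp_all add: algebra_simps mult_scaleC_left mult_scaleC_right)

lemma clinear_adams2: "clinear (adams2 :: 'n::finite uea \<Rightarrow> _)"
  using clinear_tensor_lift[OF cbilinear_mult[where 'a = "'n uea"]]
  by (simp add: clinear_def adams2_def uea_coprod_simps)

text \<open>This is dual to the fact that the antisymmetric part of a Hochschild \<open>2\<close>-cocycle \<open>c\<close> of a commutative
  algebra is a biderivation. There the derivation rule in \<open>f\<close> and \<open>g\<close> is a combination of the cocycle
  equation at \<open>(f, g, k)\<close>, \<open>(k, f, g)\<close> and \<open>(f, k, g)\<close>; here the three equations come from three ways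
  of multiplying two of the three legs.\<close>

lemma twist_antisymmetric_part_adams2:
  fixes c :: "('n::finite uea, 'n uea) tensor"
  assumes "coprod_left c + unit_right c = coprod_right c + unit_left c"
  shows "tensor_map adams2 id (c - flip c) = 2 *\<^sub>C (c - flip c)"
proof -
  note lin = tensor_of_linear mult_scaleC_left mult_scaleC_right distrib_left distrib_right
  define B1 B2 B3 :: "'n uea \<Rightarrow> 'n uea \<Rightarrow> 'n uea \<Rightarrow> ('n uea, 'n uea) tensor" where
    "B1 x y z = (x * y) \<otimes> z" and "B2 x y z = (y * z) \<otimes> x" and "B3 x y z = (x * z) \<otimes> y" for x y z
  have tri: "ctrilinear B1" "ctrilinear B2" "ctrilinear B3"
    by (rule ctrilinearI, simp_all only: lin B1_def B2_def B3_def)+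
  \<comment> \<open>The images of the remaining terms of the cocycle equation, which cancel in the combination.\<close>
  define M P Q where "M = tensor_lift (\<lambda>x y :: 'n uea. (x * y) \<otimes> (1 :: 'n uea))"
    and "P = tensor_lift (\<lambda>x y :: 'n uea. (x \<otimes> 1) * uea_coprod y)"
    and "Q = tensor_lift (\<lambda>x y :: 'n uea. uea_coprod x * (y \<otimes> 1))"
  have bil: "cbilinear (\<lambda>x y :: 'n uea. (x * y) \<otimes> (1 :: 'n uea))"
    "cbilinear (\<lambda>x y :: 'n uea. (x \<otimes> 1) * uea_coprod y)"
    "cbilinear (\<lambda>x y :: 'n uea. uea_coprod x * (y \<otimes> 1))"
    by (rule cbilinearI, simp_all only: lin uea_coprod_simps)+
  note MPQ = tensor_lift_of[OF bil(1), folded M_def] tensor_lift_of[OF bil(2), folded P_def]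
    tensor_lift_of[OF bil(3), folded Q_def]
  note clin = clinear_tensor_lift[OF bil(1), folded M_def] clinear_tensor_lift[OF bil(2), folded P_def]
    clinear_tensor_lift[OF bil(3), folded Q_def]
  have T: "tensor_lift3 B1 (x \<otimes> y \<otimes> z) = (x * y) \<otimes> z" "tensor_lift3 B2 (x \<otimes> y \<otimes> z) = (y * z) \<otimes> x"
    "tensor_lift3 B3 (x \<otimes> y \<otimes> z) = (x * z) \<otimes> y" for x y z
    by (simp_all only: tensor_lift3_of tri B1_def B2_def B3_def)
  note Tlin = clinear_tensor_lift3[OF tri(1)] clinear_tensor_lift3[OF tri(2)] clinear_tensor_lift3[OF tri(3)]
  note A = clinear_add[OF clinear_tensor_assoc] tensor_of_linear Tlin[THEN clinear_add]
    clinear_add[OF clinear_flip] distrib_left distrib_right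
    clinear_add[OF clinear_tensor_lift[OF cbilinear_mult]]
  have left1: "tensor_lift3 B1 (tensor_assoc (s \<otimes> y)) = tensor_lift (*) s \<otimes> y"
    and left2: "tensor_lift3 B2 (tensor_assoc (s \<otimes> y)) = flip s * (y \<otimes> 1)"
    and left3: "tensor_lift3 B3 (tensor_assoc (s \<otimes> y)) = s * (y \<otimes> 1)" for s y
    by (induction s rule: tensor_induct;
        simp only: A tensor_assoc_of T tensor_mult_of flip_of
          tensor_lift_of[OF cbilinear_mult] mult_1_left mult_1_right)+
  have right1: "tensor_lift3 B1 (x \<otimes> s) = (x \<otimes> 1) * s"
    and right2: "tensor_lift3 B2 (x \<otimes> s) = tensor_lift (*) s \<otimes> x"
    and right3: "tensor_lift3 B3 (x \<otimes> s) = (x \<otimes> 1) * flip s" for s x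
    by (induction s rule: tensor_induct;
        simp only: A T tensor_mult_of flip_of tensor_lift_of[OF cbilinear_mult]
          mult_1_left mult_1_right)+
  let ?\<psi> = "tensor_map adams2 (id :: 'n uea \<Rightarrow> 'n uea)"
  have psi: "clinear ?\<psi>" by (simp add: clinear_tensor_map clinear_adams2 clinear_id)
  have psi_pure: "?\<psi> (x \<otimes> y) = tensor_lift (*) (uea_coprod x) \<otimes> y" for x y
    by (simp add: tensor_map_of clinear_adams2 clinear_id adams2_def)
  note all = clinear_legs[THEN clinear_add] A clin[THEN clinear_add] psi[THEN clinear_add]
  have T1: "tensor_lift3 B1 (coprod_left c) = ?\<psi> c" "tensor_lift3 B1 (unit_right c) = M c"
    "tensor_lift3 B1 (coprod_right c) = P c" "tensor_lift3 B1 (unit_left c) = c"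
   and T2: "tensor_lift3 B2 (coprod_left c) = Q c" "tensor_lift3 B2 (unit_right c) = flip c"
    "tensor_lift3 B2 (coprod_right c) = ?\<psi> (flip c)" "tensor_lift3 B2 (unit_left c) = M c"
   and T3: "tensor_lift3 B3 (coprod_left c) = Q c" "tensor_lift3 B3 (unit_right c) = c"
    "tensor_lift3 B3 (coprod_right c) = P c" "tensor_lift3 B3 (unit_left c) = flip c" for c
    by (induction c rule: tensor_induct;
        simp only: mult_1_left mult_1_right psi_pure all legs_pure MPQ left1 left2 left3 right1 right2 right3 T
          uea_coprod_cocommutative flip_of tensor_mult_of tensor_lift_of[OF cbilinear_mult])+
  have "?\<psi> c + M c = P c + c" "Q c + flip c = ?\<psi> (flip c) + M c" "Q c + c = P c + flip c"
    using arg_cong[OF assms, of "tensor_lift3 B1"] arg_cong[OF assms, of "tensor_lift3 B2"]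
      arg_cong[OF assms, of "tensor_lift3 B3"]
    by (simp_all add: Tlin[THEN clinear_add] T1 T2 T3)
  then have "?\<psi> c = P c + c - M c" "?\<psi> (flip c) = Q c + flip c - M c" "P c = Q c + c - flip c"
    by (simp_all only: eq_diff_eq)
  then have "?\<psi> c - ?\<psi> (flip c) = (c - flip c) + (c - flip c)"
    by simp
  also have "\<dots> = 2 *\<^sub>C (c - flip c)"
    using scaleC_add_left[of 1 1 "c - flip c"] by (simp add: scaleC_one)
  finally show ?thesis by (simp add: clinear_diff[OF psi])
qed

lemma two_power_eq_iff: "(2 :: complex) ^ k = 2 ^ n \<longleftrightarrow> k = n"
proof -
  have "(2 :: complex) ^ k = 2 ^ n \<longleftrightarrow> of_nat (2 ^ k) = (of_nat (2 ^ n) :: complex)" by simp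
  also have "\<dots> \<longleftrightarrow> (2 :: nat) ^ k = 2 ^ n" by (rule of_nat_eq_iff)
  finally show ?thesis by simp
qed

text \<open>By induction: \<open>\<Psi> - 2 ^ N\<close> kills the top term and multiplies the others by nonzero numbers.\<close>

lemma eigenvectors_sum_zero:
  assumes \<Psi>: "clinear \<Psi>" and eig: "\<And>k. k \<le> N \<Longrightarrow> \<Psi> (t k) = 2 ^ k *\<^sub>C t k"
    and sum: "(\<Sum>k\<le>N. t k) = 0" and "j \<le> N"
  shows "t j = (0 :: 'a::complex_vector)"
  using eig sum \<open>j \<le> N\<close>
proof (induction N arbitrary: t j)
  case 0
  then show ?case by simp
next
  case (Suc N)
  define u where "u k = (2 ^ k - 2 ^ Suc N) *\<^sub>C t k" for k
  have "(\<Sum>k\<le>Suc N. u k) = \<Psi> (\<Sum>k\<le>Suc N. t k) - 2 ^ Suc N *\<^sub>C (\<Sum>k\<le>Suc N. t k)"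
    using Suc.prems(1)
    by (simp add: u_def clinear_sum[OF \<Psi>] complex_vector.scale_left_diff_distrib sum_subtractf
        complex_vector.scale_sum_right del: sum.atMost_Suc power_Suc)
  also have "\<dots> = 0" using Suc.prems(2) clinear_zero[OF \<Psi>] by simp
  finally have "(\<Sum>k\<le>N. u k) = 0" by (simp add: u_def)
  moreover have "\<Psi> (u k) = 2 ^ k *\<^sub>C u k" if "k \<le> N" for k
    using Suc.prems(1)[of k] that by (simp add: u_def clinear_scaleC[OF \<Psi>] scaleC_scaleC mult.commute)
  ultimately have u: "u k = 0" if "k \<le> N" for k using Suc.IH that by blast
  have "t k = 0" if "k \<le> N" for k
  proof -
    have "(2 :: complex) ^ k \<noteq> 2 ^ Suc N"
      using that by (simp only: two_power_eq_iff)
    then show ?thesis using u[OF that] by (simp add: u_def)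
  qed
  moreover from this have "t (Suc N) = 0" using Suc.prems(2) by simp
  ultimately show ?case using Suc.prems(3) by (cases "j = Suc N") auto
qed

lemma span_Union_decompose:
  assumes "t \<in> cspan (\<Union>k. X k)"
  shows "\<exists>N s. (\<forall>k. s k \<in> cspan (X k)) \<and> t = (\<Sum>k\<le>(N::nat). s k)"
  using assms
proof (induction rule: complex_vector.span_induct_alt)
  case base
  show ?case by (intro exI[of _ 0] exI[of _ "\<lambda>_. 0"]) (simp add: complex_vector.span_zero)
next
  case (step c x y)
  then obtain k N s where x: "x \<in> X k" and s: "\<And>k. s k \<in> cspan (X k)" "y = (\<Sum>k\<le>N. s k)"
    by blast
  define s' where "s' j = (if j \<le> N then s j else 0) + (if j = k then c *\<^sub>C x else 0)" for j
  have "(if j \<le> N then s j else 0) \<in> cspan (X j)"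
    "(if j = k then c *\<^sub>C x else 0) \<in> cspan (X j)" for j
    using x s(1) by (simp_all add: complex_vector.span_zero complex_vector.span_scale complex_vector.span_base)
  then have "s' j \<in> cspan (X j)" for j
    unfolding s'_def by (rule complex_vector.span_add)
  moreover have "(\<Sum>j\<le>max N k. s' j) = y + c *\<^sub>C x"
  proof -
    have "(\<Sum>j\<le>max N k. if j \<le> N then s j else 0) = (\<Sum>j\<le>N. s j)"
      by (rule sum.mono_neutral_cong_right) auto
    moreover have "(\<Sum>j\<le>max N k. if j = k then c *\<^sub>C x else 0) = c *\<^sub>C x"
      by (simp add: sum.delta)
    ultimately show ?thesis by (simp add: s'_def sum.distrib s(2))
  qed
  ultimately show ?case
    by (intro exI[of _ "max N k"] exI[of _ s']) (simp add: add.commute)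
qed

text \<open>Split \<open>t\<close> into eigenvectors \<open>s k\<close>. Then \<open>(2 ^ k - 2) s k\<close> are eigenvectors with sum zero, so
  \<open>s k\<close> vanishes unless \<open>k = 1\<close>.\<close>

lemma eigenvector_in_span:
  assumes \<Psi>: "clinear \<Psi>" and eig: "\<And>k x. x \<in> X k \<Longrightarrow> \<Psi> x = 2 ^ k *\<^sub>C x"
    and t: "t \<in> cspan (\<Union>k. X k)" "\<Psi> t = 2 *\<^sub>C t"
  shows "t \<in> cspan (X 1)"
proof -
  obtain N s where s: "\<And>k. s k \<in> cspan (X k)" "t = (\<Sum>k\<le>N. s k)"
    using span_Union_decompose[OF t(1)] by blast
  have eig': "\<Psi> x = 2 ^ k *\<^sub>C x" if "x \<in> cspan (X k)" for k x
    using that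
  proof (induction rule: complex_vector.span_induct_alt)
    case (step c x y)
    then show ?case using eig[of x k]
      by (simp add: clinear_add[OF \<Psi>] clinear_scaleC[OF \<Psi>] scaleC_add_right scaleC_scaleC mult.commute)
  qed (simp add: clinear_zero[OF \<Psi>])
  have "(\<Sum>k\<le>N. (2 ^ k - 2) *\<^sub>C s k) = \<Psi> t - 2 *\<^sub>C t"
    using eig'[OF s(1)]
    by (simp add: s(2) clinear_sum[OF \<Psi>] complex_vector.scale_left_diff_distrib sum_subtractf
        complex_vector.scale_sum_right)
  then have sum: "(\<Sum>k\<le>N. (2 ^ k - 2) *\<^sub>C s k) = 0" using t(2) by simp
  have "(2 ^ k - 2) *\<^sub>C s k = 0" if "k \<le> N" for k
    by (rule eigenvectors_sum_zero[OF \<Psi> _ sum that])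
      (simp add: clinear_scaleC[OF \<Psi>] eig'[OF s(1)] scaleC_scaleC mult.commute)
  moreover have "(2 :: complex) ^ k - 2 \<noteq> 0" if "k \<noteq> 1" for k
    using two_power_eq_iff[of k 1] that by simp
  ultimately have "s k = 0" if "k \<le> N" "k \<noteq> 1" for k using that by auto
  then have "t = (\<Sum>k\<in>{..N} \<inter> {1}. s k)"
    unfolding s(2) by (intro sum.mono_neutral_right) auto
  then show ?thesis
    using s(1)[of 1] by (cases "1 \<le> N") (auto simp: complex_vector.span_zero)
qed

text \<open>The leading term of a polynomial of degree \<open>n\<close> is eliminated by subtracting \<open>2 ^ n\<close> times its value
  at \<open>t\<close> from its value at \<open>2 t\<close>.\<close>

lemma subspace_coefficients:
  assumes W: "complex_vector.subspace W"
    and "\<And>t :: real. (\<Sum>k\<le>n. complex_of_real t ^ k *\<^sub>C c k) \<in> W" and "j \<le> n"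
  shows "c j \<in> W"
  using assms(2,3)
proof (induction n arbitrary: c j)
  case 0
  then show ?case using 0(1)[of 0] by (simp add: scaleC_one)
next
  case (Suc n)
  note sub = complex_vector.subspace_diff[OF W] complex_vector.subspace_scale[OF W]
  have low: "c k \<in> W" if "k \<le> n" for k
  proof -
    have "(\<Sum>k\<le>n. complex_of_real t ^ k *\<^sub>C (2 ^ k - 2 ^ Suc n) *\<^sub>C c k)
        = (\<Sum>k\<le>Suc n. complex_of_real (2 * t) ^ k *\<^sub>C c k)
          - 2 ^ Suc n *\<^sub>C (\<Sum>k\<le>Suc n. complex_of_real t ^ k *\<^sub>C c k)" for t
    proof -
      have "(\<Sum>k\<le>Suc n. complex_of_real (2 * t) ^ k *\<^sub>C c k)
          - 2 ^ Suc n *\<^sub>C (\<Sum>k\<le>Suc n. complex_of_real t ^ k *\<^sub>C c k)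
        = (\<Sum>k\<le>Suc n. complex_of_real t ^ k *\<^sub>C (2 ^ k - 2 ^ Suc n) *\<^sub>C c k)"
        unfolding complex_vector.scale_sum_right sum_subtractf[symmetric]
        by (intro sum.cong refl)
          (simp add: scaleC_scaleC power_mult_distrib algebra_simps complex_vector.scale_left_diff_distrib
            del: power_Suc)
      then show ?thesis by simp
    qed
    then have "(\<Sum>k\<le>n. complex_of_real t ^ k *\<^sub>C (2 ^ k - 2 ^ Suc n) *\<^sub>C c k) \<in> W" for t
      by (simp only: sub(1)[OF Suc.prems(1) sub(2)[OF Suc.prems(1)]])
    then have "(2 ^ k - 2 ^ Suc n) *\<^sub>C c k \<in> W"
      using Suc.IH[of "\<lambda>k. (2 ^ k - 2 ^ Suc n) *\<^sub>C c k"] that by simp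
    then have "inverse (2 ^ k - 2 ^ Suc n) *\<^sub>C (2 ^ k - 2 ^ Suc n) *\<^sub>C c k \<in> W" by (rule sub)
    moreover have "(2 :: complex) ^ k \<noteq> 2 ^ Suc n"
      using that by (simp only: two_power_eq_iff)
    ultimately show ?thesis by (simp add: scaleC_scaleC scaleC_one)
  qed
  have "(\<Sum>k\<le>Suc n. c k) - (\<Sum>k\<le>n. c k) \<in> W"
    using Suc.prems(1)[of 1] complex_vector.subspace_sum[OF W, of "{..n}" c] low
    by (intro sub) (simp_all add: scaleC_one)
  then show ?case using low Suc.prems(2) by (cases "j = Suc n") auto
qed

lemma power_linear_expansion:
  fixes x y :: "'a::complex_algebra_1"
  shows "\<exists>c. c 0 = x ^ n \<and> (n > 0 \<longrightarrow> c 1 = (\<Sum>i<n. x ^ i * y * x ^ (n - 1 - i))) \<and>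
     (\<forall>t. (x + t *\<^sub>C y) ^ n = (\<Sum>k\<le>n. t ^ k *\<^sub>C c k))"
proof (induction n)
  case 0
  show ?case by (intro exI[of _ "\<lambda>_. 1"]) (simp add: scaleC_one)
next
  case (Suc n)
  then obtain c where c: "c 0 = x ^ n" "n > 0 \<longrightarrow> c 1 = (\<Sum>i<n. x ^ i * y * x ^ (n - 1 - i))"
    "\<And>t. (x + t *\<^sub>C y) ^ n = (\<Sum>k\<le>n. t ^ k *\<^sub>C c k)" by blast
  define c' where "c' k = (if k \<le> n then x * c k else 0) + (case k of 0 \<Rightarrow> 0 | Suc l \<Rightarrow> y * c l)" for k
  have "(x + t *\<^sub>C y) ^ Suc n = (\<Sum>k\<le>Suc n. t ^ k *\<^sub>C c' k)" for t
  proof -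
    have "(\<Sum>k\<le>Suc n. t ^ k *\<^sub>C c' k) = (\<Sum>k\<le>Suc n. t ^ k *\<^sub>C (if k \<le> n then x * c k else 0))
        + (\<Sum>k\<le>Suc n. t ^ k *\<^sub>C (case k of 0 \<Rightarrow> 0 | Suc l \<Rightarrow> y * c l))"
      by (simp add: c'_def scaleC_add_right sum.distrib del: sum.atMost_Suc)
    also have "(\<Sum>k\<le>Suc n. t ^ k *\<^sub>C (if k \<le> n then x * c k else 0)) = (\<Sum>k\<le>n. t ^ k *\<^sub>C (x * c k))"
      by simp
    also have "(\<Sum>k\<le>Suc n. t ^ k *\<^sub>C (case k of 0 \<Rightarrow> 0 | Suc l \<Rightarrow> y * c l))
        = (\<Sum>k\<le>n. t ^ Suc k *\<^sub>C (y * c k))"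
      by (subst sum.atMost_Suc_shift) simp
    also have "(\<Sum>k\<le>n. t ^ k *\<^sub>C (x * c k)) + (\<Sum>k\<le>n. t ^ Suc k *\<^sub>C (y * c k))
       = (x + t *\<^sub>C y) * (\<Sum>k\<le>n. t ^ k *\<^sub>C c k)"
      by (simp add: distrib_right sum_distrib_left mult_scaleC_right mult_scaleC_left
          complex_vector.scale_sum_right scaleC_scaleC scaleC_add_right sum.distrib mult.commute)
    finally show ?thesis by (simp add: c(3))
  qed
  moreover have "c' 0 = x ^ Suc n" by (simp add: c'_def c(1))
  moreover have "c' 1 = (\<Sum>i<Suc n. x ^ i * y * x ^ (Suc n - 1 - i))"
  proof (cases n)
    case 0
    then show ?thesis by (simp add: c'_def c(1))
  next
    case (Suc m)
    have "c' 1 = x * (\<Sum>i<n. x ^ i * y * x ^ (n - 1 - i)) + y * x ^ n"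
      using c(1,2) Suc by (simp add: c'_def)
    also have "\<dots> = (\<Sum>i<Suc n. x ^ i * y * x ^ (Suc n - 1 - i))"
      by (subst sum.lessThan_Suc_shift) (simp add: sum_distrib_left mult.assoc)
    finally show ?thesis .
  qed
  ultimately show ?case by (intro exI[of _ c']) blast
qed

text \<open>Symmetrization, by induction on the length. Modulo shorter words all factors commute, so
  \<open>(m + 1) b a\<^sup>m\<close> is the derivative at \<open>t = 0\<close> of \<open>(a + t b)\<^sup>m\<^sup>+\<^sup>1\<close>, which is a coefficient of a
  polynomial with values in the span of the powers.\<close>

lemma uea_powers_span_word:
  "prod_list (map uea_of w) \<in> cspan {uea_of a ^ k | a k. k \<le> length w}"
proof -
  define S :: "nat \<Rightarrow> 'a uea set" where "S m = cspan {uea_of a ^ k | a k. k \<le> m}" for m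
  have S_mono: "S m \<subseteq> S n" if "m \<le> n" for m n
    unfolding S_def by (rule complex_vector.span_mono) (use that in \<open>auto intro: order_trans\<close>)
  have S_sub: "complex_vector.subspace (S m)" for m
    unfolding S_def by (rule complex_vector.subspace_span)
  have "length w \<le> m \<Longrightarrow> prod_list (map uea_of w) \<in> S m" for m and w :: "(complex^'a^'a) list"
  proof (induction m arbitrary: w)
    case 0
    then have "prod_list (map uea_of w) = uea_of 0 ^ 0" by simp
    then show ?case unfolding S_def by (intro complex_vector.span_base) blast
  next
    case (Suc m)
    note words = Suc.IH
    have step: "uea_of b * uea_of a ^ m \<in> S (Suc m)" for a b :: "complex^'a^'a"
    proof -
      let ?x = "uea_of a" and ?y = "uea_of b"
      obtain c where c: "c 1 = (\<Sum>i<Suc m. ?x ^ i * ?y * ?x ^ (Suc m - 1 - i))"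
        "\<And>t. (?x + t *\<^sub>C ?y) ^ Suc m = (\<Sum>k\<le>Suc m. t ^ k *\<^sub>C c k)"
        using power_linear_expansion[of ?x "Suc m" ?y] by blast
      have "(\<Sum>k\<le>Suc m. complex_of_real t ^ k *\<^sub>C c k) \<in> S (Suc m)" for t
      proof -
        have "(\<Sum>k\<le>Suc m. complex_of_real t ^ k *\<^sub>C c k) = uea_of (a + t *\<^sub>R b) ^ Suc m"
          by (simp only: c(2)[symmetric] uea_of_linear)
        then show ?thesis unfolding S_def
          by (simp only:) (rule complex_vector.span_base, blast)
      qed
      then have 1: "c 1 \<in> S (Suc m)"
        by (intro subspace_coefficients[OF S_sub, where n = "Suc m" and c = c and j = 1]) simp_all
      have 2: "?x ^ i * ?y * ?x ^ j - ?y * ?x ^ (i + j) \<in> S m" if "i + j = m" for i j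
        using that
      proof (induction i arbitrary: j)
        case 0
        show ?case by (simp add: complex_vector.subspace_0[OF S_sub])
      next
        case (Suc i)
        have "prod_list (map uea_of (replicate i a @ gl_bracket a b # replicate j a)) \<in> S m"
          using Suc.prems by (intro words) simp
        then have "?x ^ i * uea_of (gl_bracket a b) * ?x ^ j \<in> S m"
          by (simp add: mult.assoc)
        moreover have "?x ^ i * uea_of (gl_bracket a b) * ?x ^ j
            = ?x ^ Suc i * ?y * ?x ^ j - ?x ^ i * ?y * ?x ^ Suc j"
          by (simp only: uea_of_bracket right_diff_distrib left_diff_distrib power_Suc2[of _ i]
              power_Suc[of _ j] mult.assoc)
        ultimately have "?x ^ Suc i * ?y * ?x ^ j - ?x ^ i * ?y * ?x ^ Suc j \<in> S m" by simp
        from complex_vector.subspace_add[OF S_sub this Suc.IH[of "Suc j"]] Suc.prems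
        show ?case by (simp del: power_Suc)
      qed
      have "(\<Sum>i<Suc m. ?x ^ i * ?y * ?x ^ (m - i) - ?y * ?x ^ (i + (m - i))) \<in> S (Suc m)"
        using 2 S_mono[of m "Suc m"] by (intro complex_vector.subspace_sum[OF S_sub]) auto
      from complex_vector.subspace_diff[OF S_sub 1 this]
      have "(\<Sum>i<Suc m. ?y * ?x ^ (i + (m - i))) \<in> S (Suc m)"
        unfolding c(1) sum_subtractf by (simp del: sum.lessThan_Suc)
      also have "(\<Sum>i<Suc m. ?y * ?x ^ (i + (m - i))) = (\<Sum>i<Suc m. ?y * ?x ^ m)"
        by (intro sum.cong) auto
      also have "\<dots> = of_nat (Suc m) *\<^sub>C (?y * ?x ^ m)"
        by (simp only: complex_vector.sum_constant_scale card_lessThan)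
      finally have "inverse (of_nat (Suc m)) *\<^sub>C of_nat (Suc m) *\<^sub>C (?y * ?x ^ m) \<in> S (Suc m)"
        by (rule complex_vector.subspace_scale[OF S_sub])
      then show ?thesis by (simp add: scaleC_scaleC scaleC_one del: of_nat_Suc)
    qed
    show ?case
    proof (cases w)
      case Nil
      then show ?thesis using Suc.IH[of "[]"] S_mono[of m "Suc m"] by auto
    next
      case (Cons b v)
      have "uea_of b * s \<in> S (Suc m)" if "s \<in> S m" for s
        using that unfolding S_def[of m]
      proof (induction rule: complex_vector.span_induct_alt)
        case base
        show ?case using complex_vector.subspace_0[OF S_sub] by simp
      next
        case (step c x y)
        obtain a k where x: "x = uea_of a ^ k" "k \<le> m" using step by blast
        have "uea_of b * x \<in> S (Suc m)"
        proof (cases "k = m")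
          case True
          then show ?thesis using \<open>\<And>a b. uea_of b * uea_of a ^ m \<in> S (Suc m)\<close> x by simp
        next
          case False
          then have "uea_of b * x \<in> S m"
            using Suc.IH[of "b # replicate k a"] x by simp
          then show ?thesis using S_mono[of m "Suc m"] by auto
        qed
        then show ?case
          using step complex_vector.subspace_add[OF S_sub] complex_vector.subspace_scale[OF S_sub]
          by (simp add: distrib_left mult_scaleC_right)
      qed
      then show ?thesis using Suc Cons by simp
    qed
  qed
  then show ?thesis unfolding S_def by blast
qed

text \<open>The elements \<open>a \<otimes> 1\<close> and \<open>1 \<otimes> a\<close> commute, and multiplication sends both to \<open>a\<close>, so the
  coproduct of \<open>a\<^sup>k\<close> goes to \<open>(a + a)\<^sup>k\<close>.\<close>

lemma adams2_power: "adams2 (uea_of a ^ k) = 2 ^ k *\<^sub>C uea_of a ^ k"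
proof -
  let ?x = "uea_of a" and ?L = "tensor_lift ((*) :: 'a uea \<Rightarrow> 'a uea \<Rightarrow> 'a uea)"
  let ?D = "?x \<otimes> 1 + 1 \<otimes> ?x"
  note L = clinear_tensor_lift[OF cbilinear_mult[where 'a = "'a uea"]]
  define C where "C = cspan {?x ^ i \<otimes> ?x ^ j | i j. True}"
  have step: "?D * y \<in> C \<and> ?L (?D * y) = 2 *\<^sub>C (?x * ?L y)" if "y \<in> C" for y
    using that unfolding C_def
  proof (induction rule: complex_vector.span_induct_alt)
    case base
    show ?case by (simp add: complex_vector.span_zero clinear_zero[OF L])
  next
    case (step c y z)
    obtain i j where y: "y = ?x ^ i \<otimes> ?x ^ j" using step by blast
    have D: "?D * y = ?x ^ Suc i \<otimes> ?x ^ j + ?x ^ i \<otimes> ?x ^ Suc j"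
      by (simp add: y distrib_right tensor_mult_of)
    have "?D * y \<in> cspan {?x ^ i \<otimes> ?x ^ j | i j. True}"
      unfolding D by (intro complex_vector.span_add complex_vector.span_base) blast+
    moreover have "?L (?D * y) = 2 *\<^sub>C (?x * ?L y)"
      unfolding D using scaleC_add_left[of 1 1 "?x ^ (Suc i + j)"]
      by (simp add: clinear_add[OF L] tensor_lift_of[OF cbilinear_mult] y power_add mult.assoc
          scaleC_one power_commutes)
        (simp add: mult.assoc[symmetric] power_commutes)
    ultimately show ?case using step
      by (simp add: distrib_left mult_scaleC_right complex_vector.span_add complex_vector.span_scale
          clinear_add[OF L] clinear_scaleC[OF L] scaleC_add_right complex_vector.scale_left_commute)
  qed
  have "uea_coprod (?x ^ k) \<in> C \<and> ?L (uea_coprod (?x ^ k)) = 2 ^ k *\<^sub>C ?x ^ k"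
  proof (induction k)
    case 0
    have "1 \<otimes> 1 \<in> C" unfolding C_def by (intro complex_vector.span_base CollectI exI[of _ 0]) simp
    then show ?case
      by (simp add: uea_coprod_simps one_tensor_def tensor_lift_of[OF cbilinear_mult] scaleC_one)
  next
    case (Suc k)
    then show ?case using step[of "uea_coprod (?x ^ k)"]
      by (simp add: uea_coprod_simps mult_scaleC_right scaleC_scaleC)
  qed
  then show ?thesis by (simp add: adams2_def)
qed

lemma uea_powers_span: "u \<in> cspan (\<Union>k. {uea_of a ^ k | a. True})"
proof (induction u rule: uea_word_induct)
  case (word w c)
  have "prod_list (map uea_of w) \<in> cspan (\<Union>k. {uea_of a ^ k | a. True})"
    by (rule subsetD[OF complex_vector.span_mono uea_powers_span_word]) auto
  then show ?case by (rule complex_vector.span_scale)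
qed (rule complex_vector.span_add)

lemma clinear_span:
  assumes f: "clinear f" and "u \<in> cspan X"
  shows "f u \<in> cspan (f ` X)"
  using assms(2)
proof (induction rule: complex_vector.span_induct_alt)
  case (step c x y)
  then show ?case
    by (simp add: clinear_add[OF f] clinear_scaleC[OF f] complex_vector.span_add complex_vector.span_scale
        complex_vector.span_base)
qed (simp add: clinear_zero[OF f] complex_vector.span_zero)

text \<open>On \<open>k\<close>-th powers of elements of \<open>g\<close>, which span \<open>U\<close>, the Adams operation is multiplication by
  \<open>2 ^ k\<close>. Hence the eigenvalue \<open>2\<close> forces \<open>g\<close> in the first leg and, by antisymmetry, in the second.\<close>

lemma adams2_eigenvector_in_g_tensor_g:
  fixes r :: "('n::finite uea, 'n uea) tensor"
  assumes eig: "tensor_map adams2 id r = 2 *\<^sub>C r" and skew: "flip r = - r"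
  shows "r \<in> cspan {uea_of a \<otimes> uea_of b | a b. True}"
proof -
  let ?\<Psi>1 = "tensor_map (adams2 :: 'n uea \<Rightarrow> 'n uea) (id :: 'n uea \<Rightarrow> 'n uea)"
    and ?\<Psi>2 = "tensor_map (id :: 'n uea \<Rightarrow> 'n uea) (adams2 :: 'n uea \<Rightarrow> 'n uea)"
  have lin: "clinear ?\<Psi>1" "clinear ?\<Psi>2"
    by (simp_all add: clinear_tensor_map clinear_adams2 clinear_id)
  have pure: "?\<Psi>1 (u \<otimes> v) = adams2 u \<otimes> v" "?\<Psi>2 (u \<otimes> v) = u \<otimes> adams2 v" for u v
    by (simp_all add: tensor_map_of clinear_adams2 clinear_id)
  have flip: "?\<Psi>2 (flip t) = flip (?\<Psi>1 t)" for t
    by (induction t rule: tensor_induct)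
      (simp_all only: pure flip_of clinear_add[OF lin(1)] clinear_add[OF lin(2)] clinear_add[OF clinear_flip])
  have "- ?\<Psi>2 r = ?\<Psi>2 (flip r)"
    using clinear_diff[OF lin(2), of 0 r] by (simp add: skew clinear_zero[OF lin(2)])
  also have "\<dots> = 2 *\<^sub>C flip r"
    by (simp only: flip eig clinear_scaleC[OF clinear_flip])
  also have "\<dots> = - (2 *\<^sub>C r)"
    by (simp only: skew complex_vector.scale_minus_right)
  finally have eig2: "?\<Psi>2 r = 2 *\<^sub>C r" by simp
  have "r \<in> cspan (\<Union>k. {uea_of a ^ k \<otimes> v | a v. True})"
  proof (induction r rule: tensor_induct)
    case (pure u v)
    show ?case
      by (rule subsetD[OF complex_vector.span_mono clinear_span[OF clinear_tensor_of_left uea_powers_span]]) auto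
  qed (rule complex_vector.span_add)
  then have "r \<in> cspan {uea_of a ^ 1 \<otimes> v | a v. True}"
    by (rule eigenvector_in_span[OF lin(1) _ _ eig, rotated])
      (auto simp: pure adams2_power tensor_of_linear simp del: id_apply)
  moreover have "{uea_of a ^ 1 \<otimes> v | (a :: complex^'n^'n) (v :: 'n uea). True}
      \<subseteq> cspan (\<Union>k. {uea_of a \<otimes> uea_of b ^ k | a b. True})"
  proof
    fix t assume "t \<in> {uea_of a ^ 1 \<otimes> v | (a :: complex^'n^'n) (v :: 'n uea). True}"
    then obtain a and v :: "'n uea" where t: "t = uea_of a \<otimes> v" by auto
    show "t \<in> cspan (\<Union>k. {uea_of a \<otimes> uea_of b ^ k | a b. True})"
      unfolding t
      by (rule subsetD[OF complex_vector.span_mono clinear_span[OF clinear_tensor_of_right uea_powers_span]]) auto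
  qed
  ultimately have "r \<in> cspan (\<Union>k. {uea_of a \<otimes> uea_of b ^ k | a b. True})"
    using complex_vector.span_minimal[OF _ complex_vector.subspace_span] by blast
  then have "r \<in> cspan {uea_of a \<otimes> uea_of b ^ 1 | a b. True}"
    by (rule eigenvector_in_span[OF lin(2) _ _ eig2, rotated])
      (auto simp: pure adams2_power tensor_of_linear simp del: id_apply)
  then show ?thesis by simp
qed

lemma span_tensors_finite_sum:
  assumes "r \<in> cspan {f a \<otimes> g b | a b. True}"
  shows "\<exists>(N::nat) c a b. r = (\<Sum>j<N. c j *\<^sub>C (f (a j) \<otimes> g (b j)))"
  using assms
proof (induction rule: complex_vector.span_induct_alt)
  case base
  show ?case by (intro exI[of _ 0]) simp
next
  case (step k x y)
  obtain a0 b0 where "x = f a0 \<otimes> g b0" using step.hyps by blast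
  moreover obtain N c a b where "y = (\<Sum>j<(N::nat). c j *\<^sub>C (f (a j) \<otimes> g (b j)))"
    using step.IH by blast
  ultimately show ?case
    by (intro exI[of _ "Suc N"] exI[of _ "c(N := k)"] exI[of _ "a(N := a0)"] exI[of _ "b(N := b0)"])
      (simp add: add.commute)
qed

theorem twist_r_matrix:
  fixes F G :: "('n::finite uea, 'n uea) tensor fps"
  assumes "twist S F" "F * G = 1" "G * F = 1" "fps_nth G 0 = 1"
  shows "\<exists>(N::nat) c a b. fps_nth G 1 - flip (fps_nth G 1)
    = (\<Sum>j<N. c j *\<^sub>C (uea_of (a j) \<otimes> uea_of (b j)))"
proof (rule span_tensors_finite_sum, rule adams2_eigenvector_in_g_tensor_g)
  show "tensor_map adams2 id (fps_nth G 1 - flip (fps_nth G 1)) = 2 *\<^sub>C (fps_nth G 1 - flip (fps_nth G 1))"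
    by (rule twist_antisymmetric_part_adams2[OF twist_inverse_cocycle_order_1[OF assms]])
  show "flip (fps_nth G 1 - flip (fps_nth G 1)) = - (fps_nth G 1 - flip (fps_nth G 1))"
    by (simp add: clinear_diff[OF clinear_flip] flip_flip)
qed

section \<open>Lines and the action of matrices\<close>

lemma bounded_bilinear_matrix_vector_mult:
  "bounded_bilinear ((*v) :: complex^'n^'m \<Rightarrow> complex^'n \<Rightarrow> complex^'m)"
  unfolding bilinear_conv_bounded_bilinear[symmetric] bilinear_def
  by (auto intro!: linearI simp: matrix_vector_mult_def vec_eq_iff scaleR_sum_right distrib_left
      distrib_right sum.distrib)

lemma bounded_bilinear_matrix_matrix_mult:
  "bounded_bilinear ((**) :: complex^'n^'m \<Rightarrow> complex^'k^'n \<Rightarrow> complex^'k^'m)"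
  unfolding bilinear_conv_bounded_bilinear[symmetric] bilinear_def
  by (auto intro!: linearI simp: matrix_matrix_mult_def vec_eq_iff scaleR_sum_right distrib_left
      distrib_right sum.distrib)

lemma bounded_bilinear_vector_scalar_mult:
  "bounded_bilinear ((*s) :: complex \<Rightarrow> complex^'n \<Rightarrow> complex^'n)"
  unfolding bilinear_conv_bounded_bilinear[symmetric] bilinear_def
  by (auto intro!: linearI simp: vec_eq_iff algebra_simps)

lemma Rep_cproj_line: "v \<noteq> 0 \<Longrightarrow> Rep_cproj (line v) = range (\<lambda>c. c *s v)"
  unfolding line_def by (rule Abs_cproj_inverse) blast

lemma cproj_eq_line: "\<exists>v. v \<noteq> 0 \<and> p = line v"
  using Rep_cproj[of p] Rep_cproj_inverse[of p] unfolding line_def by force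

lemma line_scale:
  assumes "c \<noteq> 0" shows "line (c *s v) = line v"
proof -
  have "range (\<lambda>d. d *s (c *s v)) = range (\<lambda>d. d *s v)"
  proof
    show "range (\<lambda>d. d *s v) \<subseteq> range (\<lambda>d. d *s (c *s v))"
    proof
      fix u assume "u \<in> range (\<lambda>d. d *s v)"
      then obtain d where "u = d *s v" by blast
      then have "u = (d / c) *s (c *s v)" using assms by (simp add: vector_smult_assoc)
      then show "u \<in> range (\<lambda>d. d *s (c *s v))" by blast
    qed
  qed (auto simp: vector_smult_assoc)
  then show ?thesis by (simp add: line_def)
qed

lemma cproj_act_line:
  assumes "v \<noteq> 0" shows "cproj_act g (line v) = line (g *v v)"
proof -
  have "(*v) g ` range (\<lambda>c. c *s v) = range (\<lambda>c. c *s (g *v v))"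
    by (simp add: image_image vector_scalar_commute)
  then show ?thesis using assms by (simp add: cproj_act_def Rep_cproj_line) (simp add: line_def)
qed

lemma has_vector_derivative_quadratic_error:
  assumes "\<delta> > 0" "\<And>t. \<bar>t\<bar> < \<delta> \<Longrightarrow> norm (f t - w - t *\<^sub>R d) \<le> D * t\<^sup>2"
  shows "(f has_vector_derivative d) (at 0)" "f 0 = w"
proof -
  show f0: "f 0 = w" using assms(2)[of 0] assms(1) by simp
  show "(f has_vector_derivative d) (at 0)"
    unfolding has_vector_derivative_def has_derivative_at
  proof (intro conjI)
    show "bounded_linear (\<lambda>x. x *\<^sub>R d)" by (rule bounded_linear_scaleR_left)
    show "(\<lambda>h. norm (f (0 + h) - f 0 - h *\<^sub>R d) / norm h) \<midarrow>0\<rightarrow> 0"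
    proof (rule Lim_null_comparison)
      have "norm (f (0 + t) - f 0 - t *\<^sub>R d) / norm t \<le> D * \<bar>t\<bar>" if "\<bar>t\<bar> < \<delta>" for t
      proof (cases "t = 0")
        case False
        then show ?thesis using assms(2)[OF that] f0
          by (simp add: divide_le_eq power2_eq_square abs_mult_self_eq mult.assoc)
      qed simp
      then show "\<forall>\<^sub>F t in at 0. norm (norm (f (0 + t) - f 0 - t *\<^sub>R d) / norm t) \<le> D * \<bar>t\<bar>"
        using assms(1) by (auto simp: eventually_at intro!: exI[of _ \<delta>])
      show "((\<lambda>t. D * \<bar>t\<bar>) \<longlongrightarrow> 0) (at 0)"
        by (auto intro!: tendsto_eq_intros)
    qed
  qed
qed

text \<open>The series from the quadratic term on is dominated by that of a real exponential function.\<close>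

lemma matrix_exp_quadratic_error:
  fixes A :: "complex^'n::finite^'n"
  shows "\<exists>C\<ge>0. \<forall>t. \<bar>t\<bar> \<le> 1 \<longrightarrow> norm (matrix_exp (t *\<^sub>R A) - mat 1 - t *\<^sub>R A) \<le> C * t\<^sup>2"
proof -
  define P where "P k = ((\<lambda>B. A ** B) ^^ k) (mat 1)" for k
  obtain K where K: "K > 0" "\<And>B :: complex^'n^'n. norm (A ** B) \<le> norm B * K"
    using bounded_linear.pos_bounded[OF bounded_bilinear.bounded_linear_right[OF bounded_bilinear_matrix_matrix_mult]]
    by blast
  define N where "N = norm (mat 1 :: complex^'n^'n)"
  have P: "norm (P k) \<le> N * K ^ k" for k
  proof (induction k)
    case (Suc k)
    have "norm (P (Suc k)) \<le> norm (P k) * K" using K(2)[of "P k"] by (simp add: P_def)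
    also have "\<dots> \<le> (N * K ^ k) * K" using Suc K(1) by (intro mult_right_mono) auto
    finally show ?case by (simp add: mult_ac)
  qed (simp add: P_def N_def)
  have tP: "((\<lambda>B. (t *\<^sub>R A) ** B) ^^ k) (mat 1) = t ^ k *\<^sub>R P k" for t k
  proof (induction k)
    case (Suc k)
    then show ?case
      by (simp add: P_def bounded_bilinear.scaleR_left[OF bounded_bilinear_matrix_matrix_mult]
          bounded_bilinear.scaleR_right[OF bounded_bilinear_matrix_matrix_mult])
  qed (simp add: P_def)
  define b where "b k = N * (K ^ k /\<^sub>R fact k)" for k
  have b: "summable b" unfolding b_def by (intro summable_mult summable_exp_generic)
  have b': "summable (\<lambda>k. b (k + 2))" using b by (rule summable_ignore_initial_segment)
  have "norm (matrix_exp (t *\<^sub>R A) - mat 1 - t *\<^sub>R A) \<le> suminf (\<lambda>k. b (k + 2)) * t\<^sup>2" if t: "\<bar>t\<bar> \<le> 1" for t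
  proof -
    define a where "a k = (1 / fact k) *\<^sub>R t ^ k *\<^sub>R P k" for k
    have nP: "norm (P k) / fact k \<le> b k" for k
      using P[of k] by (simp add: b_def field_simps)
    have bound: "norm (a (k + 2)) \<le> b (k + 2) * t\<^sup>2" for k
    proof -
      have "\<bar>t\<bar> ^ (k + 2) = \<bar>t\<bar> ^ k * t\<^sup>2" by (simp only: power_add power2_abs)
      also have "\<dots> \<le> t\<^sup>2" using t by (intro mult_left_le_one_le power_le_one) auto
      finally have "\<bar>t\<bar> ^ (k + 2) \<le> t\<^sup>2" .
      then have "(norm (P (k + 2)) / fact (k + 2)) * \<bar>t\<bar> ^ (k + 2) \<le> b (k + 2) * t\<^sup>2"
        using nP[of "k + 2"] by (intro mult_mono) (auto intro: order_trans[OF _ nP])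
      then show ?thesis by (simp add: a_def abs_mult power_abs field_simps del: fact_Suc)
    qed
    have s2: "summable (\<lambda>k. b (k + 2) * t\<^sup>2)" using b' by (rule summable_mult2)
    have sn: "summable (\<lambda>k. norm (a (k + 2)))"
      by (rule summable_comparison_test'[OF s2]) (use bound in simp)
    have "summable (\<lambda>k. a (k + 2))" using summable_norm_cancel[OF sn] .
    then have sa: "summable a" by (simp only: summable_iff_shift)
    have "matrix_exp (t *\<^sub>R A) = suminf a"
      unfolding matrix_exp_def tP by (rule arg_cong[where f = suminf]) (simp add: a_def fun_eq_iff)
    also have "\<dots> = suminf (\<lambda>k. a (k + 2)) + (\<Sum>k<2. a k)" by (rule suminf_split_initial_segment[OF sa])
    also have "(\<Sum>k<2. a k) = mat 1 + t *\<^sub>R A"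
      by (simp add: numeral_2_eq_2 a_def P_def matrix_mul_rid)
    finally have "matrix_exp (t *\<^sub>R A) - mat 1 - t *\<^sub>R A = suminf (\<lambda>k. a (k + 2))" by simp
    also have "norm \<dots> \<le> suminf (\<lambda>k. norm (a (k + 2)))" by (rule summable_norm[OF sn])
    also have "\<dots> \<le> suminf (\<lambda>k. b (k + 2) * t\<^sup>2)" by (rule suminf_le[OF bound sn s2])
    also have "\<dots> = suminf (\<lambda>k. b (k + 2)) * t\<^sup>2" by (rule suminf_mult2[OF b', symmetric])
    finally show ?thesis .
  qed
  moreover have "0 \<le> suminf (\<lambda>k. b (k + 2))"
    using K(1) by (intro suminf_nonneg[OF b']) (simp add: b_def N_def)
  ultimately show ?thesis by blast
qed

text \<open>The curve \<open>y t = exp (t A)\<^sup>-\<^sup>1 v\<close> solves \<open>y + M t y = v\<close> with \<open>M t = exp (t A) - 1\<close> of order \<open>t\<close>.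
  Substituting the equation into itself gives \<open>y = v - t A v\<close> up to an error of order \<open>t\<^sup>2\<close>.\<close>

lemma matrix_inv_exp_has_vector_derivative:
  fixes A :: "complex^'n::finite^'n"
  shows "((\<lambda>t. matrix_inv (matrix_exp (t *\<^sub>R A)) *v v) has_vector_derivative - (A *v v)) (at 0)"
    and "matrix_inv (matrix_exp (0 *\<^sub>R A)) *v v = v"
proof -
  obtain C where C: "C \<ge> 0" "\<And>t. \<bar>t\<bar> \<le> 1 \<Longrightarrow> norm (matrix_exp (t *\<^sub>R A) - mat 1 - t *\<^sub>R A) \<le> C * t\<^sup>2"
    using matrix_exp_quadratic_error by blast
  obtain B where B: "B > 0" "\<And>(M :: complex^'n^'n) x. norm (M *v x) \<le> norm M * norm x * B"
    using bounded_bilinear.pos_bounded[OF bounded_bilinear_matrix_vector_mult] by blast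
  define L where "L = norm A + C"
  define M where "M t = matrix_exp (t *\<^sub>R A) - mat 1" for t
  define y where "y t = matrix_inv (matrix_exp (t *\<^sub>R A)) *v v" for t
  \<comment> \<open>For \<open>\<bar>t\<bar> < \<delta>\<close> the operator norm of \<open>M t\<close> is at most \<open>1 / 2\<close>, so \<open>exp (t A)\<close> is invertible.\<close>
  define \<delta> where "\<delta> = min 1 (1 / (2 * (B * L + 1)))"
  have L: "L \<ge> 0" using C(1) by (simp add: L_def)
  have pos: "B * L + 1 > 0" using B(1) L by (simp add: add_nonneg_pos)
  then have \<delta>: "\<delta> > 0" "\<delta> \<le> 1" by (simp_all add: \<delta>_def)
  have M: "norm (M t) \<le> L * \<bar>t\<bar>" if "\<bar>t\<bar> \<le> 1" for t
  proof -
    have "norm (M t) \<le> norm (M t - t *\<^sub>R A) + norm (t *\<^sub>R A)"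
      using norm_triangle_ineq[of "M t - t *\<^sub>R A" "t *\<^sub>R A"] by simp
    also have "\<dots> \<le> C * t\<^sup>2 + \<bar>t\<bar> * norm A" using C(2)[OF that] by (simp add: M_def)
    also have "C * t\<^sup>2 \<le> C * \<bar>t\<bar>"
      using that mult_left_le[of "\<bar>t\<bar>" "\<bar>t\<bar>"] C(1)
      by (intro mult_left_mono) (simp_all add: power2_eq_square flip: abs_mult)
    finally show ?thesis by (simp add: L_def algebra_simps)
  qed
  have half: "norm (M t *v x) \<le> norm x / 2" if "\<bar>t\<bar> < \<delta>" for t x
  proof -
    have "B * L * \<bar>t\<bar> \<le> (B * L + 1) * \<delta>"
      using that B(1) L by (intro mult_mono) auto
    also have "\<dots> \<le> (B * L + 1) * (1 / (2 * (B * L + 1)))"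
      using pos by (intro mult_left_mono) (auto simp: \<delta>_def)
    also have "\<dots> = 1 / 2" using pos by (simp add: field_simps)
    finally have h: "B * L * \<bar>t\<bar> \<le> 1 / 2" .
    have "norm (M t *v x) \<le> norm (M t) * norm x * B" by (rule B(2))
    also have "\<dots> \<le> (L * \<bar>t\<bar>) * norm x * B"
      using M[of t] that \<delta> B(1) by (intro mult_right_mono) auto
    also have "\<dots> = (B * L * \<bar>t\<bar>) * norm x" by (simp add: mult_ac)
    also have "\<dots> \<le> (1 / 2) * norm x" using h by (intro mult_right_mono) auto
    finally show ?thesis by simp
  qed
  have EM: "matrix_exp (t *\<^sub>R A) *v x = x + M t *v x" for t x
    by (simp add: M_def matrix_vector_mult_diff_rdistrib)
  have inv: "y t + M t *v y t = v" if "\<bar>t\<bar> < \<delta>" for t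
  proof -
    have "inj ((*v) (matrix_exp (t *\<^sub>R A)))"
    proof (rule injI)
      fix x z assume "matrix_exp (t *\<^sub>R A) *v x = matrix_exp (t *\<^sub>R A) *v z"
      then have "x - z = - (M t *v (x - z))" 
        by (simp add: EM matrix_vector_mult_diff_distrib algebra_simps)
      then have "norm (x - z) \<le> norm (x - z) / 2" using half[OF that, of "x - z"] by (metis norm_minus_cancel)
      then show "x = z" by simp
    qed
    then obtain B' where "B' ** matrix_exp (t *\<^sub>R A) = mat 1"
      using matrix_left_invertible_injective[of "matrix_exp (t *\<^sub>R A)"] by auto
    then have "invertible (matrix_exp (t *\<^sub>R A))"
      using matrix_left_right_inverse unfolding invertible_def by blast
    then have "matrix_exp (t *\<^sub>R A) ** matrix_inv (matrix_exp (t *\<^sub>R A)) = mat 1"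
      unfolding matrix_inv_def invertible_def by (rule someI2_ex) blast
    then have "matrix_exp (t *\<^sub>R A) *v y t = v"
      by (simp add: y_def matrix_vector_mul_assoc)
    then show ?thesis by (simp add: EM)
  qed
  define D where "D = 2 * norm v * B * C + 2 * norm A * B * L * B * norm v"
  have err: "norm (y t - v - t *\<^sub>R (- (A *v v))) \<le> D * t\<^sup>2" if t: "\<bar>t\<bar> < \<delta>" for t
  proof -
    have ny: "norm (y t) \<le> 2 * norm v"
      using inv[OF t] half[OF t, of "y t"] norm_triangle_ineq2[of "y t" "- (M t *v y t)"] by simp
    have "y t - v - t *\<^sub>R (- (A *v v)) = - (M t *v y t) + t *\<^sub>R (A *v v)"
      using inv[OF t] by (simp add: algebra_simps)
    also have "\<dots> = - ((M t - t *\<^sub>R A) *v y t) + t *\<^sub>R (A *v (M t *v y t))"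
    proof -
      have "A *v v = A *v y t + A *v (M t *v y t)"
        using inv[OF t] by (metis matrix_vector_right_distrib)
      then show ?thesis
        by (simp add: matrix_vector_mult_diff_rdistrib scaleR_add_right
            bounded_bilinear.scaleR_left[OF bounded_bilinear_matrix_vector_mult])
    qed
    also have "norm \<dots> \<le> norm ((M t - t *\<^sub>R A) *v y t) + norm (t *\<^sub>R (A *v (M t *v y t)))"
      by (metis norm_triangle_ineq norm_minus_cancel)
    also have "norm ((M t - t *\<^sub>R A) *v y t) \<le> (C * t\<^sup>2) * (2 * norm v) * B"
      using B(1) C t \<delta> ny
      by - (rule order_trans[OF B(2)], intro mult_right_mono mult_mono, auto simp: M_def)
    also have "norm (t *\<^sub>R (A *v (M t *v y t))) \<le> \<bar>t\<bar> * (norm A * ((L * \<bar>t\<bar>) * (2 * norm v) * B) * B)"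
    proof -
      have "norm (M t *v y t) \<le> (L * \<bar>t\<bar>) * (2 * norm v) * B"
        using B(1) L M[of t] t \<delta> ny by - (rule order_trans[OF B(2)], intro mult_right_mono mult_mono, auto)
      then have "norm (A *v (M t *v y t)) \<le> norm A * ((L * \<bar>t\<bar>) * (2 * norm v) * B) * B"
        using B(1) by - (rule order_trans[OF B(2)], intro mult_right_mono mult_left_mono, auto)
      then show ?thesis by (simp add: mult_left_mono)
    qed
    moreover have "(C * t\<^sup>2) * (2 * norm v) * B + \<bar>t\<bar> * (norm A * ((L * \<bar>t\<bar>) * (2 * norm v) * B) * B)
        = 2 * norm v * B * C * t\<^sup>2 + 2 * norm A * B * L * B * norm v * \<bar>t\<bar>\<^sup>2"
      by algebra
    ultimately show ?thesis unfolding D_def distrib_right power2_abs by linarith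
  qed
  show "((\<lambda>t. matrix_inv (matrix_exp (t *\<^sub>R A)) *v v) has_vector_derivative - (A *v v)) (at 0)"
    "matrix_inv (matrix_exp (0 *\<^sub>R A)) *v v = v"
    using has_vector_derivative_quadratic_error[OF \<delta>(1) err] unfolding y_def by blast+
qed

section \<open>Functions on projective space as functions on the punctured vector space\<close>

text \<open>Both operations below give \<open>0\<close> at the origin, where no line is defined, so that algebraic
  identities for functions on the punctured space hold as equations of functions on \<open>\<complex>\<^sup>n\<close>. The sign of
  \<open>lie_deriv\<close> is that of the action \<open>f (g\<^sup>-\<^sup>1 x)\<close>; it makes \<open>lie_deriv\<close> a representation.\<close>

definition pull :: "('n::finite cproj \<Rightarrow> 'b::zero) \<Rightarrow> complex^'n \<Rightarrow> 'b" where
  "pull f v = (if v = 0 then 0 else f (line v))"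

definition lie_deriv ::
  "complex^'n^'n \<Rightarrow> (complex^'n::finite \<Rightarrow> 'b::real_normed_vector) \<Rightarrow> complex^'n \<Rightarrow> 'b" where
  "lie_deriv A \<phi> v = (if v = 0 then 0 else - fder \<phi> v (A *v v))"

abbreviation smooth_punctured :: "(complex^'n::finite \<Rightarrow> 'b::real_normed_vector) \<Rightarrow> bool" where
  "smooth_punctured \<equiv> smooth_on (- {0})"

lemma open_punctured: "open (- {0 :: 'a::real_normed_vector})"
  by (simp add: open_Compl)

text \<open>In the direction to the right, \<open>pull f\<close> is on \<open>v $ i \<noteq> 0\<close> the composition of the \<open>i\<close>-th chart
  expression with \<open>v \<mapsto> v / v $ i\<close>. In the other, a chart expression is the restriction of \<open>pull f\<close> to an
  affine hyperplane.\<close>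

lemma C_inf_iff_pull: "f \<in> C_inf \<longleftrightarrow> smooth_punctured (pull f)"
proof
  assume f: "f \<in> C_inf"
  define U where "U i = {v :: complex^'a. v $ i \<noteq> 0}" for i
  have U: "open (U i)" for i
    unfolding U_def by (intro open_Collect_neq continuous_intros)
  have "smooth_on (U i) (pull f)" for i
  proof -
    let ?N = "\<lambda>v :: complex^'a. inverse (v $ i) *s v"
    have "smooth_on (U i) ?N"
      by (intro smooth_on_bilinear[OF bounded_bilinear_vector_scalar_mult] smooth_on_inverse U
          smooth_on_linear[OF U] bounded_linear_vec_nth bounded_linear_ident) (auto simp: U_def)
    moreover have "smooth_on UNIV (\<lambda>w. f (chart_inv i w))"
      using f by (simp add: C_inf_def smooth_iff_smooth_on_UNIV)
    ultimately have sm: "smooth_on (U i) (\<lambda>v. f (chart_inv i (?N v)))"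
      by (intro smooth_on_compose[OF U open_UNIV, of "\<lambda>w. f (chart_inv i w)" i ?N]) auto
    have eq: "f (chart_inv i (?N v)) = pull f v" if "v \<in> U i" for v
    proof -
      have "(\<chi> j. if j = i then 1 else ?N v $ j) = ?N v"
        using that by (auto simp: vec_eq_iff U_def)
      then show ?thesis using that line_scale[of "inverse (v $ i)" v]
        by (auto simp: chart_inv_def pull_def U_def)
    qed
    show ?thesis by (rule smooth_on_cong[OF U eq sm])
  qed
  then have "smooth_on (\<Union>i\<in>UNIV. U i) (pull f)" using U by (intro smooth_on_Union) auto
  moreover have "(\<Union>i\<in>UNIV. U i) = - {0}" by (auto simp: U_def vec_eq_iff)
  ultimately show "smooth_punctured (pull f)" by simp
next
  assume f: "smooth_punctured (pull f)"
  show "f \<in> C_inf"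
    unfolding C_inf_def
  proof safe
    fix i
    let ?l = "\<lambda>w :: complex^'a. \<chi> j. if j = i then 0 else w $ j"
    have l: "(\<chi> j. if j = i then 1 else w $ j) = axis i 1 + ?l w" for w
      by (auto simp: vec_eq_iff axis_def)
    have "linear ?l" by (auto intro!: linearI simp: vec_eq_iff)
    then have "smooth_on UNIV (\<lambda>w. axis i 1 + ?l w)"
      by (intro smooth_on_add smooth_on_const smooth_on_linear open_UNIV) (simp add: linear_conv_bounded_linear)
    moreover have nz: "axis i 1 + ?l w \<noteq> 0" for w
      by (auto simp: vec_eq_iff axis_def intro!: exI[of _ i])
    ultimately have "smooth_on UNIV (\<lambda>w. pull f (axis i 1 + ?l w))"
      by (intro smooth_on_compose[OF open_UNIV open_punctured f]) auto
    also have "(\<lambda>w. pull f (axis i 1 + ?l w)) = (\<lambda>w. f (chart_inv i w))"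
      using nz by (simp add: pull_def chart_inv_def l fun_eq_iff)
    finally show "smooth (\<lambda>w. f (chart_inv i w))" by (simp add: smooth_iff_smooth_on_UNIV)
  qed
qed

lemma frechet_derivative_smooth_direction:
  fixes \<phi> :: "'a::euclidean_space \<Rightarrow> 'b::real_normed_vector"
  assumes "smooth_on U \<phi>" "x \<in> U"
  shows "fder \<phi> x w = (\<Sum>b\<in>Basis. (w \<bullet> b) *\<^sub>R fder \<phi> x b)"
proof -
  have "linear (fder \<phi> x)"
    using smooth_onD(1)[OF assms] has_derivative_linear by blast
  then have "fder \<phi> x (\<Sum>b\<in>Basis. (w \<bullet> b) *\<^sub>R b)
      = (\<Sum>b\<in>Basis. (w \<bullet> b) *\<^sub>R fder \<phi> x b)"
    by (simp add: linear_sum linear_scale)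
  then show ?thesis by (simp add: euclidean_representation)
qed

lemma smooth_punctured_lie_deriv:
  assumes "smooth_punctured \<phi>" shows "smooth_punctured (lie_deriv A \<phi>)"
proof -
  have lin: "bounded_linear ((*v) A)"
    by (rule bounded_bilinear.bounded_linear_right[OF bounded_bilinear_matrix_vector_mult])
  have "smooth_punctured (\<lambda>v. \<Sum>b\<in>Basis. (- (A *v v) \<bullet> b) *\<^sub>R fder \<phi> v b)"
    by (intro smooth_on_sum smooth_on_bilinear[OF bounded_bilinear_scaleR]
        smooth_on_bilinear[OF bounded_bilinear_inner] smooth_onD(2) assms smooth_on_const
        smooth_on_linear open_punctured bounded_linear_minus lin)
  moreover have eq: "(\<Sum>b\<in>Basis. (- (A *v v) \<bullet> b) *\<^sub>R fder \<phi> v b) = lie_deriv A \<phi> v"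
    if "v \<in> - {0}" for v
    using frechet_derivative_smooth_direction[OF assms that, of "A *v v"] that
    by (simp add: lie_deriv_def sum_negf)
  ultimately show ?thesis using smooth_on_cong[OF open_punctured eq] by simp
qed

lemma lie_deriv_bilinear:
  assumes B: "bounded_bilinear B" and \<phi>: "smooth_punctured \<phi>" and \<psi>: "smooth_punctured \<psi>"
  shows "lie_deriv A (\<lambda>v. B (\<phi> v) (\<psi> v)) v = B (lie_deriv A \<phi> v) (\<psi> v) + B (\<phi> v) (lie_deriv A \<psi> v)"
proof (cases "v = 0")
  case False
  then have v: "v \<in> - {0}" by simp
  from frechet_derivative_eqI[OF bounded_bilinear.FDERIV[OF B smooth_onD(1)[OF \<phi> v] smooth_onD(1)[OF \<psi> v]]]
  show ?thesis using False
    by (simp add: lie_deriv_def bounded_bilinear.minus_left[OF B] bounded_bilinear.minus_right[OF B])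
qed (simp add: lie_deriv_def bounded_bilinear.zero_left[OF B] bounded_bilinear.zero_right[OF B])

lemma lie_deriv_add:
  assumes \<phi>: "smooth_punctured \<phi>" and \<psi>: "smooth_punctured \<psi>"
  shows "lie_deriv A (\<lambda>v. \<phi> v + \<psi> v) v = lie_deriv A \<phi> v + lie_deriv A \<psi> v"
proof (cases "v = 0")
  case False
  then have v: "v \<in> - {0}" by simp
  from frechet_derivative_eqI[OF has_derivative_add[OF smooth_onD(1)[OF \<phi> v] smooth_onD(1)[OF \<psi> v]]]
  show ?thesis using False by (simp add: lie_deriv_def)
qed (simp add: lie_deriv_def)

lemma lie_deriv_const: "lie_deriv A (\<lambda>v. c) v = 0"
  using frechet_derivative_eqI[OF has_derivative_const[of c]] by (simp add: lie_deriv_def)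

lemmas lie_deriv_mult = lie_deriv_bilinear[OF bounded_bilinear_mult]

lemma lie_deriv_add_matrix:
  assumes "smooth_punctured \<phi>"
  shows "lie_deriv (A + B) \<phi> v = lie_deriv A \<phi> v + lie_deriv B \<phi> v"
    and "lie_deriv (r *\<^sub>R A) \<phi> v = r *\<^sub>R lie_deriv A \<phi> v"
proof -
  have "linear (fder \<phi> v)" if "v \<noteq> 0"
    using smooth_onD(1)[OF assms] that has_derivative_linear by auto
  then show "lie_deriv (A + B) \<phi> v = lie_deriv A \<phi> v + lie_deriv B \<phi> v"
    "lie_deriv (r *\<^sub>R A) \<phi> v = r *\<^sub>R lie_deriv A \<phi> v"
    by (simp_all add: lie_deriv_def matrix_vector_mult_add_rdistrib linear_add linear_scale
        bounded_bilinear.scaleR_left[OF bounded_bilinear_matrix_vector_mult])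
qed

lemma lie_deriv_sum_matrix:
  assumes "smooth_punctured \<phi>"
  shows "lie_deriv (\<Sum>i\<in>I. r i *\<^sub>R A i) \<phi> v = (\<Sum>i\<in>I. r i *\<^sub>R lie_deriv (A i) \<phi> v)"
proof (induction I rule: infinite_finite_induct)
  case (insert i I)
  then show ?case by (simp add: lie_deriv_add_matrix[OF assms])
qed (use lie_deriv_add_matrix(2)[OF assms, of 0 0 v] in simp_all)

lemma lie_deriv_lie_deriv:
  fixes \<phi> :: "complex^'n::finite \<Rightarrow> 'b::euclidean_space"
  assumes \<phi>: "smooth_punctured \<phi>" and "v \<noteq> 0"
  shows "lie_deriv A (lie_deriv B \<phi>) v = fder \<phi> v (B *v (A *v v))
      + fder (\<lambda>u. fder \<phi> u (A *v v)) v (B *v v)"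
proof -
  have v: "v \<in> - {0}" using assms by simp
  let ?D = "\<lambda>u. fder \<phi> u"
  have lin: "bounded_linear ((*v) B)"
    by (rule bounded_bilinear.bounded_linear_right[OF bounded_bilinear_matrix_vector_mult])
  have "((\<lambda>u. \<Sum>b\<in>Basis. ((B *v u) \<bullet> b) *\<^sub>R ?D u b) has_derivative
      (\<lambda>w. \<Sum>b\<in>Basis. ((B *v v) \<bullet> b) *\<^sub>R fder (\<lambda>u. ?D u b) v w
        + ((B *v w) \<bullet> b) *\<^sub>R ?D v b)) (at v)"
    by (intro has_derivative_sum bounded_bilinear.FDERIV[OF bounded_bilinear_scaleR]
        smooth_onD(1)[OF smooth_onD(2)[OF \<phi>] v] has_derivative_inner_left
        bounded_linear_imp_has_derivative lin)
  then have "fder (\<lambda>u. \<Sum>b\<in>Basis. ((B *v u) \<bullet> b) *\<^sub>R ?D u b) v (A *v v)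
     = (\<Sum>b\<in>Basis. ((B *v v) \<bullet> b) *\<^sub>R fder (\<lambda>u. ?D u b) v (A *v v)
        + ((B *v (A *v v)) \<bullet> b) *\<^sub>R ?D v b)"
    by (simp add: frechet_derivative_eqI)
  also have "\<dots> = (\<Sum>b\<in>Basis. ((B *v v) \<bullet> b) *\<^sub>R fder (\<lambda>u. ?D u b) v (A *v v))
     + ?D v (B *v (A *v v))"
    by (simp add: sum.distrib flip: frechet_derivative_smooth_direction[OF \<phi> v])
  also have "(\<Sum>b\<in>Basis. ((B *v v) \<bullet> b) *\<^sub>R fder (\<lambda>u. ?D u b) v (A *v v))
     = (\<Sum>b\<in>Basis. ((B *v v) \<bullet> b) *\<^sub>R fder (\<lambda>u. ?D u (A *v v)) v b)"
    using second_derivative_symmetric[OF \<phi> open_punctured v] by simp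
  also have "\<dots> = fder (\<lambda>u. ?D u (A *v v)) v (B *v v)"
    by (rule frechet_derivative_smooth_direction[OF smooth_onD(2)[OF \<phi>] v, symmetric])
  also have "fder (\<lambda>u. \<Sum>b\<in>Basis. ((B *v u) \<bullet> b) *\<^sub>R ?D u b) v
      = fder (\<lambda>u. - lie_deriv B \<phi> u) v"
    by (rule frechet_derivative_cong_open[OF open_punctured v])
      (simp add: lie_deriv_def flip: frechet_derivative_smooth_direction[OF \<phi>])
  also have "\<dots> = (\<lambda>w. - fder (lie_deriv B \<phi>) v w)"
    by (intro frechet_derivative_eqI has_derivative_minus
        smooth_onD(1)[OF smooth_punctured_lie_deriv[OF \<phi>] v])
  finally show ?thesis using assms(2) by (simp add: lie_deriv_def[of A] add.commute)
qed

text \<open>The second-order terms cancel by Schwarz's theorem.\<close>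

lemma lie_deriv_bracket:
  fixes \<phi> :: "complex^'n::finite \<Rightarrow> 'b::euclidean_space"
  assumes \<phi>: "smooth_punctured \<phi>"
  shows "lie_deriv A (lie_deriv B \<phi>) v - lie_deriv B (lie_deriv A \<phi>) v = lie_deriv (gl_bracket A B) \<phi> v"
proof (cases "v = 0")
  case False
  then have v: "v \<in> - {0}" by simp
  have "linear (fder \<phi> v)"
    using smooth_onD(1)[OF \<phi> v] has_derivative_linear by blast
  then show ?thesis
    using False second_derivative_symmetric[OF \<phi> open_punctured v, of "A *v v" "B *v v"]
    by (simp add: lie_deriv_lie_deriv[OF \<phi>]) 
       (simp add: lie_deriv_def matrix_vector_mult_diff_rdistrib linear_diff matrix_vector_mul_assoc)
qed (simp add: lie_deriv_def)

lemma lie_act_line: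
  assumes "f \<in> C_inf" "v \<noteq> 0"
  shows "lie_act A f (line v) = lie_deriv A (pull f) v"
proof -
  let ?y = "\<lambda>t. matrix_inv (matrix_exp (t *\<^sub>R A)) *v v"
  note y = matrix_inv_exp_has_vector_derivative[of A v]
  have D: "(pull f has_derivative fder (pull f) v) (at v)"
    using smooth_onD(1)[of "- {0}" "pull f" v] assms by (simp add: C_inf_iff_pull)
  have "((\<lambda>t. pull f (?y t)) has_vector_derivative fder (pull f) v (- (A *v v))) (at 0)"
    using has_vector_derivative_compose[OF y(1), of "pull f" "fder (pull f) v"] D y(2)
    by simp
  moreover have "continuous (at 0) ?y" using y(1) has_vector_derivative_continuous by blast
  then have "\<forall>\<^sub>F t in at 0. ?y t \<noteq> 0"
    using assms(2) y(2) tendsto_imp_eventually_ne[of ?y "?y 0" "at 0" 0] by (simp add: continuous_at)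
  then obtain d where d: "d > 0" "\<And>t. dist t 0 < d \<Longrightarrow> ?y t \<noteq> 0"
    using y(2) assms(2) unfolding eventually_at by (metis UNIV_I)
  then have "pull f (?y t) = fun_act (matrix_exp (t *\<^sub>R A)) f (line v)" if "t \<in> ball 0 d" for t
    using that assms(2) by (simp add: pull_def fun_act_def cproj_act_line dist_commute)
  ultimately have "((\<lambda>t. fun_act (matrix_exp (t *\<^sub>R A)) f (line v)) has_vector_derivative
      fder (pull f) v (- (A *v v))) (at 0)"
    using has_vector_derivative_transform_within_open[of "\<lambda>t. pull f (?y t)" _ 0 "ball 0 d"] d(1)
    by simp
  then show ?thesis
    using assms(2) linear_neg[OF has_derivative_linear[OF D]]
    by (simp add: lie_act_def lie_deriv_def vector_derivative_at)
qed

lemma pull_lie_act: "f \<in> C_inf \<Longrightarrow> pull (lie_act A f) = lie_deriv A (pull f)"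
  by (auto simp: fun_eq_iff pull_def[of "lie_act A f"] lie_act_line lie_deriv_def[of _ _ 0])

lemma lie_act_C_inf: "f \<in> C_inf \<Longrightarrow> lie_act A f \<in> C_inf"
  by (simp add: C_inf_iff_pull pull_lie_act smooth_punctured_lie_deriv)

section \<open>The enveloping algebra acts on functions\<close>

text \<open>As rewrite rules these would turn a sum of functions that is an argument of an operator into a
  \<open>\<lambda>\<close>-abstraction.\<close>

lemmas [simp del] = plus_fun_apply times_fun_apply minus_apply zero_fun_apply

lemmas fun_apply = plus_fun_apply times_fun_apply minus_apply zero_fun_apply

lemma smooth_punctured_fun:
  fixes \<phi> \<psi> :: "complex^'n::finite \<Rightarrow> complex"
  assumes "smooth_punctured \<phi>" "smooth_punctured \<psi>"
  shows "smooth_punctured (\<phi> + \<psi>)" "smooth_punctured (\<phi> * \<psi>)" "smooth_punctured (c *\<^sub>C \<phi>)"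
  using smooth_on_add[OF open_punctured assms] smooth_on_mult[OF open_punctured assms]
    smooth_on_mult[OF open_punctured smooth_on_const[OF open_punctured] assms(1)]
  by (simp_all add: plus_fun_def times_fun_def scaleC_fun_def scaleC_complex_def)

lemma smooth_punctured_zero: "smooth_punctured (0 :: complex^'n::finite \<Rightarrow> complex)"
  using smooth_on_const[OF open_punctured] by (simp add: zero_fun_def)

lemma smooth_punctured_diff:
  fixes \<phi> \<psi> :: "complex^'n::finite \<Rightarrow> complex"
  assumes "smooth_punctured \<phi>" "smooth_punctured \<psi>"
  shows "smooth_punctured (\<phi> - \<psi>)"
proof -
  have "\<phi> - \<psi> = \<phi> + (-1) *\<^sub>C \<psi>" by (simp add: fun_eq_iff fun_apply scaleC_fun_def scaleC_complex_def)
  then show ?thesis using smooth_punctured_fun assms by metis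
qed

lemma lie_deriv_fun:
  fixes \<phi> \<psi> :: "complex^'n::finite \<Rightarrow> complex"
  assumes "smooth_punctured \<phi>" "smooth_punctured \<psi>"
  shows "lie_deriv A (\<phi> + \<psi>) = lie_deriv A \<phi> + lie_deriv A \<psi>"
    "lie_deriv A (c *\<^sub>C \<phi>) = c *\<^sub>C lie_deriv A \<phi>"
    "lie_deriv A (\<phi> * \<psi>) = lie_deriv A \<phi> * \<psi> + \<phi> * lie_deriv A \<psi>"
  using lie_deriv_add[OF assms] lie_deriv_mult[OF assms]
    lie_deriv_mult[OF smooth_on_const[OF open_punctured] assms(1)]
  by (simp_all add: fun_eq_iff plus_fun_def times_fun_def scaleC_fun_def scaleC_complex_def lie_deriv_const)

definition word_act ::
  "((complex^'n^'n) list \<Rightarrow>\<^sub>0 complex) \<Rightarrow> (complex^'n::finite \<Rightarrow> complex) \<Rightarrow> complex^'n \<Rightarrow> complex" where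
  "word_act p \<phi> = lin_ext (\<lambda>w. foldr lie_deriv w \<phi>) p"

lemma word_act_linear:
  "word_act (p + q) \<phi> = word_act p \<phi> + word_act q \<phi>"
  "word_act (p - q) \<phi> = word_act p \<phi> - word_act q \<phi>"
  "word_act (c *\<^sub>C p) \<phi> = c *\<^sub>C word_act p \<phi>"
  "word_act (Poly_Mapping.single w c) \<phi> = c *\<^sub>C foldr lie_deriv w \<phi>"
  by (simp_all add: word_act_def lin_ext_add lin_ext_diff lin_ext_scaleC lin_ext_single)

lemma smooth_punctured_foldr: "smooth_punctured \<phi> \<Longrightarrow> smooth_punctured (foldr lie_deriv w \<phi>)"
  for \<phi> :: "complex^'n::finite \<Rightarrow> complex"
  by (induction w) (simp_all add: smooth_punctured_lie_deriv)

lemma smooth_punctured_word_act: "smooth_punctured \<phi> \<Longrightarrow> smooth_punctured (word_act p \<phi>)"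
  by (induction p rule: poly_mapping_single_induct)
    (simp_all add: word_act_linear smooth_punctured_fun smooth_punctured_foldr)

lemma foldr_lie_deriv_linear:
  fixes \<phi> \<psi> :: "complex^'n::finite \<Rightarrow> complex"
  assumes "smooth_punctured \<phi>" "smooth_punctured \<psi>"
  shows "foldr lie_deriv w (\<phi> + \<psi>) = foldr lie_deriv w \<phi> + foldr lie_deriv w \<psi>"
    "foldr lie_deriv w (c *\<^sub>C \<phi>) = c *\<^sub>C foldr lie_deriv w \<phi>"
  using assms by (induction w) (simp_all add: lie_deriv_fun smooth_punctured_foldr)

lemma word_act_fun:
  assumes "smooth_punctured \<phi>" "smooth_punctured \<psi>"
  shows "word_act p (\<phi> + \<psi>) = word_act p \<phi> + word_act p \<psi>"
    "word_act p (c *\<^sub>C \<phi>) = c *\<^sub>C word_act p \<phi>"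
  using assms
  by (simp_all add: word_act_def foldr_lie_deriv_linear lin_ext_fun_add lin_ext_fun_scaleC)

lemma word_act_mult:
  assumes "smooth_punctured \<phi>" shows "word_act (p * q) \<phi> = word_act p (word_act q \<phi>)"
proof (induction p rule: poly_mapping_single_induct)
  case (1 w c)
  show ?case
  proof (induction q rule: poly_mapping_single_induct)
    case (1 w' c')
    show ?case using assms
      by (simp add: mult_single word_act_linear plus_list_def foldr_lie_deriv_linear
          smooth_punctured_foldr scaleC_scaleC)
  next
    case (2 q q')
    then show ?case using assms
      by (simp add: distrib_left word_act_linear word_act_fun smooth_punctured_word_act
          foldr_lie_deriv_linear scaleC_add_right)
  qed
qed (simp add: distrib_right word_act_linear)

lemma word_act_zero: "word_act p 0 = 0"
  using word_act_fun(1)[OF smooth_punctured_zero smooth_punctured_zero, of p] by simp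

text \<open>Lie derivatives satisfy the defining relations of \<open>U\<close>, so the free algebra acts through \<open>U\<close>.\<close>

lemma word_act_ideal:
  fixes \<phi> :: "complex^'n::finite \<Rightarrow> complex"
  assumes "p \<in> uea_ideal" "smooth_punctured \<phi>" shows "word_act p \<phi> = 0"
  using assms
proof (induction arbitrary: \<phi>)
  case (add_rel A B)
  then show ?case
    by (simp add: word_act_linear scaleC_one fun_eq_iff fun_apply lie_deriv_add_matrix)
next
  case (scale_rel r A)
  then show ?case
    by (simp add: word_act_linear scaleC_one fun_eq_iff fun_apply lie_deriv_add_matrix scaleC_fun_def
        scaleC_complex_def scaleR_conv_of_real[of r "_ :: complex"])
next
  case (bracket_rel A B)
  then show ?case
    using lie_deriv_bracket[OF bracket_rel, of A B]
    by (simp add: word_act_linear word_act_mult scaleC_one fun_eq_iff fun_apply)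
next
  case (add p q)
  then show ?case by (simp add: word_act_linear)
next
  case (mult_left p a)
  then show ?case by (simp add: word_act_mult word_act_zero)
next
  case (mult_right p a)
  then show ?case by (simp add: word_act_mult smooth_punctured_word_act)
qed

definition uact :: "'n::finite uea \<Rightarrow> (complex^'n \<Rightarrow> complex) \<Rightarrow> complex^'n \<Rightarrow> complex" where
  "uact u \<phi> = word_act (rep_uea u) \<phi>"

lemma uact_abs: "smooth_punctured \<phi> \<Longrightarrow> uact (abs_uea p) \<phi> = word_act p \<phi>"
proof -
  assume \<phi>: "smooth_punctured \<phi>"
  have "uea_eq (rep_uea (abs_uea p)) p"
    by (intro rep_abs_rsp_left[OF Quotient3_uea] equivp_reflp[OF uea_equivp])
  then have "word_act (rep_uea (abs_uea p) - p) \<phi> = 0"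
    unfolding uea_eq_def by (rule word_act_ideal[OF _ \<phi>])
  then show ?thesis by (simp add: uact_def word_act_linear)
qed

lemma smooth_punctured_uact: "smooth_punctured \<phi> \<Longrightarrow> smooth_punctured (uact u \<phi>)"
  unfolding uact_def by (rule smooth_punctured_word_act)

lemma uact_simps:
  assumes "smooth_punctured \<phi>"
  shows "uact (u + v) \<phi> = uact u \<phi> + uact v \<phi>"
    "uact (c *\<^sub>C u) \<phi> = c *\<^sub>C uact u \<phi>"
    "uact (u * v) \<phi> = uact u (uact v \<phi>)"
    "uact 1 \<phi> = \<phi>" "uact (uea_of A) \<phi> = lie_deriv A \<phi>"
proof -
  obtain p q where u: "u = abs_uea p" and v: "v = abs_uea q"
    by (metis Quotient3_abs_rep[OF Quotient3_uea])
  show "uact (u + v) \<phi> = uact u \<phi> + uact v \<phi>" "uact (c *\<^sub>C u) \<phi> = c *\<^sub>C uact u \<phi>"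
    "uact (u * v) \<phi> = uact u (uact v \<phi>)"
    unfolding u v
    by (simp_all add: plus_uea.abs_eq scaleC_uea.abs_eq times_uea.abs_eq uact_abs assms
        word_act_linear word_act_mult smooth_punctured_word_act)
  have "word_act (Poly_Mapping.single [] 1) \<phi> = \<phi>" by (simp add: word_act_linear scaleC_one)
  moreover have "Poly_Mapping.single [] 1 = (1 :: (complex^'a^'a) list \<Rightarrow>\<^sub>0 complex)"
    by (simp add: zero_list_def flip: single_one)
  ultimately have "word_act 1 \<phi> = \<phi>" by simp
  then show "uact 1 \<phi> = \<phi>" "uact (uea_of A) \<phi> = lie_deriv A \<phi>"
    by (simp_all add: one_uea.abs_eq uea_of.abs_eq uact_abs assms word_act_linear scaleC_one)
qed

lemma uact_fun:
  assumes "smooth_punctured \<phi>" "smooth_punctured \<psi>"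
  shows "uact u (\<phi> + \<psi>) = uact u \<phi> + uact u \<psi>" "uact u (c *\<^sub>C \<phi>) = c *\<^sub>C uact u \<phi>"
  using assms by (simp_all add: uact_def word_act_fun)

text \<open>The counterpart of \<open>tensor_act_mult\<close> on the punctured space.\<close>

definition tact ::
  "('n::finite uea, 'n uea) tensor \<Rightarrow> (complex^'n \<Rightarrow> complex) \<Rightarrow> (complex^'n \<Rightarrow> complex) \<Rightarrow> complex^'n \<Rightarrow> complex"
  where "tact t \<phi> \<psi> = tensor_lift (\<lambda>u v. uact u \<phi> * uact v \<psi>) t"

lemma scaleC_fun_mult:
  fixes \<phi> \<psi> :: "'a \<Rightarrow> complex"
  shows "(c *\<^sub>C \<phi>) * \<psi> = c *\<^sub>C (\<phi> * \<psi>)" "\<phi> * (c *\<^sub>C \<psi>) = c *\<^sub>C (\<phi> * \<psi>)"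
  by (simp_all add: fun_eq_iff fun_apply scaleC_fun_def scaleC_complex_def)

lemma tact_bilinear:
  assumes "smooth_punctured \<phi>" "smooth_punctured \<psi>"
  shows "cbilinear (\<lambda>u v. uact u \<phi> * uact v \<psi>)"
  using assms by (intro cbilinearI) (simp_all add: uact_simps distrib_left distrib_right scaleC_fun_mult)

lemma tact_pure:
  assumes "smooth_punctured \<phi>" "smooth_punctured \<psi>"
  shows "tact (u \<otimes> v) \<phi> \<psi> = uact u \<phi> * uact v \<psi>"
  unfolding tact_def by (rule tensor_lift_of[OF tact_bilinear[OF assms]])

lemma clinear_tact:
  assumes "smooth_punctured \<phi>" "smooth_punctured \<psi>" shows "clinear (\<lambda>t. tact t \<phi> \<psi>)"
  unfolding tact_def by (rule clinear_tensor_lift[OF tact_bilinear[OF assms]])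

lemmas tact_add = clinear_add[OF clinear_tact]
lemmas tact_scaleC = clinear_scaleC[OF clinear_tact]

lemma smooth_punctured_tact:
  assumes "smooth_punctured \<phi>" "smooth_punctured \<psi>" shows "smooth_punctured (tact t \<phi> \<psi>)"
  using assms by (induction t rule: tensor_induct)
    (simp_all add: tact_add tact_pure smooth_punctured_fun smooth_punctured_uact)

lemma tact_fun:
  assumes "smooth_punctured \<phi>" "smooth_punctured \<phi>'" "smooth_punctured \<psi>"
  shows "tact t (\<phi> + \<phi>') \<psi> = tact t \<phi> \<psi> + tact t \<phi>' \<psi>" "tact t \<psi> (\<phi> + \<phi>') = tact t \<psi> \<phi> + tact t \<psi> \<phi>'"
  using assms
  by (induction t rule: tensor_induct;
      simp add: tact_add tact_pure smooth_punctured_fun uact_fun distrib_left distrib_right)+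

lemma tact_diff:
  assumes "smooth_punctured \<phi>" "smooth_punctured \<phi>'" "smooth_punctured \<psi>"
  shows "tact t (\<phi> - \<phi>') \<psi> = tact t \<phi> \<psi> - tact t \<phi>' \<psi>" "tact t \<psi> (\<phi> - \<phi>') = tact t \<psi> \<phi> - tact t \<psi> \<phi>'"
  using tact_fun[OF smooth_punctured_diff[OF assms(1,2)] assms(2,3), of t] by (simp_all add: eq_diff_eq)

lemma tact_zero:
  assumes "smooth_punctured \<psi>" shows "tact t 0 \<psi> = 0" "tact t \<psi> 0 = 0"
  using tact_diff[OF smooth_punctured_zero smooth_punctured_zero assms, of t] by simp_all

lemma tact_one:
  assumes "smooth_punctured \<phi>" "smooth_punctured \<psi>" shows "tact 1 \<phi> \<psi> = \<phi> * \<psi>"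
  using assms by (simp add: one_tensor_def tact_pure uact_simps)

lemma tact_flip:
  assumes "smooth_punctured \<phi>" "smooth_punctured \<psi>" shows "tact (flip t) \<phi> \<psi> = tact t \<psi> \<phi>"
  using assms by (induction t rule: tensor_induct)
    (simp_all add: flip_of clinear_add[OF clinear_flip] tact_add tact_pure mult.commute)

lemma tact_mult_pure:
  assumes "smooth_punctured \<phi>" "smooth_punctured \<psi>"
  shows "tact (t * (u \<otimes> v)) \<phi> \<psi> = tact t (uact u \<phi>) (uact v \<psi>)"
  using assms by (induction t rule: tensor_induct)
    (simp_all add: distrib_right tact_add tact_pure tensor_mult_of uact_simps smooth_punctured_uact)

text \<open>For elements of \<open>g\<close>, which generate \<open>U\<close>, this is the product rule for Lie derivatives.\<close>

lemma tact_coprod: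
  assumes \<phi>: "smooth_punctured \<phi>" and \<psi>: "smooth_punctured \<psi>"
  shows "tact (uea_coprod u) \<phi> \<psi> = uact u (\<phi> * \<psi>)"
proof (induction u rule: uea_word_induct)
  case (word w c)
  note sm = \<phi> \<psi> smooth_punctured_fun(2)[OF \<phi> \<psi>]
  have primitive: "tact ((uea_of A \<otimes> 1 + 1 \<otimes> uea_of A) * t) \<phi> \<psi> = lie_deriv A (tact t \<phi> \<psi>)" for A t
  proof (induction t rule: tensor_induct)
    case (pure u v)
    show ?case using \<phi> \<psi>
      by (simp add: distrib_right tensor_mult_of tact_add tact_pure uact_simps smooth_punctured_uact
          lie_deriv_fun)
  next
    case (add s t)
    then show ?case using \<phi> \<psi>
      by (simp add: distrib_left tact_add lie_deriv_fun smooth_punctured_tact)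
  qed
  have "tact (uea_coprod (prod_list (map uea_of w))) \<phi> \<psi> = uact (prod_list (map uea_of w)) (\<phi> * \<psi>)"
    by (induction w) (simp_all add: uea_coprod_simps tact_one sm uact_simps primitive smooth_punctured_uact)
  then show ?case by (simp add: uea_coprod_simps tact_scaleC sm uact_simps)
qed (simp add: uea_coprod_simps tact_add uact_simps smooth_punctured_fun \<phi> \<psi>)

definition tact3 ::
  "('n::finite uea, ('n uea, 'n uea) tensor) tensor \<Rightarrow> (complex^'n \<Rightarrow> complex) \<Rightarrow> (complex^'n \<Rightarrow> complex)
     \<Rightarrow> (complex^'n \<Rightarrow> complex) \<Rightarrow> complex^'n \<Rightarrow> complex"
  where "tact3 t \<phi> \<psi> \<theta> = tensor_lift3 (\<lambda>u v w. uact u \<phi> * uact v \<psi> * uact w \<theta>) t"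

context
  fixes \<phi> \<psi> \<theta> :: "complex^'n::finite \<Rightarrow> complex"
  assumes sm: "smooth_punctured \<phi>" "smooth_punctured \<psi>" "smooth_punctured \<theta>"
begin

lemma tact3_trilinear: "ctrilinear (\<lambda>u v w. uact u \<phi> * uact v \<psi> * uact w \<theta>)"
  by (intro ctrilinearI) (simp_all add: uact_simps sm distrib_left distrib_right scaleC_fun_mult)

lemma tact3_pure: "tact3 (u \<otimes> v \<otimes> w) \<phi> \<psi> \<theta> = uact u \<phi> * uact v \<psi> * uact w \<theta>"
  unfolding tact3_def by (rule tensor_lift3_of[OF tact3_trilinear])

lemma tact3_add: "tact3 (s + t) \<phi> \<psi> \<theta> = tact3 s \<phi> \<psi> \<theta> + tact3 t \<phi> \<psi> \<theta>"
  unfolding tact3_def by (rule clinear_add[OF clinear_tensor_lift3[OF tact3_trilinear]])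

lemma tact3_assoc: "tact3 (tensor_assoc (s \<otimes> w)) \<phi> \<psi> \<theta> = tact s \<phi> \<psi> * uact w \<theta>"
  by (induction s rule: tensor_induct)
    (simp_all add: tensor_of_linear clinear_add[OF clinear_tensor_assoc] tensor_assoc_of tact3_add
      tact3_pure tact_add tact_pure sm distrib_right)

lemma tact3_right: "tact3 (u \<otimes> s) \<phi> \<psi> \<theta> = uact u \<phi> * tact s \<psi> \<theta>"
  by (induction s rule: tensor_induct)
    (simp_all add: tensor_of_linear tact3_add tact3_pure tact_add tact_pure sm distrib_left mult.assoc)

lemma tact3_left_nested: "tact3 (coprod_left s * unit_right t) \<phi> \<psi> \<theta> = tact s (tact t \<phi> \<psi>) \<theta>"
proof (induction s rule: tensor_induct)
  case (pure u v)
  show ?case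
  proof (induction t rule: tensor_induct)
    case (pure a b)
    have "unit_right (a \<otimes> b) = tensor_assoc ((a \<otimes> b) \<otimes> 1)" by (simp add: unit_right_def)
    then have "coprod_left (u \<otimes> v) * unit_right (a \<otimes> b)
        = tensor_assoc ((uea_coprod u * (a \<otimes> b)) \<otimes> v)"
      by (simp add: legs_pure(1) tensor_mult_of flip: tensor_assoc_mult)
    then show ?case
      by (simp add: tact3_assoc tact_mult_pure tact_coprod tact_pure sm smooth_punctured_uact
          smooth_punctured_fun)
  next
    case (add t t')
    then show ?case
      by (simp add: clinear_add[OF clinear_legs(3)] distrib_left tact3_add tact_add tact_fun sm
          smooth_punctured_tact)
  qed
next
  case (add s s')
  then show ?case
    by (simp add: clinear_add[OF clinear_legs(1)] distrib_right tact3_add tact_add sm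
        smooth_punctured_tact)
qed

lemma tact3_right_nested: "tact3 (coprod_right s * unit_left t) \<phi> \<psi> \<theta> = tact s \<phi> (tact t \<psi> \<theta>)"
proof (induction s rule: tensor_induct)
  case (pure u v)
  show ?case
  proof (induction t rule: tensor_induct)
    case (pure a b)
    show ?case
      by (simp add: legs_pure tensor_mult_of tact3_right tact_mult_pure tact_coprod tact_pure sm
          smooth_punctured_uact smooth_punctured_fun)
  next
    case (add t t')
    then show ?case
      by (simp add: clinear_add[OF clinear_legs(4)] distrib_left tact3_add tact_add tact_fun sm
          smooth_punctured_tact)
  qed
next
  case (add s s')
  then show ?case
    by (simp add: clinear_add[OF clinear_legs(2)] distrib_right tact3_add tact_add sm
        smooth_punctured_tact)
qed

text \<open>This is associativity of the star product at order \<open>h\<^sup>2\<close>. It follows from the cocycle equation and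
  so holds for all functions on the punctured space, not only for those of degree \<open>0\<close>.\<close>

lemma twist_associativity_order_2:
  assumes "twist S F" "F * G = 1" "G * F = 1" "fps_nth G 0 = 1"
  defines "B1 \<equiv> tact (fps_nth G 1)" and "B2 \<equiv> tact (fps_nth G 2)"
  shows "B2 (\<phi> * \<psi>) \<theta> + B1 (B1 \<phi> \<psi>) \<theta> + B2 \<phi> \<psi> * \<theta> = B2 \<phi> (\<psi> * \<theta>) + B1 \<phi> (B1 \<psi> \<theta>) + \<phi> * B2 \<psi> \<theta>"
  using arg_cong[OF twist_inverse_cocycle_order_2[OF assms(1-4)], of "\<lambda>t. tact3 t \<phi> \<psi> \<theta>"]
    tact3_left_nested[of "fps_nth G 2" 1] tact3_left_nested[of 1 "fps_nth G 2"]
    tact3_right_nested[of "fps_nth G 2" 1] tact3_right_nested[of 1 "fps_nth G 2"]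
  by (simp add: B1_def B2_def tact3_add tact3_left_nested tact3_right_nested legs_one tact_one sm
      smooth_punctured_tact)

end

lemma alternating_sum_of_associators:
  fixes P1 P2 P3 Q1 Q2 Q3 t t' u u' w w' :: "'a::ab_group_add"
  assumes "P3 + a1 + t = Q1 + b1 + w" "P2 + a2 + u = Q1 + b2 + w'" "P3 + a3 + t' = Q2 + b3 + u"
    "P1 + a4 + w = Q2 + b4 + u'" "P2 + a5 + u' = Q3 + b5 + t" "P1 + a6 + w' = Q3 + b6 + t'"
  shows "b1 - b2 - (a4 - a6) - (b3 - b4 - (a2 - a5)) = a1 - a3 - (b5 - b6)"
proof -
  have a: "a1 = Q1 + b1 + w - t - P3" "a2 = Q1 + b2 + w' - u - P2" "a3 = Q2 + b3 + u - t' - P3"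
    "a4 = Q2 + b4 + u' - w - P1" "a5 = Q3 + b5 + t - u' - P2" "a6 = Q3 + b6 + t' - w' - P1"
    using assms by (simp_all add: eq_diff_eq add_ac)
  show ?thesis unfolding a by (simp add: algebra_simps)
qed

text \<open>Take the alternating sum of associativity at order \<open>h\<^sup>2\<close> over all permutations of the arguments. The
  second-order terms cancel because the product of functions is commutative, and what remains is the
  Jacobi identity for the commutator of the first-order term.\<close>

lemma twist_jacobi:
  fixes \<phi> \<psi> \<theta> :: "complex^'n::finite \<Rightarrow> complex"
  assumes tw: "twist S F" "F * G = 1" "G * F = 1" "fps_nth G 0 = 1"
    and sm: "smooth_punctured \<phi>" "smooth_punctured \<psi>" "smooth_punctured \<theta>"
  defines "\<rho> \<equiv> \<lambda>\<phi> \<psi>. tact (fps_nth G 1) \<phi> \<psi> - tact (fps_nth G 1) \<psi> \<phi>"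
  shows "\<rho> \<phi> (\<rho> \<psi> \<theta>) - \<rho> \<psi> (\<rho> \<phi> \<theta>) = \<rho> (\<rho> \<phi> \<psi>) \<theta>"
proof -
  note A = twist_associativity_order_2[OF _ _ _ tw]
  note T = smooth_punctured_tact
  show ?thesis
    unfolding \<rho>_def tact_diff[OF T[OF sm(1,2)] T[OF sm(2,1)] sm(3)]
      tact_diff[OF T[OF sm(1,3)] T[OF sm(3,1)] sm(2)] tact_diff[OF T[OF sm(2,3)] T[OF sm(3,2)] sm(1)]
    using A[OF sm(1) sm(2) sm(3)] A[OF sm(1) sm(3) sm(2)] A[OF sm(2) sm(1) sm(3)]
      A[OF sm(2) sm(3) sm(1)] A[OF sm(3) sm(1) sm(2)] A[OF sm(3) sm(2) sm(1)]
    by (intro alternating_sum_of_associators) (simp_all only: mult.commute)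
qed

section \<open>The classical limit\<close>

text \<open>The bracket of functions defined by \<open>\<Sum>\<^sub>j c\<^sub>j a\<^sub>j \<otimes> b\<^sub>j\<close>.\<close>

definition rmat ::
  "nat \<Rightarrow> (nat \<Rightarrow> complex) \<Rightarrow> (nat \<Rightarrow> complex^'n^'n) \<Rightarrow> (nat \<Rightarrow> complex^'n^'n)
     \<Rightarrow> (complex^'n::finite \<Rightarrow> complex) \<Rightarrow> (complex^'n \<Rightarrow> complex) \<Rightarrow> complex^'n \<Rightarrow> complex" where
  "rmat N c a b \<phi> \<psi> v = (\<Sum>j<N. c j * lie_deriv (a j) \<phi> v * lie_deriv (b j) \<psi> v)"

lemma tact_rmat:
  assumes "smooth_punctured \<phi>" "smooth_punctured \<psi>"
  shows "tact (\<Sum>j<N. c j *\<^sub>C (uea_of (a j) \<otimes> uea_of (b j))) \<phi> \<psi> = rmat N c a b \<phi> \<psi>"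
proof (induction N)
  case 0
  show ?case using clinear_zero[OF clinear_tact[OF assms]] by (simp add: fun_eq_iff rmat_def fun_apply)
next
  case (Suc N)
  then show ?case
    by (simp add: tact_add tact_scaleC tact_pure uact_simps assms fun_eq_iff rmat_def fun_apply
        scaleC_fun_def scaleC_complex_def mult.assoc)
qed

lemma pull_fun:
  "pull (f + g) = pull f + pull g" "pull (f * g) = pull f * pull g" "pull (c *\<^sub>C f) = c *\<^sub>C pull f"
  "pull (0 :: 'n::finite cproj \<Rightarrow> complex) = 0"
  for f g :: "'n::finite cproj \<Rightarrow> complex"
  by (simp_all add: fun_eq_iff pull_def fun_apply scaleC_fun_def scaleC_complex_def)

lemma pull_inject:
  fixes f g :: "'n::finite cproj \<Rightarrow> complex"
  assumes "pull f = pull g" shows "f = g"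
proof
  fix p :: "'n cproj"
  obtain v where v: "v \<noteq> 0" "p = line v" using cproj_eq_line by blast
  show "f p = g p" using fun_cong[OF assms, of v] v by (simp add: pull_def)
qed

lemma pull_lin_ext: "pull (lin_ext f p) = lin_ext (\<lambda>k. pull (f k)) p"
  for f :: "'k \<Rightarrow> 'n::finite cproj \<Rightarrow> complex"
  by (induction p rule: poly_mapping_single_induct)
    (simp_all add: lin_ext_add lin_ext_single pull_fun)

lemma pull_foldr_lie_act:
  assumes "f \<in> C_inf"
  shows "foldr lie_act w f \<in> C_inf \<and> pull (foldr lie_act w f) = foldr lie_deriv w (pull f)"
  using assms by (induction w) (simp_all add: lie_act_C_inf pull_lie_act)

lemma pull_uea_act: "f \<in> C_inf \<Longrightarrow> pull (uea_act u f) = uact u (pull f)"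
  by (simp add: uea_act_def uact_def word_act_def pull_lin_ext pull_foldr_lie_act)

lemma pull_tensor_act_mult:
  assumes "f \<in> C_inf" "g \<in> C_inf"
  shows "pull (tensor_act_mult t f g) = tact t (pull f) (pull g)"
  using assms
  by (simp add: tensor_act_mult_def tact_def tensor_lift_def pull_lin_ext pull_fun pull_uea_act
      case_prod_unfold)

text \<open>The passage to functions on the punctured space is the essential gain: a star product on projective
  space alone gives no Poisson bracket of functions with sections of a line bundle.\<close>

theorem induced_star_product_classical_limit:
  fixes F :: "('n::finite uea, 'n uea) tensor fps"
  assumes F: "twist S F" and ind: "induced_by_twist F s" and star: "star_product P s"
  obtains N c a b where
    "\<And>f g. f \<in> C_inf \<Longrightarrow> g \<in> C_inf \<Longrightarrow> rmat N c a b (pull f) (pull g) = \<i> *\<^sub>C pull (P f g)"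
    "\<And>\<phi> \<psi>. smooth_punctured \<phi> \<Longrightarrow> smooth_punctured \<psi> \<Longrightarrow> rmat N c a b \<phi> \<psi> = - rmat N c a b \<psi> \<phi>"
    "\<And>\<phi> \<psi> \<theta>. smooth_punctured \<phi> \<Longrightarrow> smooth_punctured \<psi> \<Longrightarrow> smooth_punctured \<theta> \<Longrightarrow>
       rmat N c a b \<phi> (rmat N c a b \<psi> \<theta>) - rmat N c a b \<psi> (rmat N c a b \<phi> \<theta>)
       = rmat N c a b (rmat N c a b \<phi> \<psi>) \<theta>"
proof -
  obtain G where G: "F * G = 1" "G * F = 1" using F by (auto simp: twist_def)
  have inv: "fps_inverse_of F = G" by (rule fps_inverse_of_eq[OF G])
  have G0: "fps_nth G 0 = 1"
    using arg_cong[OF G(1), of "\<lambda>x. fps_nth x 0"] F by (simp add: twist_def)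
  note tw = F G G0
  obtain N c a b where r: "fps_nth G 1 - flip (fps_nth G 1)
      = (\<Sum>j<(N::nat). c j *\<^sub>C (uea_of (a j) \<otimes> uea_of (b j)))"
    using twist_r_matrix[OF tw] by blast
  let ?B = "tact (fps_nth G 1)"
  have rho: "rmat N c a b \<phi> \<psi> = ?B \<phi> \<psi> - ?B \<psi> \<phi>"
    if "smooth_punctured \<phi>" "smooth_punctured \<psi>" for \<phi> \<psi>
    using tact_rmat[OF that, of c a b N] clinear_diff[OF clinear_tact[OF that]]
    by (simp add: tact_flip that flip: r)
  show ?thesis
  proof (rule that[of N c a b])
    fix f g :: "'n cproj \<Rightarrow> complex" assume fg: "f \<in> C_inf" "g \<in> C_inf"
    then have pfg: "smooth_punctured (pull f)" "smooth_punctured (pull g)"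
      by (simp_all add: C_inf_iff_pull)
    obtain B where B: "\<And>f g. f \<in> C_inf \<Longrightarrow> g \<in> C_inf \<Longrightarrow> s (fps_const f) (fps_const g) = Abs_fps (\<lambda>k. B k f g)"
      "\<And>f g. f \<in> C_inf \<Longrightarrow> g \<in> C_inf \<Longrightarrow> B (1::nat) f g - B 1 g f = \<i> *\<^sub>C P f g"
      using star unfolding star_product_def by blast
    have zero: "(0 :: 'n cproj \<Rightarrow> complex) \<in> C_inf"
      by (simp add: C_inf_iff_pull pull_fun smooth_punctured_zero)
    have tam0: "tensor_act_mult t 0 g = 0" "tensor_act_mult t g 0 = 0" if "g \<in> C_inf"
      for t and g :: "'n cproj \<Rightarrow> complex"
      using that pull_tensor_act_mult[OF zero that] pull_tensor_act_mult[OF that zero]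
      by (auto intro!: pull_inject simp: pull_fun tact_zero C_inf_iff_pull)
    have B1: "pull (B 1 f g) = ?B (pull f) (pull g)" if fg: "f \<in> C_inf" "g \<in> C_inf" for f g
    proof -
      have "fps_const f \<in> C_inf_fps" "fps_const g \<in> C_inf_fps"
        using fg zero by (simp_all add: C_inf_fps_def)
      then have "s (fps_const f) (fps_const g) = Abs_fps (\<lambda>m. \<Sum>i\<le>m. \<Sum>j\<le>m - i.
          tensor_act_mult (fps_nth G i) (fps_nth (fps_const f) j) (fps_nth (fps_const g) (m - i - j)))"
        using ind by (simp add: induced_by_twist_def inv)
      from arg_cong[OF this, of "\<lambda>x. fps_nth x 1"]
      have "B 1 f g = tensor_act_mult (fps_nth G 1) f g"
        using fg zero by (simp add: B(1) tam0)
      then show ?thesis using fg by (simp add: pull_tensor_act_mult)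
    qed
    have "pull (B 1 f g) - pull (B 1 g f) = pull (B 1 f g - B 1 g f)"
      by (simp add: fun_eq_iff pull_def fun_apply)
    then show "rmat N c a b (pull f) (pull g) = \<i> *\<^sub>C pull (P f g)"
      by (simp only: rho pfg B1[symmetric] B(2) fg pull_fun)
  next
    fix \<phi> \<psi> :: "complex^'n \<Rightarrow> complex" assume "smooth_punctured \<phi>" "smooth_punctured \<psi>"
    then show "rmat N c a b \<phi> \<psi> = - rmat N c a b \<psi> \<phi>" by (simp add: rho)
  next
    fix \<phi> \<psi> \<theta> :: "complex^'n \<Rightarrow> complex"
    assume sm: "smooth_punctured \<phi>" "smooth_punctured \<psi>" "smooth_punctured \<theta>"
    then show "rmat N c a b \<phi> (rmat N c a b \<psi> \<theta>) - rmat N c a b \<psi> (rmat N c a b \<phi> \<theta>)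
       = rmat N c a b (rmat N c a b \<phi> \<psi>) \<theta>"
      using twist_jacobi[OF tw sm]
      by (simp add: rho smooth_punctured_tact smooth_punctured_diff)
  qed
qed

section \<open>A global frame on projective space\<close>

lemma line_eqD:
  assumes "line v = line w" "v \<noteq> 0" "w \<noteq> 0"
  shows "\<exists>c. c \<noteq> 0 \<and> w = c *s v"
proof -
  have "range (\<lambda>c. c *s w) = range (\<lambda>c. c *s v)"
    using Rep_cproj_line[OF assms(2)] Rep_cproj_line[OF assms(3)] assms(1) by simp
  moreover have "w \<in> range (\<lambda>c. c *s w)" using rangeI[of "\<lambda>c. c *s w" 1] by simp
  ultimately have "w \<in> range (\<lambda>c. c *s v)" by simp
  then obtain c where "w = c *s v" by blast
  then show ?thesis using assms(3) by (cases "c = 0") auto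
qed

lemma pull_exists:
  fixes \<phi> :: "complex^'n::finite \<Rightarrow> 'b::zero"
  assumes "\<phi> 0 = 0" "\<And>c v. c \<noteq> 0 \<Longrightarrow> \<phi> (c *s v) = \<phi> v"
  obtains f where "pull f = \<phi>"
proof
  define f where "f p = \<phi> (SOME v. v \<noteq> 0 \<and> p = line v)" for p :: "'n cproj"
  show "pull f = \<phi>"
  proof
    fix v show "pull f v = \<phi> v"
    proof (cases "v = 0")
      case False
      define w where "w = (SOME w. w \<noteq> 0 \<and> line v = line w)"
      have "w \<noteq> 0 \<and> line v = line w" unfolding w_def by (rule someI[of _ v]) (simp add: False)
      then obtain c where "c \<noteq> 0" "w = c *s v" using line_eqD False by blast
      then show ?thesis using assms(2) False by (simp add: pull_def f_def flip: w_def)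
    qed (simp add: pull_def assms(1))
  qed
qed

lemma pull_scale: "c \<noteq> 0 \<Longrightarrow> pull f (c *s v) = pull f v"
  by (simp add: pull_def line_scale)

text \<open>A function of degree \<open>0\<close> is constant on \<open>v + t k v = (1 + t k) v\<close> for small real \<open>t\<close>.\<close>

lemma frechet_derivative_pull_radial:
  fixes f :: "'n::finite cproj \<Rightarrow> 'b::real_normed_vector"
  assumes f: "f \<in> C_inf" and v: "v \<noteq> 0"
  shows "fder (pull f) v (k *s v) = 0"
proof -
  have D: "(pull f has_derivative fder (pull f) v) (at v)"
    using smooth_onD(1)[of "- {0}" "pull f" v] f v by (simp add: C_inf_iff_pull)
  have "((\<lambda>t. v + t *\<^sub>R (k *s v)) has_vector_derivative k *s v) (at 0)"
    by (auto intro!: derivative_eq_intros)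
  from has_vector_derivative_compose[OF this, of "pull f"] D
  have 1: "((\<lambda>t. pull f (v + t *\<^sub>R (k *s v))) has_vector_derivative
      fder (pull f) v (k *s v)) (at 0)" by simp
  define d where "d = 1 / (norm k + 1)"
  have d: "d > 0" by (simp add: d_def add_nonneg_pos)
  have eq: "pull f (v + t *\<^sub>R (k *s v)) = pull f v" if "t \<in> ball 0 d" for t
  proof -
    have "norm k + 1 > 0" by (simp add: add_nonneg_pos)
    then have "\<bar>t\<bar> * (norm k + 1) < 1" using that by (simp add: d_def pos_less_divide_eq)
    then have "norm (of_real t * k) < 1" by (simp add: norm_mult algebra_simps)
    then have nz: "1 + of_real t * k \<noteq> 0"
      by (metis add.inverse_unique norm_minus_cancel norm_one order_less_irrefl)
    have "v + t *\<^sub>R (k *s v) = (1 + of_real t * k) *s v"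
      by (simp add: vec_eq_iff distrib_right scaleR_conv_of_real[where 'a = complex])
    then show ?thesis using pull_scale[OF nz] by simp
  qed
  have 2: "((\<lambda>t. pull f v) has_vector_derivative fder (pull f) v (k *s v)) (at 0)"
    by (rule has_vector_derivative_transform_within_open[OF 1, of "ball 0 d"]) (use d eq in auto)
  show ?thesis using vector_derivative_unique_at[OF 2 has_vector_derivative_const] .
qed

text \<open>The orthogonal projection onto the line spanned by \<open>v\<close> embeds projective space into the matrices, so
  the differentials of its coordinates span all cotangent spaces. The minus sign in \<open>frame\<close> cancels the
  one in \<open>lie_deriv\<close>.\<close>

definition outer :: "complex^'n \<Rightarrow> complex^'n \<Rightarrow> complex^'n^'n" where
  "outer v w = (\<chi> i j. v $ i * cnj (w $ j))"

definition proj :: "complex^'n::finite \<Rightarrow> complex^'n^'n" where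
  "proj v = inverse (v \<bullet> v) *\<^sub>R outer v v"

definition frame :: "complex^'n^'n \<Rightarrow> complex^'n::finite \<Rightarrow> real" where
  "frame e v = - (proj v \<bullet> e)"

lemma bounded_bilinear_outer: "bounded_bilinear (outer :: complex^'n::finite \<Rightarrow> _)"
  unfolding bilinear_conv_bounded_bilinear[symmetric] bilinear_def
  by (auto intro!: linearI simp: vec_eq_iff outer_def algebra_simps)

lemma smooth_punctured_inverse_norm: "smooth_punctured (\<lambda>v :: complex^'n::finite. inverse (v \<bullet> v))"
  by (intro smooth_on_inverse smooth_on_bilinear[OF bounded_bilinear_inner] smooth_on_linear
      open_punctured bounded_linear_ident) simp

lemma smooth_punctured_proj: "smooth_punctured (proj :: complex^'n::finite \<Rightarrow> _)"
  unfolding proj_def[abs_def]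
  by (intro smooth_on_bilinear[OF bounded_bilinear_scaleR] smooth_punctured_inverse_norm
      smooth_on_bilinear[OF bounded_bilinear_outer] smooth_on_linear open_punctured bounded_linear_ident)

lemma smooth_punctured_frame: "smooth_punctured (frame e)"
proof -
  have "smooth_punctured (\<lambda>v. proj v \<bullet> (- e))"
    by (intro smooth_on_bilinear[OF bounded_bilinear_inner] smooth_punctured_proj smooth_on_const
        open_punctured)
  then show ?thesis by (simp add: frame_def[abs_def])
qed

lemma inner_self_complex_vec: "of_real (v \<bullet> v) = (\<Sum>j\<in>UNIV. cnj (v $ j) * v $ j)"
  for v :: "complex^'n::finite"
  by (simp add: inner_vec_def of_real_sum complex_norm_square dot_square_norm mult.commute
      del: of_real_power)

lemma proj_mult: "proj v *v w = ((\<Sum>j\<in>UNIV. cnj (v $ j) * w $ j) / of_real (v \<bullet> v)) *s v"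
  by (simp add: vec_eq_iff proj_def outer_def matrix_vector_mult_def sum_distrib_left sum_distrib_right
      sum_divide_distrib scaleR_conv_of_real[where 'a = complex] field_simps)

lemma proj_mult_self: "proj v *v v = v" if "v \<noteq> 0"
  using that by (simp add: proj_mult flip: inner_self_complex_vec)

lemma inner_self_scale: "(c *s v) \<bullet> (c *s v) = (norm c)\<^sup>2 * (v \<bullet> v)"
  for v :: "complex^'n::finite"
  by (simp add: inner_vec_def dot_square_norm norm_mult power_mult_distrib sum_distrib_left)

lemma proj_scale: "c \<noteq> 0 \<Longrightarrow> proj (c *s v) = proj v"
proof -
  assume c: "c \<noteq> 0"
  have "outer (c *s v) (c *s v) = (norm c)\<^sup>2 *\<^sub>R outer v v"
    by (simp add: outer_def vec_eq_iff scaleR_conv_of_real[where 'a = complex] complex_norm_square mult_ac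
        del: of_real_power)
  then show ?thesis using c by (simp add: proj_def inner_self_scale)
qed

lemma proj_zero: "proj 0 = 0"
  by (simp add: proj_def)

text \<open>Differentiating \<open>proj v v = v\<close> expresses every tangent direction \<open>w\<close> at \<open>v\<close>, up to a multiple of
  \<open>v\<close>, as the value at \<open>v\<close> of the matrix \<open>D proj(v) w\<close>. So a derivative of a function of degree \<open>0\<close>
  is a combination of the derivatives along the basis matrices, with the derivatives of the frame
  functions as coefficients.\<close>

lemma lie_deriv_frame_expansion:
  fixes f :: "'n::finite cproj \<Rightarrow> 'b::real_normed_vector"
  assumes f: "f \<in> C_inf"
  shows "lie_deriv B (pull f) v = (\<Sum>e\<in>Basis. lie_deriv B (frame e) v *\<^sub>R lie_deriv e (pull f) v)"
proof (cases "v = 0")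
  case False
  then have v: "v \<in> - {0}" by simp
  let ?D = "fder (pull f) v" and ?w = "B *v v"
  have lin: "linear ?D"
    using smooth_onD(1)[of "- {0}" "pull f" v] f v has_derivative_linear by (auto simp: C_inf_iff_pull)
  define Q where "Q = fder proj v ?w"
  have dproj: "(proj has_derivative fder proj v) (at v)"
    by (rule smooth_onD(1)[OF smooth_punctured_proj v])
  have "((\<lambda>v. proj v *v v) has_derivative
      (\<lambda>w. proj v *v w + fder proj v w *v v)) (at v)"
    by (rule bounded_bilinear.FDERIV[OF bounded_bilinear_matrix_vector_mult dproj has_derivative_ident])
  moreover have "((\<lambda>v. v) has_derivative D) (at v) \<longleftrightarrow> ((\<lambda>v. proj v *v v) has_derivative D) (at v)" for D
    by (rule has_derivative_cong_open[OF open_punctured v]) (simp add: proj_mult_self)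
  ultimately have "((\<lambda>v. v) has_derivative
      (\<lambda>w. proj v *v w + fder proj v w *v v)) (at v)" by simp
  from has_derivative_unique[OF this has_derivative_ident]
  have "(\<lambda>w. proj v *v w + fder proj v w *v v) = (\<lambda>w. w)" .
  from fun_cong[OF this, of ?w] have Q: "Q *v v = ?w - proj v *v ?w"
    by (simp add: Q_def eq_diff_eq add.commute)
  have DQ: "?D (Q *v v) = ?D ?w"
    unfolding Q linear_diff[OF lin] proj_mult by (simp add: frechet_derivative_pull_radial[OF f False])
  have "lie_deriv B (frame e) v = Q \<bullet> e" for e
  proof -
    have "(frame e has_derivative (\<lambda>w. - (fder proj v w \<bullet> e))) (at v)"
      unfolding frame_def[abs_def] by (intro has_derivative_minus has_derivative_inner_left dproj)
    then show ?thesis using False by (simp add: lie_deriv_def frechet_derivative_eqI Q_def)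
  qed
  then have "(\<Sum>e\<in>Basis. lie_deriv B (frame e) v *\<^sub>R lie_deriv e (pull f) v)
      = lie_deriv (\<Sum>e\<in>Basis. (Q \<bullet> e) *\<^sub>R e) (pull f) v"
    using f by (simp add: lie_deriv_sum_matrix C_inf_iff_pull)
  also have "\<dots> = - ?D (Q *v v)"
    using False by (simp add: lie_deriv_def euclidean_representation)
  finally show ?thesis using DQ False by (simp add: lie_deriv_def)
qed (simp add: lie_deriv_def)

lemma smooth_punctured_linear_compose:
  fixes h :: "'b::euclidean_space \<Rightarrow> 'c::real_normed_vector"
  assumes "bounded_linear h" "smooth_punctured \<phi>" shows "smooth_punctured (\<lambda>v. h (\<phi> v))"
  by (rule smooth_on_compose[OF open_punctured open_UNIV smooth_on_linear[OF open_UNIV assms(1)] assms(2)])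
    simp

lemma lie_deriv_linear_compose:
  assumes h: "bounded_linear h" and \<phi>: "smooth_punctured \<phi>"
  shows "lie_deriv A (\<lambda>v. h (\<phi> v)) v = h (lie_deriv A \<phi> v)"
proof (cases "v = 0")
  case True
  then show ?thesis using linear_0[of h] h by (simp add: lie_deriv_def bounded_linear.linear)
next
  case False
  have "((\<lambda>v. h (\<phi> v)) has_derivative (\<lambda>w. h (fder \<phi> v w))) (at v)"
    using False by (intro bounded_linear.has_derivative[OF h] smooth_onD(1)[OF \<phi>]) simp
  then show ?thesis
    using False h by (simp add: lie_deriv_def frechet_derivative_eqI linear_neg bounded_linear.linear)
qed

lemma pull_of_real: "pull (complex_of_real \<circ> f) = (\<lambda>v. complex_of_real (pull f v))"
  by (simp add: pull_def fun_eq_iff)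

lemma of_real_C_inf: "f \<in> C_inf \<Longrightarrow> complex_of_real \<circ> f \<in> C_inf"
  by (simp add: C_inf_iff_pull pull_of_real smooth_punctured_linear_compose[OF bounded_linear_of_real])

definition cframe :: "complex^'n^'n \<Rightarrow> complex^'n::finite \<Rightarrow> complex" where
  "cframe e v = complex_of_real (frame e v)"

lemma smooth_punctured_cframe: "smooth_punctured (cframe e)"
  unfolding cframe_def[abs_def]
  by (rule smooth_punctured_linear_compose[OF bounded_linear_of_real smooth_punctured_frame])

lemma lie_deriv_cframe: "lie_deriv B (cframe e) v = complex_of_real (lie_deriv B (frame e) v)"
  unfolding cframe_def[abs_def]
  by (rule lie_deriv_linear_compose[OF bounded_linear_of_real smooth_punctured_frame])

lemma cframe_pull: "\<exists>f\<in>C_inf. pull f = cframe e"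
proof -
  obtain f where "pull f = cframe e"
    by (rule pull_exists[of "cframe e"]) (simp_all add: cframe_def frame_def proj_scale proj_zero)
  then show ?thesis using smooth_punctured_cframe[of e] by (auto simp: C_inf_iff_pull)
qed

lemma lie_deriv_cframe_expansion:
  fixes f :: "'n::finite cproj \<Rightarrow> complex"
  assumes "f \<in> C_inf"
  shows "lie_deriv B (pull f) v = (\<Sum>e\<in>Basis. lie_deriv B (cframe e) v * lie_deriv e (pull f) v)"
  using lie_deriv_frame_expansion[OF assms, of B v] by (simp add: lie_deriv_cframe scaleR_conv_of_real)

section \<open>The flat partial connection of a symplectic r-matrix\<close>

text \<open>In the locale, \<open>w B A\<close> stands for the symplectic form evaluated on the fundamental vector fields of
  \<open>B\<close> and \<open>A\<close>. Then \<open>w_frame\<close> is linearity in the first vector field, \<open>w_vanishes\<close> is linearity in the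
  second at a zero of it, and \<open>anchor\<close> says that the r-matrix inverts the symplectic form.\<close>

locale symplectic_r_matrix =
  fixes N :: nat and c :: "nat \<Rightarrow> complex" and a b :: "nat \<Rightarrow> complex^'n::finite^'n"
    and w :: "complex^'n^'n \<Rightarrow> complex^'n^'n \<Rightarrow> 'n cproj \<Rightarrow> complex"
  assumes skew: "\<And>\<phi> \<psi>. smooth_punctured \<phi> \<Longrightarrow> smooth_punctured \<psi> \<Longrightarrow>
      rmat N c a b \<phi> \<psi> = - rmat N c a b \<psi> \<phi>"
    and jacobi: "\<And>\<phi> \<psi> \<theta>. smooth_punctured \<phi> \<Longrightarrow> smooth_punctured \<psi> \<Longrightarrow> smooth_punctured \<theta> \<Longrightarrow>
      rmat N c a b \<phi> (rmat N c a b \<psi> \<theta>) - rmat N c a b \<psi> (rmat N c a b \<phi> \<theta>)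
       = rmat N c a b (rmat N c a b \<phi> \<psi>) \<theta>"
    and degree: "\<And>f g. f \<in> C_inf \<Longrightarrow> g \<in> C_inf \<Longrightarrow> \<exists>h\<in>C_inf. rmat N c a b (pull f) (pull g) = pull h"
    and w_C_inf: "\<And>A B. w B A \<in> C_inf"
    and w_frame: "\<And>A B v. pull (w B A) v = (\<Sum>e\<in>Basis. lie_deriv B (cframe e) v * pull (w e A) v)"
    and w_vanishes: "\<And>A B v k. A *v v = k *s v \<Longrightarrow> pull (w B A) v = 0"
    and anchor: "\<And>A f v. f \<in> C_inf \<Longrightarrow>
      lie_deriv A (pull f) v = (\<Sum>j<N. - \<i> * c j * pull (w (a j) A) v * lie_deriv (b j) (pull f) v)"
begin

abbreviation \<rho> where "\<rho> \<equiv> rmat N c a b"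

lemma smooth_\<rho>: "smooth_punctured \<phi> \<Longrightarrow> smooth_punctured \<psi> \<Longrightarrow> smooth_punctured (\<rho> \<phi> \<psi>)"
  unfolding rmat_def[abs_def]
  by (intro smooth_on_sum smooth_on_mult smooth_on_const smooth_punctured_lie_deriv open_punctured)

text \<open>The fundamental vector field of \<open>A\<close> on projective space has the right-hand side of \<open>anchor\<close> as a lift
  to the punctured space that in general differs from the linear vector field of \<open>A\<close>. The derivative along this
  lift is the covariant derivative.\<close>

definition nabla :: "complex^'n^'n \<Rightarrow> (complex^'n \<Rightarrow> complex) \<Rightarrow> complex^'n \<Rightarrow> complex" where
  "nabla A s v = (\<Sum>j<N. - \<i> * c j * pull (w (a j) A) v * lie_deriv (b j) s v)"

text \<open>The coefficients of \<open>nabla A\<close> in terms of the operators \<open>\<rho> (cframe e)\<close>, for which the Jacobi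
  identity is available.\<close>

definition coeff :: "complex^'n^'n \<Rightarrow> complex^'n^'n \<Rightarrow> complex^'n \<Rightarrow> complex" where
  "coeff A e v = - \<i> * pull (w e A) v"

lemma smooth_pull_w: "smooth_punctured (pull (w B A))"
  using w_C_inf C_inf_iff_pull by blast

lemma smooth_coeff: "smooth_punctured (coeff A e)"
  unfolding coeff_def[abs_def] by (intro smooth_on_mult smooth_on_const smooth_pull_w open_punctured)

lemma smooth_nabla: "smooth_punctured s \<Longrightarrow> smooth_punctured (nabla A s)"
  unfolding nabla_def[abs_def]
  by (intro smooth_on_sum smooth_on_mult smooth_on_const smooth_punctured_lie_deriv smooth_pull_w
      open_punctured)

lemma nabla_pull: "f \<in> C_inf \<Longrightarrow> nabla A (pull f) = lie_deriv A (pull f)"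
  by (simp add: nabla_def anchor fun_eq_iff)

lemma nabla_frame: "nabla A s v = (\<Sum>e\<in>Basis. coeff A e v * \<rho> (cframe e) s v)"
proof -
  have "nabla A s v = (\<Sum>j<N. \<Sum>e\<in>Basis.
      coeff A e v * (c j * lie_deriv (a j) (cframe e) v * lie_deriv (b j) s v))"
    unfolding nabla_def
  proof (rule sum.cong[OF refl])
    fix j
    show "- \<i> * c j * pull (w (a j) A) v * lie_deriv (b j) s v
        = (\<Sum>e\<in>Basis. coeff A e v * (c j * lie_deriv (a j) (cframe e) v * lie_deriv (b j) s v))"
      unfolding w_frame[of "a j" A v] coeff_def sum_distrib_left sum_distrib_right
      by (intro sum.cong refl) (simp only: mult_ac)
  qed
  also have "\<dots> = (\<Sum>e\<in>Basis. coeff A e v * \<rho> (cframe e) s v)"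
    unfolding rmat_def sum_distrib_left by (rule sum.swap)
  finally show ?thesis .
qed

lemma nabla_mult:
  assumes "smooth_punctured \<phi>" "smooth_punctured s"
  shows "nabla A (\<lambda>v. \<phi> v * s v) v = nabla A \<phi> v * s v + \<phi> v * nabla A s v"
  unfolding nabla_def lie_deriv_mult[OF assms] sum_distrib_left sum_distrib_right sum.distrib[symmetric]
  by (intro sum.cong refl) (simp only: distrib_left mult_ac)

lemma nabla_add:
  assumes "smooth_punctured \<phi>" "smooth_punctured s"
  shows "nabla A (\<lambda>v. \<phi> v + s v) v = nabla A \<phi> v + nabla A s v"
  unfolding nabla_def lie_deriv_add[OF assms] sum.distrib[symmetric]
  by (intro sum.cong refl) (simp only: distrib_left)

lemma nabla_sum:
  assumes "\<And>i. i \<in> I \<Longrightarrow> smooth_punctured (s i)"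
  shows "nabla A (\<lambda>v. \<Sum>i\<in>I. s i v) v = (\<Sum>i\<in>I. nabla A (s i) v)"
  using assms
proof (induction I rule: infinite_finite_induct)
  case (insert i I)
  then show ?case by (simp add: nabla_add smooth_on_sum open_punctured)
qed (simp_all add: nabla_def lie_deriv_const)

lemma \<rho>_frame:
  assumes "f \<in> C_inf"
  shows "\<rho> (pull f) s v = (\<Sum>e\<in>Basis. lie_deriv e (pull f) v * \<rho> (cframe e) s v)"
proof -
  have "\<rho> (pull f) s v = (\<Sum>j<N. \<Sum>e\<in>Basis.
      lie_deriv e (pull f) v * (c j * lie_deriv (a j) (cframe e) v * lie_deriv (b j) s v))"
    unfolding rmat_def
  proof (rule sum.cong[OF refl])
    fix j
    show "c j * lie_deriv (a j) (pull f) v * lie_deriv (b j) s v = (\<Sum>e\<in>Basis.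
      lie_deriv e (pull f) v * (c j * lie_deriv (a j) (cframe e) v * lie_deriv (b j) s v))"
      unfolding lie_deriv_cframe_expansion[OF assms, of "a j" v] sum_distrib_left sum_distrib_right
      by (intro sum.cong refl) (simp only: mult_ac)
  qed
  also have "\<dots> = (\<Sum>e\<in>Basis. lie_deriv e (pull f) v * \<rho> (cframe e) s v)"
    unfolding rmat_def sum_distrib_left by (rule sum.swap)
  finally show ?thesis .
qed

text \<open>The hypothesis says that a vector field on projective space vanishes at \<open>v\<close>, and the conclusion that
  so does its lift. The link is the covector \<open>\<Sum> k e * d (cframe e)\<close>: by antisymmetry the hypothesis says
  that Hamiltonian vector fields annihilate it, and these span the tangent space.\<close>

lemma horizontal_lift_unique:
  assumes "\<And>e'. e' \<in> Basis \<Longrightarrow> (\<Sum>e\<in>Basis. k e * \<rho> (cframe e) (cframe e') v) = 0"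
  shows "(\<Sum>e\<in>Basis. k e * \<rho> (cframe e) s v) = 0"
proof -
  have zero: "(\<Sum>e\<in>Basis. k e * lie_deriv A (cframe e) v) = 0" for A
  proof -
    have "lie_deriv A (cframe e) v = (\<Sum>e'\<in>Basis. coeff A e' v * - \<rho> (cframe e) (cframe e') v)" for e
    proof -
      obtain f where f: "f \<in> C_inf" "pull f = cframe e" using cframe_pull by blast
      have "lie_deriv A (cframe e) v = nabla A (cframe e) v" using nabla_pull[OF f(1)] f(2) by simp
      also have "\<dots> = (\<Sum>e'\<in>Basis. coeff A e' v * \<rho> (cframe e') (cframe e) v)" by (rule nabla_frame)
      also have "\<dots> = (\<Sum>e'\<in>Basis. coeff A e' v * - \<rho> (cframe e) (cframe e') v)"
        using fun_cong[OF skew[OF smooth_punctured_cframe smooth_punctured_cframe], of _ e v] by simp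
      finally show ?thesis .
    qed
    then have "(\<Sum>e\<in>Basis. k e * lie_deriv A (cframe e) v)
        = (\<Sum>e\<in>Basis. \<Sum>e'\<in>Basis. - coeff A e' v * (k e * \<rho> (cframe e) (cframe e') v))"
      by (simp add: sum_distrib_left mult_ac)
    also have "\<dots> = (\<Sum>e'\<in>Basis. - coeff A e' v * (\<Sum>e\<in>Basis. k e * \<rho> (cframe e) (cframe e') v))"
      unfolding sum_distrib_left by (rule sum.swap)
    also have "\<dots> = 0" using assms by simp
    finally show ?thesis .
  qed
  have "(\<Sum>e\<in>Basis. k e * \<rho> (cframe e) s v)
      = (\<Sum>j<N. \<Sum>e\<in>Basis. c j * lie_deriv (b j) s v * (k e * lie_deriv (a j) (cframe e) v))"
    unfolding rmat_def sum_distrib_left by (subst sum.swap) (simp only: mult_ac)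
  also have "\<dots> = 0" unfolding sum_distrib_left[symmetric] by (simp add: zero)
  finally show ?thesis .
qed

text \<open>By the Jacobi identity the commutators of the operators \<open>\<rho> (cframe e)\<close> are of the form \<open>\<rho> (pull h)\<close>,
  so the curvature is a combination of the same operators. As such it is the lift of a vector field.\<close>

lemma nabla_commutator:
  obtains K where "\<And>s :: complex^'n \<Rightarrow> complex. smooth_punctured s \<Longrightarrow>
    nabla A (nabla B s) v - nabla B (nabla A s) v = (\<Sum>e\<in>Basis. K e * \<rho> (cframe e) s v)"
proof
  let ?K = "\<lambda>e. nabla A (coeff B e) v - nabla B (coeff A e) v
     + (\<Sum>d\<in>Basis. \<Sum>d'\<in>Basis. coeff A d v * coeff B d' v * lie_deriv e (\<rho> (cframe d) (cframe d')) v)"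
  fix s :: "complex^'n \<Rightarrow> complex" assume s: "smooth_punctured s"
  note sm = s smooth_coeff smooth_\<rho> smooth_punctured_cframe
  have double: "nabla A (nabla B s) v = (\<Sum>e\<in>Basis. nabla A (coeff B e) v * \<rho> (cframe e) s v)
      + (\<Sum>d\<in>Basis. \<Sum>e\<in>Basis. coeff A d v * coeff B e v * \<rho> (cframe d) (\<rho> (cframe e) s) v)" for A B
  proof -
    have "nabla A (nabla B s) v = nabla A (\<lambda>v. \<Sum>e\<in>Basis. coeff B e v * \<rho> (cframe e) s v) v"
      by (simp add: nabla_frame[of B, abs_def])
    also have "\<dots> = (\<Sum>e\<in>Basis. nabla A (\<lambda>v. coeff B e v * \<rho> (cframe e) s v) v)"
      by (intro nabla_sum smooth_on_mult open_punctured sm)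
    also have "\<dots> = (\<Sum>e\<in>Basis. nabla A (coeff B e) v * \<rho> (cframe e) s v)
        + (\<Sum>e\<in>Basis. coeff B e v * nabla A (\<rho> (cframe e) s) v)"
      by (simp add: nabla_mult sm sum.distrib)
    also have "(\<Sum>e\<in>Basis. coeff B e v * nabla A (\<rho> (cframe e) s) v)
        = (\<Sum>e\<in>Basis. \<Sum>d\<in>Basis. coeff A d v * coeff B e v * \<rho> (cframe d) (\<rho> (cframe e) s) v)"
      by (simp add: nabla_frame[of A "\<rho> _ _"] sum_distrib_left mult_ac)
    also have "\<dots> = (\<Sum>d\<in>Basis. \<Sum>e\<in>Basis. coeff A d v * coeff B e v * \<rho> (cframe d) (\<rho> (cframe e) s) v)"
      by (rule sum.swap)
    finally show ?thesis .
  qed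
  have comm: "\<rho> (cframe d) (\<rho> (cframe e) s) v - \<rho> (cframe e) (\<rho> (cframe d) s) v
      = (\<Sum>k\<in>Basis. lie_deriv k (\<rho> (cframe d) (cframe e)) v * \<rho> (cframe k) s v)" for d e
  proof -
    obtain f g h where fgh: "f \<in> C_inf" "pull f = cframe d" "g \<in> C_inf" "pull g = cframe e"
      "h \<in> C_inf" "\<rho> (cframe d) (cframe e) = pull h"
      using cframe_pull degree by metis
    have "\<rho> (cframe d) (\<rho> (cframe e) s) v - \<rho> (cframe e) (\<rho> (cframe d) s) v
        = \<rho> (\<rho> (cframe d) (cframe e)) s v"
      using fun_cong[OF jacobi[OF smooth_punctured_cframe smooth_punctured_cframe s], of d e v]
      by (simp add: fun_apply)
    also have "\<dots> = (\<Sum>k\<in>Basis. lie_deriv k (\<rho> (cframe d) (cframe e)) v * \<rho> (cframe k) s v)"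
      unfolding fgh(6) by (rule \<rho>_frame[OF fgh(5)])
    finally show ?thesis .
  qed
  have "nabla A (nabla B s) v - nabla B (nabla A s) v
     = (\<Sum>e\<in>Basis. (nabla A (coeff B e) v - nabla B (coeff A e) v) * \<rho> (cframe e) s v)
       + (\<Sum>d\<in>Basis. \<Sum>e\<in>Basis. coeff A d v * coeff B e v *
          (\<rho> (cframe d) (\<rho> (cframe e) s) v - \<rho> (cframe e) (\<rho> (cframe d) s) v))"
  proof -
    have "(\<Sum>d\<in>Basis. \<Sum>e\<in>Basis. coeff B d v * coeff A e v * \<rho> (cframe d) (\<rho> (cframe e) s) v)
       = (\<Sum>d\<in>Basis. \<Sum>e\<in>Basis. coeff A d v * coeff B e v * \<rho> (cframe e) (\<rho> (cframe d) s) v)"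
      by (subst sum.swap) (simp only: mult.commute[of "coeff B _ v"])
    then show ?thesis
      unfolding double[of A B] double[of B A] by (simp add: left_diff_distrib right_diff_distrib sum_subtractf)
  qed
  also have "(\<Sum>d\<in>Basis. \<Sum>e\<in>Basis. coeff A d v * coeff B e v *
          (\<rho> (cframe d) (\<rho> (cframe e) s) v - \<rho> (cframe e) (\<rho> (cframe d) s) v))
     = (\<Sum>d\<in>Basis. \<Sum>e\<in>Basis. \<Sum>k\<in>Basis.
          coeff A d v * coeff B e v * lie_deriv k (\<rho> (cframe d) (cframe e)) v * \<rho> (cframe k) s v)"
    unfolding comm sum_distrib_left by (simp only: mult.assoc)
  also have "\<dots> = (\<Sum>d\<in>Basis. \<Sum>k\<in>Basis. \<Sum>e\<in>Basis.
          coeff A d v * coeff B e v * lie_deriv k (\<rho> (cframe d) (cframe e)) v * \<rho> (cframe k) s v)"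
    by (rule sum.cong[OF refl], rule sum.swap)
  also have "\<dots> = (\<Sum>k\<in>Basis. \<Sum>d\<in>Basis. \<Sum>e\<in>Basis.
          coeff A d v * coeff B e v * lie_deriv k (\<rho> (cframe d) (cframe e)) v * \<rho> (cframe k) s v)"
    by (rule sum.swap)
  finally show "nabla A (nabla B s) v - nabla B (nabla A s) v = (\<Sum>e\<in>Basis. ?K e * \<rho> (cframe e) s v)"
    by (simp add: distrib_right sum.distrib sum_distrib_right)
qed

text \<open>On functions of degree \<open>0\<close> the commutator is that of two Lie derivatives, which is zero. Hence the
  curvature is the lift of the zero vector field.\<close>

lemma nabla_flat:
  assumes comm: "gl_bracket A B = 0" and s: "smooth_punctured s"
  shows "nabla A (nabla B s) v = nabla B (nabla A s) v"
proof -
  obtain K where K: "\<And>s. smooth_punctured s \<Longrightarrow>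
    nabla A (nabla B s) v - nabla B (nabla A s) v = (\<Sum>e\<in>Basis. K e * \<rho> (cframe e) s v)"
    using nabla_commutator by blast
  have "(\<Sum>e\<in>Basis. K e * \<rho> (cframe e) (cframe e') v) = 0" for e'
  proof -
    obtain f where f: "f \<in> C_inf" "pull f = cframe e'" using cframe_pull by blast
    have nabla2: "nabla A (nabla B (cframe e')) = lie_deriv A (lie_deriv B (cframe e'))" for A B
      using nabla_pull[OF lie_act_C_inf[OF f(1)]] nabla_pull[OF f(1)]
      by (simp add: pull_lie_act[OF f(1)] f(2))
    have "nabla A (nabla B (cframe e')) v - nabla B (nabla A (cframe e')) v
        = lie_deriv (gl_bracket A B) (cframe e') v"
      unfolding nabla2 by (rule lie_deriv_bracket[OF smooth_punctured_cframe])
    also have "\<dots> = 0"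
      unfolding comm using lie_deriv_add_matrix(2)[OF smooth_punctured_cframe, of 0 0 e' v] by simp
    finally show ?thesis using K[OF smooth_punctured_cframe] by simp
  qed
  then show ?thesis using K[OF s] horizontal_lift_unique by simp
qed

text \<open>The linear coordinates are sections of the dual of the tautological bundle.\<close>

definition coord :: "'n \<Rightarrow> complex^'n \<Rightarrow> complex" where
  "coord k v = v $ k"

lemma smooth_coord: "smooth_punctured (coord k)"
  unfolding coord_def[abs_def]
  by (intro smooth_on_linear open_punctured bounded_linear_vec_nth bounded_linear_ident)

lemma lie_deriv_coord: "lie_deriv A (coord k) v = - ((A *v v) $ k)"
proof -
  have "fder (coord k) v = coord k"
    unfolding coord_def[abs_def]
    by (intro frechet_derivative_eqI bounded_linear_imp_has_derivative bounded_linear_vec_nth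
        bounded_linear_ident)
  then show ?thesis by (simp add: lie_deriv_def coord_def)
qed

text \<open>The function by which \<open>lie_deriv A - nabla A\<close> multiplies linear coordinates. The average over all
  coordinates avoids a division by one of them, which may vanish.\<close>

definition moment :: "complex^'n^'n \<Rightarrow> complex^'n \<Rightarrow> complex" where
  "moment A v = (\<Sum>k\<in>UNIV. cnj (v $ k) * of_real (inverse (v \<bullet> v)) *
     (lie_deriv A (coord k) v - nabla A (coord k) v))"

lemma smooth_moment: "smooth_punctured (moment A)"
proof -
  have "smooth_punctured (\<lambda>v. \<Sum>k\<in>UNIV. cnj (v $ k) * of_real (inverse (v \<bullet> v)) *
     (lie_deriv A (coord k) v + - 1 * nabla A (coord k) v))"
    by (intro smooth_on_sum smooth_on_mult smooth_on_add smooth_punctured_lie_deriv smooth_nabla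
        smooth_coord open_punctured smooth_on_const smooth_punctured_linear_compose[OF bounded_linear_of_real]
        smooth_punctured_inverse_norm smooth_on_linear bounded_linear_cnj[THEN bounded_linear_compose]
        bounded_linear_vec_nth bounded_linear_ident)
  then show ?thesis by (simp add: moment_def[abs_def])
qed

lemma moment_pull: "\<exists>f\<in>C_inf. pull f = moment A"
proof -
  have "moment A (k *s v) = moment A v" if k: "k \<noteq> 0" for k v
  proof -
    have lie: "lie_deriv A (coord i) (k *s v) = k * lie_deriv A (coord i) v" for A i
      by (simp add: lie_deriv_coord vector_scalar_commute)
    have nab: "nabla A (coord i) (k *s v) = k * nabla A (coord i) v" for i
      by (simp add: nabla_def pull_scale[OF k] lie sum_distrib_left mult_ac)
    have "cnj k * k * of_real (inverse ((norm k)\<^sup>2)) = 1"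
      using k by (simp add: complex_norm_square[symmetric] mult.commute[of "cnj k"])
    then have cancel: "cnj (k * z) * of_real (inverse ((norm k)\<^sup>2 * r)) * (k * x - k * y)
       = cnj z * of_real (inverse r) * (x - y)" for z x y :: complex and r
      by (simp add: inverse_mult_distrib right_diff_distrib[symmetric])
        (metis (no_types, opaque_lifting) mult.assoc mult.commute mult.left_neutral)
    show ?thesis
      unfolding moment_def lie nab inner_self_scale vector_smult_component by (simp only: cancel)
  qed
  moreover have "moment A 0 = 0" by (simp add: moment_def)
  ultimately obtain f where "pull f = moment A" using pull_exists by metis
  then show ?thesis using smooth_moment[of A] by (auto simp: C_inf_iff_pull)
qed

text \<open>The difference \<open>E\<close> is a derivation that kills functions of degree \<open>0\<close>. Applied to
  \<open>y j j * z\<^sub>k = y k j * z\<^sub>j\<close>, where \<open>y\<close> are the entries of \<open>proj\<close>, it gives the claim after summation over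
  \<open>j\<close>, because \<open>proj\<close> has trace \<open>1\<close>.\<close>

lemma lie_deriv_minus_nabla_coord:
  "lie_deriv A (coord k) v - nabla A (coord k) v = coord k v * moment A v"
proof (cases "v = 0")
  case True
  then show ?thesis by (simp add: lie_deriv_def nabla_def coord_def)
next
  case False
  define E where "E s = lie_deriv A s v - nabla A s v" for s
  define y where "y i j v = v $ i * cnj (v $ j) * of_real (inverse (v \<bullet> v))" for i j and v :: "complex^'n"
  have sy: "smooth_punctured (y i j)" for i j
    unfolding y_def[abs_def]
    by (intro smooth_on_mult open_punctured smooth_punctured_linear_compose[OF bounded_linear_of_real]
        smooth_punctured_inverse_norm smooth_on_linear bounded_linear_cnj[THEN bounded_linear_compose]
        bounded_linear_vec_nth bounded_linear_ident)
  have y_scale: "y i j (k *s v) = y i j v" if k: "k \<noteq> 0" for i j k v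
  proof -
    have "k * cnj k * of_real (inverse ((norm k)\<^sup>2)) = 1"
      using k by (simp add: complex_norm_square[symmetric])
    then have "(k * z) * cnj (k * x) * of_real (inverse ((norm k)\<^sup>2 * r)) = z * cnj x * of_real (inverse r)"
      for z x :: complex and r
      by (simp add: inverse_mult_distrib) (metis (no_types, opaque_lifting) mult.assoc mult.commute mult.left_neutral)
    then show ?thesis by (simp only: y_def inner_self_scale vector_smult_component)
  qed
  have ypull: "\<exists>f\<in>C_inf. pull f = y i j" for i j
  proof -
    have "y i j 0 = 0" by (simp add: y_def)
    then obtain f where "pull f = y i j" by (rule pull_exists[OF _ y_scale])
    then show ?thesis using sy[of i j] by (auto simp: C_inf_iff_pull)
  qed
  have E_mult: "E (\<lambda>v. y i j v * coord k v) = y i j v * E (coord k)" for i j k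
  proof -
    obtain f where f: "f \<in> C_inf" "pull f = y i j" using ypull by blast
    have "nabla A (y i j) v = lie_deriv A (y i j) v" using nabla_pull[OF f(1)] f(2) by simp
    then show ?thesis
      unfolding E_def lie_deriv_mult[OF sy smooth_coord] nabla_mult[OF sy smooth_coord]
      by (simp add: algebra_simps)
  qed
  have "(\<lambda>v. y j j v * coord k v) = (\<lambda>v. y k j v * coord j v)" for j
    by (simp add: y_def coord_def fun_eq_iff)
  then have swap: "y j j v * E (coord k) = y k j v * E (coord j)" for j
    using E_mult by metis
  have "(\<Sum>j\<in>UNIV. y j j v) = of_real (v \<bullet> v) * of_real (inverse (v \<bullet> v))"
    by (simp only: y_def inner_self_complex_vec sum_distrib_right mult.commute[of "cnj _"])
  also have "\<dots> = 1" using False by (simp flip: of_real_mult)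
  finally have "E (coord k) = (\<Sum>j\<in>UNIV. y j j v) * E (coord k)" by simp
  also have "\<dots> = (\<Sum>j\<in>UNIV. y k j v * E (coord j))" by (simp add: sum_distrib_right swap)
  also have "\<dots> = coord k v * moment A v"
    by (simp add: moment_def y_def coord_def E_def sum_distrib_left mult.assoc)
  finally show ?thesis by (simp add: E_def)
qed

text \<open>Flatness is evaluated on a coordinate on which both matrices act by zero. There \<open>nabla\<close> is
  multiplication by \<open>- moment\<close>, and only the derivatives of the moments survive in the commutator.\<close>

lemma moment_closed:
  assumes comm: "gl_bracket A B = 0" and k: "\<And>v. (A *v v) $ k = 0" "\<And>v. (B *v v) $ k = 0"
    and v: "v $ k \<noteq> 0"
  shows "lie_deriv A (moment B) v = lie_deriv B (moment A) v"
proof -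
  have nab: "nabla C (coord k) = (\<lambda>v. (- 1 * moment C v) * coord k v)" if "\<And>v. (C *v v) $ k = 0" for C
  proof
    fix v
    show "nabla C (coord k) v = (- 1 * moment C v) * coord k v"
      using lie_deriv_minus_nabla_coord[of C k v] that[of v]
      by (simp add: lie_deriv_coord) (metis minus_minus mult.commute)
  qed
  have sm: "smooth_punctured (\<lambda>v. - 1 * moment C v)" for C
    by (intro smooth_on_mult smooth_on_const smooth_moment open_punctured)
  have nab2: "nabla C (nabla D (coord k)) v = - lie_deriv C (moment D) v * coord k v
      + moment C v * moment D v * coord k v"
    if C: "\<And>v. (C *v v) $ k = 0" and D: "\<And>v. (D *v v) $ k = 0" for C D
  proof -
    obtain f where f: "f \<in> C_inf" "pull f = moment D" using moment_pull by blast
    have "nabla C (\<lambda>v. - 1 * moment D v) v = - nabla C (moment D) v"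
      using nabla_mult[OF smooth_on_const[OF open_punctured] smooth_moment, of C "- 1" D v]
      by (simp add: nabla_def lie_deriv_const)
    also have "nabla C (moment D) = lie_deriv C (moment D)" using nabla_pull[OF f(1)] f(2) by simp
    finally show ?thesis
      unfolding nab[OF D] nabla_mult[OF sm smooth_coord] unfolding nab[OF C] by simp
  qed
  have "nabla A (nabla B (coord k)) v = nabla B (nabla A (coord k)) v"
    by (rule nabla_flat[OF comm smooth_coord])
  then have "lie_deriv A (moment B) v * coord k v = lie_deriv B (moment A) v * coord k v"
    unfolding nab2[OF k(1) k(2)] nab2[OF k(2) k(1)] by (simp add: mult_ac)
  then show ?thesis using v by (simp add: coord_def)
qed

text \<open>At a fixed point there is no direction to differentiate in, so \<open>nabla A\<close> vanishes and only the action
  of \<open>A\<close> on the fibre remains.\<close>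

lemma moment_fixed_point:
  assumes "A *v v = k *s v" "v \<noteq> 0" shows "moment A v = - k"
proof -
  obtain i where i: "v $ i \<noteq> 0" using assms(2) by (auto simp: vec_eq_iff)
  have "nabla A (coord i) v = 0" by (simp add: nabla_def w_vanishes[OF assms(1)])
  then show ?thesis
    using lie_deriv_minus_nabla_coord[of A i v] i assms(1)
    by (simp add: lie_deriv_coord coord_def) (metis minus_mult_right mult.commute mult_cancel_left)
qed

end

section \<open>Symplectic forms on projective space\<close>

text \<open>The vector fields of the action, in the convention of point derivations that vanish on
  non-smooth functions.\<close>

definition fundamental :: "complex^'n^'n \<Rightarrow> 'n::finite vfield" where
  "fundamental A p f = (if f \<in> C_inf then Re (lie_act A (complex_of_real \<circ> f) p) else 0)"

lemma fundamental_line: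
  assumes f: "f \<in> C_inf" and v: "v \<noteq> 0"
  shows "fundamental A (line v) f = lie_deriv A (pull f) v"
  using lie_act_line[OF of_real_C_inf[OF f] v, of A] f
  by (simp add: fundamental_def pull_of_real lie_deriv_linear_compose[OF bounded_linear_of_real] C_inf_iff_pull)

lemma pull_real_fun:
  fixes f g :: "'n::finite cproj \<Rightarrow> real"
  shows "pull (\<lambda>q. f q + g q) = (\<lambda>v. pull f v + pull g v)"
    "pull (\<lambda>q. f q * g q) = (\<lambda>v. pull f v * pull g v)"
    "pull (\<lambda>q. r * f q) = (\<lambda>v. r * pull f v)"
  by (simp_all add: pull_def fun_eq_iff)

lemma fundamental_tangent: "fundamental A p \<in> tangent p"
proof -
  obtain v where v: "v \<noteq> 0" "p = line v" using cproj_eq_line by blast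
  have C: "(\<lambda>q. f q + g q) \<in> C_inf" "(\<lambda>q. f q * g q) \<in> C_inf" "(\<lambda>q. r * f q) \<in> C_inf"
    if "f \<in> C_inf" "g \<in> C_inf" for f g :: "'a cproj \<Rightarrow> real" and r
    using that smooth_on_add[OF open_punctured] smooth_on_mult[OF open_punctured]
      smooth_on_mult[OF open_punctured smooth_on_const[OF open_punctured]]
    unfolding C_inf_iff_pull pull_real_fun(1) pull_real_fun(2)[of f g] pull_real_fun(3) by blast+
  show ?thesis
    unfolding tangent_def
  proof (intro CollectI conjI ballI allI impI)
    fix f g :: "'a cproj \<Rightarrow> real" and r
    show "f \<notin> C_inf \<Longrightarrow> fundamental A p f = 0" by (simp add: fundamental_def)
    assume f: "f \<in> C_inf"
    then have sf: "smooth_punctured (pull f)" by (simp add: C_inf_iff_pull)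
    show "fundamental A p (\<lambda>q. r * f q) = r * fundamental A p f"
      using lie_deriv_mult[OF smooth_on_const[OF open_punctured] sf, of A r v]
      by (simp add: v fundamental_line f C(3)[OF f f] pull_real_fun(3) lie_deriv_const)
    assume g: "g \<in> C_inf"
    then have sg: "smooth_punctured (pull g)" by (simp add: C_inf_iff_pull)
    show "fundamental A p (\<lambda>q. f q + g q) = fundamental A p f + fundamental A p g"
      using lie_deriv_add[OF sf sg] by (simp add: v fundamental_line f g C pull_real_fun)
    show "fundamental A p (\<lambda>q. f q * g q) = f p * fundamental A p g + g p * fundamental A p f"
      using lie_deriv_mult[OF sf sg, of A v]
      by (simp add: v fundamental_line f g C pull_real_fun) (simp add: pull_def v mult.commute)
  qed
qed

lemma vector_field_fundamental: "vector_field (fundamental A)"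
  unfolding vector_field_def
proof (intro conjI allI ballI fundamental_tangent)
  fix f :: "'a cproj \<Rightarrow> real" assume f: "f \<in> C_inf"
  have "pull (\<lambda>p. fundamental A p f) = lie_deriv A (pull f)"
    using fundamental_line[OF f] by (auto simp: fun_eq_iff pull_def[of "\<lambda>p. fundamental A p f"] lie_deriv_def[of _ _ 0])
  then show "(\<lambda>p. fundamental A p f) \<in> C_inf"
    using f smooth_punctured_lie_deriv by (simp add: C_inf_iff_pull)
qed

lemma fundamental_frame_expansion:
  assumes v: "v \<noteq> 0"
  shows "fundamental B (line v) = (\<lambda>f. \<Sum>e\<in>Basis. lie_deriv B (frame e) v * fundamental e (line v) f)"
proof
  fix f :: "'a cproj \<Rightarrow> real"
  show "fundamental B (line v) f = (\<Sum>e\<in>Basis. lie_deriv B (frame e) v * fundamental e (line v) f)"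
  proof (cases "f \<in> C_inf")
    case True
    then show ?thesis using lie_deriv_frame_expansion[OF True, of B v]
      by (simp add: fundamental_line v)
  qed (simp add: fundamental_def)
qed

lemma fundamental_vanishes:
  assumes "A *v v = k *s v" "v \<noteq> 0" shows "fundamental A (line v) = (\<lambda>f. 0)"
proof
  fix f :: "'a cproj \<Rightarrow> real"
  show "fundamental A (line v) f = 0"
  proof (cases "f \<in> C_inf")
    case True
    then show ?thesis
      by (simp add: fundamental_line assms lie_deriv_def frechet_derivative_pull_radial)
  qed (simp add: fundamental_def)
qed

lemma tangent_add: "u \<in> tangent p \<Longrightarrow> w \<in> tangent p \<Longrightarrow> (\<lambda>f. u f + w f) \<in> tangent p"
  and tangent_scale: "u \<in> tangent p \<Longrightarrow> (\<lambda>f. r * u f) \<in> tangent p"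
  by (simp_all add: tangent_def algebra_simps)

lemma two_form_skew: "two_form \<omega> \<Longrightarrow> u \<in> tangent p \<Longrightarrow> w \<in> tangent p \<Longrightarrow> \<omega> p u w = - \<omega> p w u"
  unfolding two_form_def by blast

lemma two_form_C_inf: "two_form \<omega> \<Longrightarrow> vector_field X \<Longrightarrow> vector_field Y \<Longrightarrow> (\<lambda>p. \<omega> p (X p) (Y p)) \<in> C_inf"
  unfolding two_form_def by blast

lemma two_form_add: "two_form \<omega> \<Longrightarrow> u \<in> tangent p \<Longrightarrow> v \<in> tangent p \<Longrightarrow> w \<in> tangent p \<Longrightarrow>
    \<omega> p (\<lambda>f. u f + v f) w = \<omega> p u w + \<omega> p v w"
  and two_form_scale: "two_form \<omega> \<Longrightarrow> u \<in> tangent p \<Longrightarrow> w \<in> tangent p \<Longrightarrow>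
    \<omega> p (\<lambda>f. r * u f) w = r * \<omega> p u w"
  unfolding two_form_def by blast+

lemma two_form_sum:
  assumes \<omega>: "two_form \<omega>" and w: "w \<in> tangent p" and "finite I" "\<And>i. i \<in> I \<Longrightarrow> u i \<in> tangent p"
  shows "(\<lambda>f. \<Sum>i\<in>I. r i * u i f) \<in> tangent p \<and> \<omega> p (\<lambda>f. \<Sum>i\<in>I. r i * u i f) w = (\<Sum>i\<in>I. r i * \<omega> p (u i) w)"
  using assms(3,4)
proof (induction I)
  case empty
  show ?case using tangent_scale[OF w, of 0] two_form_scale[OF \<omega> w w, of 0] by simp
next
  case (insert i I)
  then have "(\<lambda>f. r i * u i f) \<in> tangent p" "(\<lambda>f. \<Sum>i\<in>I. r i * u i f) \<in> tangent p"
    by (simp_all add: tangent_scale)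
  then show ?case
    using insert two_form_add[OF \<omega> _ _ w, of "\<lambda>f. r i * u i f" "\<lambda>f. \<Sum>i\<in>I. r i * u i f"]
      two_form_scale[OF \<omega> _ w, of "u i" "r i"]
    by (simp add: tangent_add)
qed

text \<open>The formula for the bracket writes the Hamiltonian vector field \<open>Y\<close> of \<open>g\<close> as a combination of
  fundamental vector fields. Inserting this into \<open>\<omega>(Y, V) = V g\<close> for the fundamental vector field \<open>V\<close> of
  \<open>A\<close> gives the claim. As \<open>Y\<close> is real, only the imaginary parts of \<open>c\<close> contribute to it; the real parts
  give the zero vector field.\<close>

lemma r_matrix_inverts_form:
  assumes \<omega>: "two_form \<omega>" and br: "bracket_from_form \<omega> P"
    and rmat: "\<And>f g. f \<in> C_inf \<Longrightarrow> g \<in> C_inf \<Longrightarrow> rmat N c a b (pull f) (pull g) = \<i> *\<^sub>C pull (P f g)"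
    and g: "g \<in> C_inf" and v: "v \<noteq> 0"
  shows "complex_of_real (lie_deriv A (pull g) v) = (\<Sum>j<N. - \<i> * c j *
     complex_of_real (\<omega> (line v) (fundamental (a j) (line v)) (fundamental A (line v)))
     * complex_of_real (lie_deriv (b j) (pull g) v))"
proof -
  define p where "p = line v"
  note tan = fundamental_tangent
  obtain Y where Y: "hamiltonian_field \<omega> g Y"
    using br g unfolding bracket_from_form_def by blast
  then have Yp: "Y p \<in> tangent p" "\<And>u. u \<in> tangent p \<Longrightarrow> \<omega> p (Y p) u = u g"
    by (auto simp: hamiltonian_field_def vector_field_def)
  define \<beta> where "\<beta> j = lie_deriv (b j) (pull g) v" for j
  \<comment> \<open>The field \<open>Y'\<close> for the pair \<open>(f, g)\<close> may differ from \<open>Y\<close>, but both give the same value of the bracket.\<close>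
  have Y_eq: "(\<Sum>j<N. c j * of_real (\<beta> j * fundamental (a j) p f)) = \<i> * of_real (Y p f)"
    if f: "f \<in> C_inf" for f
  proof -
    obtain X Y' where X: "hamiltonian_field \<omega> f X" and Y': "hamiltonian_field \<omega> g Y'"
      and P: "P (complex_of_real \<circ> f) (complex_of_real \<circ> g) = (\<lambda>p. complex_of_real (\<omega> p (X p) (Y' p)))"
      using br f g unfolding bracket_from_form_def by blast
    have Xp: "X p \<in> tangent p" "\<And>u. u \<in> tangent p \<Longrightarrow> \<omega> p (X p) u = u f"
      using X by (auto simp: hamiltonian_field_def vector_field_def)
    have Yp': "Y' p \<in> tangent p" "\<And>u. u \<in> tangent p \<Longrightarrow> \<omega> p (Y' p) u = u g"
      using Y' by (auto simp: hamiltonian_field_def vector_field_def)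
    have "\<omega> p (X p) (Y' p) = - X p g"
      using two_form_skew[OF \<omega> Xp(1) Yp'(1)] Yp'(2)[OF Xp(1)] by simp
    also have "\<dots> = Y p f"
      using two_form_skew[OF \<omega> Xp(1) Yp(1)] Yp(2)[OF Xp(1)] Xp(2)[OF Yp(1)] by simp
    finally have "P (complex_of_real \<circ> f) (complex_of_real \<circ> g) p = of_real (Y p f)"
      by (simp add: P)
    moreover have sm: "smooth_punctured (pull f)" "smooth_punctured (pull g)"
      using f g by (simp_all add: C_inf_iff_pull)
    have "rmat N c a b (pull (complex_of_real \<circ> f)) (pull (complex_of_real \<circ> g)) v
        = (\<Sum>j<N. c j * of_real (\<beta> j * fundamental (a j) p f))"
      by (simp add: rmat_def pull_of_real lie_deriv_linear_compose[OF bounded_linear_of_real] sm \<beta>_def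
          p_def fundamental_line[OF f v] mult_ac)
    ultimately show ?thesis
      using fun_cong[OF rmat[OF of_real_C_inf[OF f] of_real_C_inf[OF g]], of v] v
      by (simp add: scaleC_fun_def scaleC_complex_def pull_def p_def)
  qed
  have Im_eq: "Y p = (\<lambda>f. \<Sum>j<N. (Im (c j) * \<beta> j) * fundamental (a j) p f)"
  proof
    fix f show "Y p f = (\<Sum>j<N. (Im (c j) * \<beta> j) * fundamental (a j) p f)"
    proof (cases "f \<in> C_inf")
      case True
      then show ?thesis using arg_cong[OF Y_eq[OF True], of Im] by (simp add: mult_ac)
    next
      case False
      then have "Y p f = 0" using Yp(1) by (simp add: tangent_def)
      then show ?thesis using False by (simp add: fundamental_def)
    qed
  qed
  have Re_eq: "(\<lambda>f. \<Sum>j<N. (Re (c j) * \<beta> j) * fundamental (a j) p f) = (\<lambda>f. 0 * fundamental A p f)"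
  proof
    fix f show "(\<Sum>j<N. (Re (c j) * \<beta> j) * fundamental (a j) p f) = 0 * fundamental A p f"
    proof (cases "f \<in> C_inf")
      case True
      then show ?thesis using arg_cong[OF Y_eq[OF True], of Re] by (simp add: mult_ac)
    qed (simp add: fundamental_def)
  qed
  define W where "W j = \<omega> p (fundamental (a j) p) (fundamental A p)" for j
  have im: "(\<Sum>j<N. (Im (c j) * \<beta> j) * W j) = lie_deriv A (pull g) v"
    using two_form_sum[OF \<omega> tan[of A p], of "{..<N}" "\<lambda>j. fundamental (a j) p" "\<lambda>j. Im (c j) * \<beta> j"]
      Yp(2)[OF tan[of A]] fundamental_line[OF g v, of A]
    by (simp add: tan Im_eq[symmetric] W_def) (simp add: p_def)
  have re: "(\<Sum>j<N. (Re (c j) * \<beta> j) * W j) = 0"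
    using two_form_sum[OF \<omega> tan[of A p], of "{..<N}" "\<lambda>j. fundamental (a j) p" "\<lambda>j. Re (c j) * \<beta> j"]
      two_form_scale[OF \<omega> tan[of A p] tan[of A p], of 0]
    unfolding Re_eq by (simp add: tan W_def)
  have "complex_of_real (lie_deriv A (pull g) v) = (\<Sum>j<N. - \<i> * c j * of_real (W j) * of_real (\<beta> j))"
  proof (rule complex_eqI)
    show "Re (complex_of_real (lie_deriv A (pull g) v)) = Re (\<Sum>j<N. - \<i> * c j * of_real (W j) * of_real (\<beta> j))"
      unfolding im[symmetric] by (simp add: mult_ac)
    have "Im (\<Sum>j<N. - \<i> * c j * of_real (W j) * of_real (\<beta> j)) = - (\<Sum>j<N. (Re (c j) * \<beta> j) * W j)"
      by (simp add: mult_ac sum_negf)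
    then show "Im (complex_of_real (lie_deriv A (pull g) v)) = Im (\<Sum>j<N. - \<i> * c j * of_real (W j) * of_real (\<beta> j))"
      unfolding re by simp
  qed
  then show ?thesis by (simp add: W_def \<beta>_def p_def)
qed

lemma symplectic_r_matrix_of_form:
  fixes \<omega> :: "'n::finite form2"
  assumes \<omega>: "two_form \<omega>" and br: "bracket_from_form \<omega> P"
    and P: "\<And>f g. f \<in> C_inf \<Longrightarrow> g \<in> C_inf \<Longrightarrow> P f g \<in> C_inf"
    and rmat: "\<And>f g. f \<in> C_inf \<Longrightarrow> g \<in> C_inf \<Longrightarrow> rmat N c a b (pull f) (pull g) = \<i> *\<^sub>C pull (P f g)"
    and skew: "\<And>\<phi> \<psi>. smooth_punctured \<phi> \<Longrightarrow> smooth_punctured \<psi> \<Longrightarrow> rmat N c a b \<phi> \<psi> = - rmat N c a b \<psi> \<phi>"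
    and jacobi: "\<And>\<phi> \<psi> \<theta>. smooth_punctured \<phi> \<Longrightarrow> smooth_punctured \<psi> \<Longrightarrow> smooth_punctured \<theta> \<Longrightarrow>
       rmat N c a b \<phi> (rmat N c a b \<psi> \<theta>) - rmat N c a b \<psi> (rmat N c a b \<phi> \<theta>)
       = rmat N c a b (rmat N c a b \<phi> \<psi>) \<theta>"
  shows "symplectic_r_matrix N c a b (\<lambda>B A p. complex_of_real (\<omega> p (fundamental B p) (fundamental A p)))"
    (is "symplectic_r_matrix _ _ _ _ ?w")
proof
  note tan = fundamental_tangent
  fix A B :: "complex^'n^'n" and f g :: "'n cproj \<Rightarrow> complex" and v :: "complex^'n" and k
  show "?w B A \<in> C_inf"
    using of_real_C_inf[OF two_form_C_inf[OF \<omega> vector_field_fundamental vector_field_fundamental]]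
    by (simp add: comp_def)
  show "\<exists>h\<in>C_inf. rmat N c a b (pull f) (pull g) = pull h" if "f \<in> C_inf" "g \<in> C_inf"
  proof
    show "rmat N c a b (pull f) (pull g) = pull (\<i> *\<^sub>C P f g)" by (simp add: rmat that pull_fun)
    show "\<i> *\<^sub>C P f g \<in> C_inf"
      using P[OF that] smooth_punctured_fun(3) by (simp add: C_inf_iff_pull pull_fun)
  qed
  show "pull (?w B A) v = (\<Sum>e\<in>Basis. lie_deriv B (cframe e) v * pull (?w e A) v)"
  proof (cases "v = 0")
    case False
    have "\<omega> (line v) (fundamental B (line v)) (fundamental A (line v))
      = (\<Sum>e\<in>Basis. lie_deriv B (frame e) v * \<omega> (line v) (fundamental e (line v)) (fundamental A (line v)))"
      unfolding fundamental_frame_expansion[OF False, of B]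
      by (rule two_form_sum[OF \<omega> tan finite_Basis tan, THEN conjunct2])
    then show ?thesis using False by (simp add: pull_def lie_deriv_cframe)
  qed (simp add: pull_def)
  show "pull (?w B A) v = 0" if "A *v v = k *s v"
  proof (cases "v = 0")
    case False
    have "\<omega> (line v) (\<lambda>f. 0) (fundamental B (line v)) = 0"
      using two_form_scale[OF \<omega> tan[of B "line v"] tan[of B "line v"], of 0] by simp
    moreover have "(\<lambda>f. 0) \<in> tangent (line v)" using tangent_scale[OF tan[of B "line v"], of 0] by simp
    ultimately show ?thesis
      using False two_form_skew[OF \<omega> tan[of B "line v"], of "\<lambda>f. 0"]
      by (simp add: pull_def fundamental_vanishes[OF that])
  qed (simp add: pull_def)
  show "lie_deriv A (pull f) v = (\<Sum>j<N. - \<i> * c j * pull (?w (a j) A) v * lie_deriv (b j) (pull f) v)"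
    if f: "f \<in> C_inf"
  proof (cases "v = 0")
    case False
    have sm: "smooth_punctured (pull f)" using f by (simp add: C_inf_iff_pull)
    have part: "h \<circ> f \<in> C_inf" "lie_deriv B (pull (h \<circ> f)) v = h (lie_deriv B (pull f) v)"
      if "bounded_linear h" for h :: "complex \<Rightarrow> real" and B
    proof -
      have "pull (h \<circ> f) = (\<lambda>v. h (pull f v))"
        using linear_0[of h] that by (auto simp: pull_def fun_eq_iff bounded_linear.linear)
      then show "h \<circ> f \<in> C_inf" "lie_deriv B (pull (h \<circ> f)) v = h (lie_deriv B (pull f) v)"
        using smooth_punctured_linear_compose[OF that sm] lie_deriv_linear_compose[OF that sm]
        by (simp_all add: C_inf_iff_pull)
    qed
    note Re = part[OF bounded_linear_Re] and Im = part[OF bounded_linear_Im]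
    have inverts: "complex_of_real (lie_deriv A (pull g) v) = (\<Sum>j<N. - \<i> * c j *
        of_real (\<omega> (line v) (fundamental (a j) (line v)) (fundamental A (line v)))
        * of_real (lie_deriv (b j) (pull g) v))" if "g \<in> C_inf" for g
      using r_matrix_inverts_form[OF \<omega> br _ that False] rmat by blast
    have split: "z = of_real (Re z) + \<i> * of_real (Im z)" for z by (rule complex_eq)
    have "lie_deriv A (pull f) v = of_real (lie_deriv A (pull (Re \<circ> f)) v)
        + \<i> * of_real (lie_deriv A (pull (Im \<circ> f)) v)"
      unfolding Re(2) Im(2) by (rule split)
    also have "\<dots> = (\<Sum>j<N. - \<i> * c j * pull (?w (a j) A) v * (of_real (lie_deriv (b j) (pull (Re \<circ> f)) v)
        + \<i> * of_real (lie_deriv (b j) (pull (Im \<circ> f)) v)))"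
      unfolding inverts[OF Re(1)] inverts[OF Im(1)]
        sum_distrib_left sum.distrib[symmetric]
      using False by (intro sum.cong refl) (simp add: pull_def[of "?w _ _"] algebra_simps)
    also have "\<dots> = (\<Sum>j<N. - \<i> * c j * pull (?w (a j) A) v * lie_deriv (b j) (pull f) v)"
      unfolding Re(2) Im(2) split[symmetric] ..
    finally show ?thesis .
  qed (simp add: lie_deriv_def)
qed (fact skew jacobi)+

section \<open>A closed form with a period\<close>

lemma integral_near_constant:
  fixes g :: "real \<Rightarrow> complex"
  assumes "g integrable_on {0..2 * pi}" "\<And>t. t \<in> {0..2 * pi} \<Longrightarrow> norm (g t - z) \<le> \<epsilon>"
  shows "norm (integral {0..2 * pi} g - (2 * pi) *\<^sub>R z) \<le> \<epsilon> * (2 * pi)"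
proof -
  have "((\<lambda>t. g t - z) has_integral integral {0..2 * pi} g - (2 * pi) *\<^sub>R z) (cbox 0 (2 * pi))"
    using has_integral_diff[OF integrable_integral[OF assms(1)] has_integral_const_real[of z 0 "2 * pi"]]
    by simp
  moreover have "\<epsilon> \<ge> 0" using assms(2)[of 0] norm_ge_zero[of "g 0 - z"] by (simp del: norm_ge_zero)
  ultimately show ?thesis
    using has_integral_bound[of \<epsilon> "\<lambda>t. g t - z" _ 0 "2 * pi"] assms(2) by simp
qed

text \<open>For \<open>k = \<i>\<close> and \<open>k = 1\<close> these generate the rotation and the dilation of the \<open>i\<close>-th coordinate.\<close>

definition unit_entry :: "'n \<Rightarrow> complex \<Rightarrow> complex^'n^'n" where
  "unit_entry i k = (\<chi> l m. if l = i \<and> m = i then k else 0)"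

lemma unit_entry_mult: "unit_entry i k *v v = axis i (k * v $ i)"
  by (auto simp: vec_eq_iff unit_entry_def matrix_vector_mult_def axis_def if_distrib[of "\<lambda>x. x * _"]
      cong: if_cong)

lemma unit_entry_commute: "gl_bracket (unit_entry i k) (unit_entry i l) = 0"
proof -
  have "unit_entry i k ** unit_entry i l = unit_entry i (k * l)" for k l
    by (auto simp: vec_eq_iff unit_entry_def matrix_matrix_mult_def if_distrib[of "\<lambda>x. x * _"]
        cong: if_cong)
  then show ?thesis by (simp add: mult.commute)
qed

text \<open>Think of \<open>\<Phi>\<close> and \<open>\<Psi>\<close> as the components of a closed \<open>1\<close>-form along rotation and dilation of the
  \<open>i\<close>-th coordinate. On the projective line through the \<open>i\<close>-th and \<open>j\<close>-th coordinate points, with affine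
  coordinate \<open>exp (s + \<i> t)\<close>, the \<open>s\<close>-derivative of \<open>\<Phi>\<close> is the \<open>t\<close>-derivative of \<open>\<Psi>\<close>, whose integral
  over a circle \<open>s = const\<close> is zero. So the integral of \<open>\<Phi>\<close> over the circle is independent of \<open>s\<close>,
  and the circles shrink to the two coordinate points as \<open>s\<close> tends to \<open>- \<infinity>\<close> and to \<open>\<infinity>\<close>.\<close>

lemma closed_form_no_period:
  fixes \<Phi> \<Psi> :: "complex^'n::finite \<Rightarrow> complex"
  assumes \<Phi>: "smooth_punctured \<Phi>" and \<Psi>: "smooth_punctured \<Psi>"
    and hom: "\<And>k v. k \<noteq> 0 \<Longrightarrow> \<Phi> (k *s v) = \<Phi> v" and ij: "i \<noteq> j"
    and closed: "\<And>v. v $ j \<noteq> 0 \<Longrightarrow> lie_deriv (unit_entry i 1) \<Phi> v = lie_deriv (unit_entry i \<i>) \<Psi> v"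
  shows "\<Phi> (axis i 1) = \<Phi> (axis j 1)"
proof -
  define z where "z s t = exp (Complex s t)" for s t
  define v where "v s t = axis i (z s t) + axis j 1" for s t
  have vj: "v s t $ j = 1" and vi: "v s t $ i = z s t" for s t
    using ij by (simp_all add: v_def axis_def)
  have v0: "v s t \<noteq> 0" for s t using vj[of s t] by (metis zero_index zero_neq_one)
  have ax: "bounded_linear (axis i :: complex \<Rightarrow> complex^'n)"
    by (auto intro!: linearI simp: linear_conv_bounded_linear[symmetric] vec_eq_iff axis_def)
  have z_s: "((\<lambda>s. z s t) has_vector_derivative z s t) (at s)"
    and z_t: "((\<lambda>t. z s t) has_vector_derivative \<i> * z s t) (at t)" for s t
    unfolding z_def complex_eq Complex_eq
    by (auto intro!: derivative_eq_intros has_vector_derivative_real_field simp: mult.commute)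
  have v_s: "((\<lambda>s. v s t) has_vector_derivative axis i (z s t)) (at s)"
    and v_t: "((\<lambda>t. v s t) has_vector_derivative axis i (\<i> * z s t)) (at t)" for s t
    unfolding v_def
    using bounded_linear.has_vector_derivative[OF ax z_s] bounded_linear.has_vector_derivative[OF ax z_t]
    by (auto intro!: derivative_eq_intros)
  define g where "g s t = - lie_deriv (unit_entry i 1) \<Phi> (v s t)" for s t
  have g_eq: "g s t = fder \<Phi> (v s t) (axis i (z s t))"
    "g s t = fder \<Psi> (v s t) (axis i (\<i> * z s t))" for s t
  proof -
    show "g s t = fder \<Phi> (v s t) (axis i (z s t))"
      by (simp add: g_def lie_deriv_def v0 unit_entry_mult vi)
    have "g s t = - lie_deriv (unit_entry i \<i>) \<Psi> (v s t)" unfolding g_def using closed[of "v s t"] vj by simp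
    then show "g s t = fder \<Psi> (v s t) (axis i (\<i> * z s t))"
      by (simp add: lie_deriv_def v0 unit_entry_mult vi)
  qed
  have \<Phi>_s: "((\<lambda>s. \<Phi> (v s t)) has_vector_derivative g s t) (at s)" for s t
    unfolding g_eq(1) by (rule has_vector_derivative_compose[OF v_s smooth_onD(1)[OF \<Phi>]]) (simp add: v0)
  have \<Psi>_t: "((\<lambda>t. \<Psi> (v s t)) has_vector_derivative g s t) (at t)" for s t
    unfolding g_eq(2) by (rule has_vector_derivative_compose[OF v_t smooth_onD(1)[OF \<Psi>]]) (simp add: v0)
  have cont_v: "continuous_on UNIV (\<lambda>(s, t). v s t)"
    unfolding v_def z_def Complex_eq case_prod_unfold
    by (intro continuous_intros bounded_linear.continuous_on[OF ax])
  have cont: "continuous_on UNIV (\<lambda>(s, t). \<phi> (v s t))" if "smooth_punctured \<phi>" for \<phi> :: "complex^'n \<Rightarrow> complex"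
  proof -
    have "(\<lambda>(s, t). v s t) ` UNIV \<subseteq> - {0}" using v0 by auto
    from continuous_on_compose2[OF smooth_onD(3)[OF that] cont_v this]
    show ?thesis by (simp add: case_prod_unfold)
  qed
  have cont_t: "continuous_on X (\<lambda>t. \<Phi> (v s t))" for s X
  proof -
    have "continuous_on X (\<lambda>t. (s, t))" by (intro continuous_intros)
    from continuous_on_compose2[OF cont[OF \<Phi>] this] show ?thesis by simp
  qed
  define J where "J s = integral {0..2 * pi} (\<lambda>t. \<Phi> (v s t))" for s
  have int: "(\<lambda>t. \<Phi> (v s t)) integrable_on {0..2 * pi}" for s
    using integrable_continuous_real[OF cont_t] .
  have "(J has_vector_derivative 0) (at s)" for s
  proof -
    have "continuous_on UNIV (\<lambda>(s, t). - lie_deriv (unit_entry i 1) \<Phi> (v s t))"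
      using continuous_on_minus[OF cont[OF smooth_punctured_lie_deriv[OF \<Phi>]]] by (simp add: case_prod_unfold)
    then have "continuous_on (UNIV \<times> cbox 0 (2 * pi)) (\<lambda>(s, t). g s t)"
      unfolding g_def by (rule continuous_on_subset) simp
    then have "((\<lambda>s. integral (cbox 0 (2 * pi)) (\<lambda>t. \<Phi> (v s t))) has_vector_derivative
        integral (cbox 0 (2 * pi)) (g s)) (at s within UNIV)"
      using \<Phi>_s int by (intro leibniz_rule_vector_derivative) auto
    moreover have "(g s has_integral \<Psi> (v s (2 * pi)) - \<Psi> (v s 0)) {0..2 * pi}"
      by (rule fundamental_theorem_of_calculus) (auto intro: has_vector_derivative_at_within \<Psi>_t)
    moreover have "v s (2 * pi) = v s 0"
      using exp_two_pi_i by (simp add: v_def z_def Complex_eq exp_add mult_ac)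
    ultimately show ?thesis by (simp add: J_def[abs_def] integral_unique)
  qed
  then obtain c where c: "\<And>s. J s = c"
    using has_vector_derivative_zero_constant[of UNIV J] by auto
  have limit: "c = (2 * pi) *\<^sub>R \<Phi> q"
    if q: "q \<noteq> 0" and u: "\<And>d. d > 0 \<Longrightarrow> \<exists>s. \<forall>t. \<exists>u. \<Phi> (v s t) = \<Phi> u \<and> dist u q < d" for q
  proof -
    have "norm (c - (2 * pi) *\<^sub>R \<Phi> q) \<le> e" if e: "e > 0" for e
    proof -
      have "isCont \<Phi> q" using smooth_onD(3)[OF \<Phi>] q by (simp add: continuous_on_eq_continuous_at open_punctured)
      then obtain d where d: "d > 0" "\<And>u. dist u q < d \<Longrightarrow> dist (\<Phi> u) (\<Phi> q) < e / (2 * pi)"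
        unfolding continuous_at_eps_delta using e by (metis divide_pos_pos pi_gt_zero zero_less_mult_iff zero_less_numeral)
      obtain s where s: "\<And>t. \<exists>u. \<Phi> (v s t) = \<Phi> u \<and> dist u q < d" using u[OF d(1)] by blast
      have "norm (\<Phi> (v s t) - \<Phi> q) \<le> e / (2 * pi)" for t
        using s[of t] d(2) by (force simp: dist_norm)
      from integral_near_constant[OF int this] show ?thesis
        unfolding J_def[symmetric] c by simp
    qed
    then have "norm (c - (2 * pi) *\<^sub>R \<Phi> q) \<le> 0" by (rule field_le_epsilon) simp
    then show ?thesis by simp
  qed
  have norm_axis: "norm (axis k y :: complex^'n) = norm y" for k y
    by (simp add: norm_eq_sqrt_inner inner_axis_axis)
  have "c = (2 * pi) *\<^sub>R \<Phi> (axis j 1)"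
  proof (rule limit)
    fix d :: real assume d: "d > 0"
    have "dist (v (ln d - 1) t) (axis j 1) < d" for t
      using d by (simp add: v_def dist_norm norm_axis z_def exp_diff divide_less_eq)
    then show "\<exists>s. \<forall>t. \<exists>u. \<Phi> (v s t) = \<Phi> u \<and> dist u (axis j 1) < d" by blast
  qed simp
  moreover have "c = (2 * pi) *\<^sub>R \<Phi> (axis i 1)"
  proof (rule limit)
    fix d :: real assume d: "d > 0"
    define s where "s = 1 - ln d"
    have "\<exists>u. \<Phi> (v s t) = \<Phi> u \<and> dist u (axis i 1) < d" for t
    proof (intro exI conjI)
      \<comment> \<open>Near the other pole the affine coordinate is inverted.\<close>
      have nz: "inverse (z s t) \<noteq> 0" by (simp add: z_def)
      have "inverse (z s t) *s v s t = axis i 1 + axis j (inverse (z s t))"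
        by (auto simp: vec_eq_iff v_def axis_def z_def)
      then show "\<Phi> (v s t) = \<Phi> (axis i 1 + axis j (inverse (z s t)))" using hom[OF nz, of "v s t"] by simp
      show "dist (axis i 1 + axis j (inverse (z s t))) (axis i 1) < d"
        using d by (simp add: dist_norm norm_axis z_def norm_inverse s_def exp_diff divide_less_eq)
    qed
    then show "\<exists>s. \<forall>t. \<exists>u. \<Phi> (v s t) = \<Phi> u \<and> dist u (axis i 1) < d" by blast
  qed simp
  ultimately show ?thesis by simp
qed

section \<open>There is no symplectic twist star product\<close>

lemma (in symplectic_r_matrix) card_less_2: "CARD('n) < 2"
proof (rule ccontr)
  assume "\<not> CARD('n) < 2"
  then obtain i j :: 'n where ij: "i \<noteq> j"
    by (metis card_2_iff' ex_card not_less UNIV_I)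
  obtain f where f: "pull f = moment (unit_entry i \<i>)" using moment_pull by blast
  have "moment (unit_entry i \<i>) (axis i 1) = moment (unit_entry i \<i>) (axis j 1)"
  proof (rule closed_form_no_period[OF smooth_moment smooth_moment _ ij])
    show "moment (unit_entry i \<i>) (k *s v) = moment (unit_entry i \<i>) v" if "k \<noteq> 0" for k v
      unfolding f[symmetric] by (rule pull_scale[OF that])
    show "lie_deriv (unit_entry i 1) (moment (unit_entry i \<i>)) v
        = lie_deriv (unit_entry i \<i>) (moment (unit_entry i 1)) v" if "v $ j \<noteq> 0" for v
      by (rule moment_closed[OF unit_entry_commute _ _ that])
        (use ij in \<open>simp_all add: unit_entry_mult axis_def\<close>)
  qed
  moreover have "moment (unit_entry i \<i>) (axis i 1) = - \<i>"
    by (rule moment_fixed_point) (simp_all add: unit_entry_mult vec_eq_iff axis_def)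
  moreover have "moment (unit_entry i \<i>) (axis j 1) = - 0"
    by (rule moment_fixed_point) (use ij in \<open>simp_all add: unit_entry_mult vec_eq_iff axis_def\<close>)
  ultimately show False by simp
qed

theorem corollary12:
  assumes "CARD('n::finite) \<ge> 2"
  shows "\<not> (\<exists>(S :: 'n uea fps set) F s.
            sub_bialgebra S \<and> twist S F \<and> symplectic_star_product s \<and> induced_by_twist F s)"
proof safe
  fix S :: "'n uea fps set" and F s
  assume F: "twist S F" and ind: "induced_by_twist F s" and "symplectic_star_product s"
  then obtain \<omega> P where \<omega>: "symplectic_form \<omega>" and br: "bracket_from_form \<omega> P" and star: "star_product P s"
    unfolding symplectic_star_product_def by blast
  have P: "P f g \<in> C_inf" if "f \<in> C_inf" "g \<in> C_inf" for f g
    using star that unfolding star_product_def poisson_bracket_def by blast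
  have \<omega>': "two_form \<omega>" using \<omega> by (simp add: symplectic_form_def)
  show False
  proof (rule induced_star_product_classical_limit[OF F ind star])
    fix N c a b
    assume "\<And>f g. f \<in> C_inf \<Longrightarrow> g \<in> C_inf \<Longrightarrow> rmat N c a b (pull f) (pull g) = \<i> *\<^sub>C pull (P f g)"
      "\<And>\<phi> \<psi>. smooth_punctured \<phi> \<Longrightarrow> smooth_punctured \<psi> \<Longrightarrow> rmat N c a b \<phi> \<psi> = - rmat N c a b \<psi> \<phi>"
      "\<And>\<phi> \<psi> \<theta>. smooth_punctured \<phi> \<Longrightarrow> smooth_punctured \<psi> \<Longrightarrow> smooth_punctured \<theta> \<Longrightarrow>
         rmat N c a b \<phi> (rmat N c a b \<psi> \<theta>) - rmat N c a b \<psi> (rmat N c a b \<phi> \<theta>)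
         = rmat N c a b (rmat N c a b \<phi> \<psi>) \<theta>"
    from symplectic_r_matrix.card_less_2[OF symplectic_r_matrix_of_form[OF \<omega>' br P this]]
    show False using assms by simp
  qed
qed

end
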